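(* Let $\Omega\subset\mathbb{R}^2$ be a bounded simply connected domain and $\psi:\partial\Omega\to\mathbb{R}$ a continuous function such that $(\Omega,\psi)$ satisfies a bounded slope condition. Let $f$ be an admissible Lagrangean, and let $(f_n)_{n\in\mathbb{N}}$ be a sequence of functions on $[0,+\infty)$, each strictly convex, in $C^1([0,+\infty))\cap C^{2,\lambda}_{loc}((0,+\infty))$, with $f_n'(0)=0$, and converging uniformly to $f$ on $[0,+\infty)$. Let $u$ (resp. $u_n$) be the unique minimizer of $\mathcal{J}(w)=\int_\Omega f(|\nabla w|)\,dx\,dy$ (resp. of $\mathcal{J}_n(w)=\int_\Omega f_n(|\nabla w|)\,dx\,dy$) among all $w\in\mathrm{Lip}(\overline\Omega)$ with $w=\psi$ on $\partial\Omega$. Let $v_n$ be the unique Lipschitz continuous function with $\int_\Omega v_n=0$ satisfying, in the sense of distributions in $\Omega$, $$\partial_x v_n=-f_n'(|\nabla u_n|)\frac{\partial_y u_n}{|\nabla u_n|},\qquad \partial_y v_n=f_n'(|\nabla u_n|)\frac{\partial_x u_n}{|\nabla u_n|}.$$ Assume also that the gradients $\nabla u_n$ converge to $\nabla u$ almost everywhere in $\Omega$. Then $(v_n)_{n\in\mathbb{N}}$ contains a subsequence which converges uniformly on $\overline\Omega$ to a function $v\in W^{1,\infty}(\Omega)$, and the pair $(u,v)$ satisfies $$\partial_x u=g'(|\nabla v|)\frac{\partial_y v}{|\nabla v|},\qquad \partial_y u=-g'(|\nabla v|)\frac{\partial_x v}{|\nabla v|}$$ almost everywhere in $\Omega$,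 where $g(r)=\sup\{\rho r-f(\rho):\rho\ge0\}$ for $r\in[0,\infty)$.
   Context: An admissible Lagrangean is a function $f:[0,+\infty)\to\mathbb{R}$ that is strictly convex, belongs to $C^1([0,+\infty))\cap C^{2,\lambda}_{loc}((0,+\infty))$ for some $0<\lambda<1$, satisfies $f'(0)>0$, and is such that $\rho f''(\rho)/f'(\rho)$ has finite limits as $\rho\to0^+$ and as $\rho\to+\infty$, the limit at $+\infty$ being strictly positive. $\mathrm{Lip}(\overline\Omega)$ is the space of Lipschitz continuous functions on $\overline\Omega$. The pair $(\Omega,\psi)$ satisfies a bounded slope condition (with constant $Q>0$) if for every $x_0\in\partial\Omega$ there exist two affine functions $L^+,L^-$ such that $L^-\le\psi\le L^+$ on $\partial\Omega$, $L^-(x_0)=\psi(x_0)=L^+(x_0)$, and $\sup_{x,y\in\Omega,\,x\ne y}\frac{|L^\pm(x)-L^\pm(y)|}{|x-y|}\le Q$. The right-hand sides of the two systems are understood to be $0$ where $\nabla u_n=0$, respectively where $\nabla v=0$ (note $f_n'(0)=0$, and $g'=0$ on $[0,f'(0)]$). *)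

theory Defs
  imports "HOL-Analysis.Analysis"
begin

section \<open>Lagrangeans\<close>

text \<open>A function on \<open>[0,\<infinity>)\<close> is a total function on the reals of which only the values on \<open>{0..}\<close>
  matter.  Its derivative is taken relative to \<open>{0..}\<close>: it is one-sided at 0 and the ordinary
  derivative at positive arguments.\<close>

definition half_deriv :: "(real \<Rightarrow> real) \<Rightarrow> real \<Rightarrow> real" where
  "half_deriv f r = vector_derivative f (at r within {0..})"

definition strictly_convex_on :: "'a::real_vector set \<Rightarrow> ('a \<Rightarrow> real) \<Rightarrow> bool" where
  "strictly_convex_on S f \<longleftrightarrow>
     convex S \<and>
     (\<forall>x\<in>S. \<forall>y\<in>S. \<forall>t. x \<noteq> y \<and> 0 < t \<and> t < 1 \<longrightarrow>
        f ((1 - t) *\<^sub>R x + t *\<^sub>R y) < (1 - t) * f x + t * f y)"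

definition C1_half :: "(real \<Rightarrow> real) \<Rightarrow> bool" where
  "C1_half f \<longleftrightarrow> f differentiable_on {0..} \<and> continuous_on {0..} (half_deriv f)"

definition locally_holder_on :: "real \<Rightarrow> real set \<Rightarrow> (real \<Rightarrow> real) \<Rightarrow> bool" where
  "locally_holder_on \<alpha> S h \<longleftrightarrow>
     (\<forall>K. compact K \<and> K \<subseteq> S \<longrightarrow>
        (\<exists>C. \<forall>x\<in>K. \<forall>y\<in>K. \<bar>h x - h y\<bar> \<le> C * \<bar>x - y\<bar> powr \<alpha>))"

definition C2_holder_loc :: "real \<Rightarrow> (real \<Rightarrow> real) \<Rightarrow> bool" where
  "C2_holder_loc \<alpha> f \<longleftrightarrow>
     f differentiable_on {0<..} \<and> half_deriv f differentiable_on {0<..} \<and>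
     locally_holder_on \<alpha> {0<..} (half_deriv (half_deriv f))"

definition regular_Lagrangean :: "(real \<Rightarrow> real) \<Rightarrow> bool" where
  "regular_Lagrangean f \<longleftrightarrow>
     strictly_convex_on {0..} f \<and> C1_half f \<and>
     (\<exists>\<alpha>. 0 < \<alpha> \<and> \<alpha> < 1 \<and> C2_holder_loc \<alpha> f)"

definition admissible_Lagrangean :: "(real \<Rightarrow> real) \<Rightarrow> bool" where
  "admissible_Lagrangean f \<longleftrightarrow>
     regular_Lagrangean f \<and> half_deriv f 0 > 0 \<and>
     (\<exists>a. ((\<lambda>\<rho>. \<rho> * half_deriv (half_deriv f) \<rho> / half_deriv f \<rho>) \<longlongrightarrow> a) (at_right 0)) \<and>
     (\<exists>b>0. ((\<lambda>\<rho>. \<rho> * half_deriv (half_deriv f) \<rho> / half_deriv f \<rho>) \<longlongrightarrow> b) at_top)"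

definition conjugate_Lagrangean :: "(real \<Rightarrow> real) \<Rightarrow> real \<Rightarrow> real" where
  "conjugate_Lagrangean f r = (SUP \<rho>\<in>{0..}. \<rho> * r - f \<rho>)"


section \<open>Weak derivatives\<close>

primrec Ck :: "nat \<Rightarrow> ('a::euclidean_space \<Rightarrow> real) \<Rightarrow> bool" where
  "Ck 0 \<phi> \<longleftrightarrow> continuous_on UNIV \<phi>"
| "Ck (Suc k) \<phi> \<longleftrightarrow>
     \<phi> differentiable_on UNIV \<and>
     (\<forall>b\<in>Basis. Ck k (\<lambda>x. frechet_derivative \<phi> (at x) b))"

definition test_function :: "'a::euclidean_space set \<Rightarrow> ('a \<Rightarrow> real) \<Rightarrow> bool" where
  "test_function \<Omega> \<phi> \<longleftrightarrow>
     (\<forall>k. Ck k \<phi>) \<and> (\<exists>K. compact K \<and> K \<subseteq> \<Omega> \<and> (\<forall>x. x \<notin> K \<longrightarrow> \<phi> x = 0))"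

definition locally_integrable_on :: "'a::euclidean_space set \<Rightarrow> ('a \<Rightarrow> 'b::euclidean_space) \<Rightarrow> bool" where
  "locally_integrable_on \<Omega> w \<longleftrightarrow>
     (\<forall>K. compact K \<and> K \<subseteq> \<Omega> \<longrightarrow> w absolutely_integrable_on K)"

definition has_weak_partial ::
  "'a::euclidean_space set \<Rightarrow> 'a \<Rightarrow> ('a \<Rightarrow> real) \<Rightarrow> ('a \<Rightarrow> real) \<Rightarrow> bool" where
  "has_weak_partial \<Omega> b w h \<longleftrightarrow>
     locally_integrable_on \<Omega> w \<and> locally_integrable_on \<Omega> h \<and>
     (\<forall>\<phi>. test_function \<Omega> \<phi> \<longrightarrow>
        (LINT x|lebesgue_on \<Omega>. w x * frechet_derivative \<phi> (at x) b)
          = - (LINT x|lebesgue_on \<Omega>. h x * \<phi> x))"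

definition has_weak_gradient ::
  "'a::euclidean_space set \<Rightarrow> ('a \<Rightarrow> real) \<Rightarrow> ('a \<Rightarrow> 'a) \<Rightarrow> bool" where
  "has_weak_gradient \<Omega> w G \<longleftrightarrow> (\<forall>b\<in>Basis. has_weak_partial \<Omega> b w (\<lambda>x. G x \<bullet> b))"

text \<open>On an open set a weak gradient is unique up to a null set, and it exists for every Lipschitz
  function, where it coincides almost everywhere with the classical gradient.  The function below
  picks one representative; it is only used inside integrals and in statements that hold almost
  everywhere.\<close>

definition weak_gradient :: "'a::euclidean_space set \<Rightarrow> ('a \<Rightarrow> real) \<Rightarrow> 'a \<Rightarrow> 'a" where
  "weak_gradient \<Omega> w = (SOME G. has_weak_gradient \<Omega> w G)"

definition ess_bounded_on :: "'a::euclidean_space set \<Rightarrow> ('a \<Rightarrow> 'b::euclidean_space) \<Rightarrow> bool" where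
  "ess_bounded_on \<Omega> w \<longleftrightarrow>
     w \<in> borel_measurable (lebesgue_on \<Omega>) \<and> (\<exists>C. AE x in lebesgue_on \<Omega>. norm (w x) \<le> C)"

definition W1_infinity :: "'a::euclidean_space set \<Rightarrow> ('a \<Rightarrow> real) \<Rightarrow> bool" where
  "W1_infinity \<Omega> w \<longleftrightarrow>
     ess_bounded_on \<Omega> w \<and> (\<exists>G. has_weak_gradient \<Omega> w G \<and> ess_bounded_on \<Omega> G)"


section \<open>The variational problem\<close>

definition affine_function :: "('a::real_vector \<Rightarrow> real) \<Rightarrow> bool" where
  "affine_function L \<longleftrightarrow> (\<exists>h c. linear h \<and> L = (\<lambda>x. h x + c))"

definition bounded_slope_condition ::
  "'a::euclidean_space set \<Rightarrow> ('a \<Rightarrow> real) \<Rightarrow> real \<Rightarrow> bool" where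
  "bounded_slope_condition \<Omega> \<psi> Q \<longleftrightarrow>
     (\<forall>x0\<in>frontier \<Omega>. \<exists>Lp Lm.
        affine_function Lp \<and> affine_function Lm \<and>
        (\<forall>x\<in>frontier \<Omega>. Lm x \<le> \<psi> x \<and> \<psi> x \<le> Lp x) \<and>
        Lm x0 = \<psi> x0 \<and> Lp x0 = \<psi> x0 \<and>
        (\<forall>x\<in>\<Omega>. \<forall>y\<in>\<Omega>. x \<noteq> y \<longrightarrow>
           \<bar>Lp x - Lp y\<bar> / norm (x - y) \<le> Q \<and> \<bar>Lm x - Lm y\<bar> / norm (x - y) \<le> Q))"

definition Lip :: "'a::metric_space set \<Rightarrow> ('a \<Rightarrow> real) set" where
  "Lip S = {w. \<exists>C. C-lipschitz_on S w}"

definition energy :: "'a::euclidean_space set \<Rightarrow> (real \<Rightarrow> real) \<Rightarrow> ('a \<Rightarrow> real) \<Rightarrow> real" where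
  "energy \<Omega> f w = (LINT x|lebesgue_on \<Omega>. f (norm (weak_gradient \<Omega> w x)))"

definition competitors :: "'a::euclidean_space set \<Rightarrow> ('a \<Rightarrow> real) \<Rightarrow> ('a \<Rightarrow> real) set" where
  "competitors \<Omega> \<psi> = {w \<in> Lip (closure \<Omega>). \<forall>x\<in>frontier \<Omega>. w x = \<psi> x}"

definition is_minimizer ::
  "'a::euclidean_space set \<Rightarrow> ('a \<Rightarrow> real) \<Rightarrow> (real \<Rightarrow> real) \<Rightarrow> ('a \<Rightarrow> real) \<Rightarrow> bool" where
  "is_minimizer \<Omega> \<psi> f u \<longleftrightarrow>
     u \<in> competitors \<Omega> \<psi> \<and> (\<forall>w\<in>competitors \<Omega> \<psi>. energy \<Omega> f u \<le> energy \<Omega> f w)"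


section \<open>The first-order systems in the plane\<close>

text \<open>In both systems the right-hand side is 0 where the gradient vanishes; this is built in, since
  division by zero yields 0.\<close>

definition conjugate_distributional ::
  "(real^2) set \<Rightarrow> (real \<Rightarrow> real) \<Rightarrow> (real^2 \<Rightarrow> real) \<Rightarrow> (real^2 \<Rightarrow> real) \<Rightarrow> bool" where
  "conjugate_distributional \<Omega> f u v \<longleftrightarrow>
     (let Du = weak_gradient \<Omega> u in
        has_weak_partial \<Omega> (axis 1 1) v
          (\<lambda>x. - half_deriv f (norm (Du x)) * (Du x $ 2 / norm (Du x))) \<and>
        has_weak_partial \<Omega> (axis 2 1) v
          (\<lambda>x. half_deriv f (norm (Du x)) * (Du x $ 1 / norm (Du x))))"

definition dual_system_ae ::
  "(real^2) set \<Rightarrow> (real \<Rightarrow> real) \<Rightarrow> (real^2 \<Rightarrow> real) \<Rightarrow> (real^2 \<Rightarrow> real) \<Rightarrow> bool" where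
  "dual_system_ae \<Omega> g u v \<longleftrightarrow>
     (let Du = weak_gradient \<Omega> u; Dv = weak_gradient \<Omega> v in
        AE x in lebesgue_on \<Omega>.
          Du x $ 1 = half_deriv g (norm (Dv x)) * (Dv x $ 2 / norm (Dv x)) \<and>
          Du x $ 2 = - half_deriv g (norm (Dv x)) * (Dv x $ 1 / norm (Dv x)))"

end

theory Submission
  imports Defs "HOL-Complex_Analysis.Great_Picard"
begin

text \<open>The idea of the proof.  Minimality of \<open>u\<^sub>n\<close> together with the bounded slope condition gives a
  bound for \<open>\<nabla>u\<^sub>n\<close> that does not depend on \<open>n\<close>.  This is the classical comparison argument:
  the affine functions of the condition are barriers at the boundary, and comparing a minimizer with
  its own translates carries the boundary estimate into the interior (\<open>minimizer_gradient_bound\<close>).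
  It rests on the strict convexity of \<open>p \<mapsto> f\<^sub>n(|p|)\<close>, which holds because \<open>f\<^sub>n'(0) = 0\<close>
  (\<open>comparison_core\<close>).

  The uniform convergence of convex functions bounds \<open>f\<^sub>n'\<close> on bounded sets, so the gradients of the
  stream functions \<open>v\<^sub>n\<close> are uniformly bounded.  A gradient bound yields a Lipschitz bound with the
  same constant on a convex domain.  The bounded slope condition forces convexity unless \<open>\<psi>\<close> is
  affine on the boundary; in that case all \<open>u\<^sub>n\<close> coincide with one affine function and all \<open>v\<^sub>n\<close> are
  affine, so the Lipschitz bound holds as well (\<open>stream_functions_equilipschitz\<close>).  Having mean value
  zero, the \<open>v\<^sub>n\<close> are also bounded, and the theorem of Arzela and Ascoli gives the subsequence and its
  Lipschitz limit \<open>v\<close>.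

  It remains to identify \<open>\<nabla>v\<close>, the weak limit of the rotated fluxes
  \<open>f\<^sub>n'(|\<nabla>u\<^sub>n|) (\<nabla>u\<^sub>n)\<^sup>\<bottom> / |\<nabla>u\<^sub>n|\<close>.  Where \<open>\<nabla>u \<noteq> 0\<close> these converge pointwise, since \<open>f\<^sub>n'\<close>
  converges to \<open>f'\<close> locally uniformly away from 0.  Where \<open>\<nabla>u = 0\<close> they need not converge,
  but the upper limit of their lengths is at most \<open>f'(0)\<close>.  Both facts are one-sided bounds on the upper
  limit in each fixed direction, and such bounds pass to weak limits (\<open>weak_limit_flux_le\<close>).  Thus
  \<open>\<nabla>v = f'(|\<nabla>u|) (\<nabla>u)\<^sup>\<bottom> / |\<nabla>u|\<close> in the first case, and \<open>|\<nabla>v| \<le> f'(0)\<close> in the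
  second.  As \<open>g'\<close> inverts \<open>f'\<close> and vanishes on \<open>[0, f'(0)]\<close> (\<open>half_deriv_conjugate\<close>), this is
  the asserted system.

  Weak gradients of Lipschitz functions are handled through almost everywhere limits of difference
  quotients (\<open>diff_quotient_converges\<close>), for which products, translations and local changes are
  elementary.  In the converse direction, a weak gradient bounds the increments of a continuous function
  along segments (\<open>weak_gradient_mean_value\<close>).\<close>

section \<open>Convex Lagrangeans and their conjugates\<close>

lemma half_line_nontrivial: "r \<ge> 0 \<Longrightarrow> at r within {0..} \<noteq> (bot::real filter)"
proof -
  assume "r \<ge> 0"
  have "at_right r \<le> at r within {0..}" using \<open>r \<ge> 0\<close> by (intro at_le) auto
  then show ?thesis using trivial_limit_at_right_real[of r] by (metis bot.extremum_uniqueI)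
qed

lemma regular_has_derivative:
  assumes "regular_Lagrangean f" "r \<ge> 0"
  shows "(f has_real_derivative half_deriv f r) (at r within {0..})"
proof -
  have "f differentiable (at r within {0..})"
    using assms unfolding regular_Lagrangean_def C1_half_def differentiable_on_def by auto
  then show ?thesis
    unfolding half_deriv_def has_real_derivative_iff_has_vector_derivative vector_derivative_works .
qed

lemma regular_continuous: "regular_Lagrangean f \<Longrightarrow> continuous_on {0..} f"
  by (metis C1_half_def differentiable_imp_continuous_on regular_Lagrangean_def)

lemma regular_continuous_deriv: "regular_Lagrangean f \<Longrightarrow> continuous_on {0..} (half_deriv f)"
  by (metis C1_half_def regular_Lagrangean_def)

lemma regular_strict_convex:
  assumes "regular_Lagrangean f" "0 \<le> x" "0 \<le> y" "x \<noteq> y" "0 < t" "t < 1"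
  shows "f ((1 - t) * x + t * y) < (1 - t) * f x + t * f y"
  using assms unfolding regular_Lagrangean_def strictly_convex_on_def by auto

lemma regular_convex:
  assumes "regular_Lagrangean f" "0 \<le> x" "0 \<le> y" "0 \<le> t" "t \<le> 1"
  shows "f ((1 - t) * x + t * y) \<le> (1 - t) * f x + t * f y"
proof (cases "x = y \<or> t = 0 \<or> t = 1")
  case True then show ?thesis by (auto simp: algebra_simps)
next
  case False then show ?thesis using regular_strict_convex[OF assms(1-3), of t] assms by auto
qed

text \<open>The secant slopes from \<open>x\<close> towards \<open>y\<close> are bounded by the full secant, by convexity, and tend
  to the derivative.\<close>

lemma regular_tangent_le:
  assumes f: "regular_Lagrangean f" and x: "0 \<le> x" and y: "0 \<le> y"
  shows "half_deriv f x * (y - x) \<le> f y - f x"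
proof (cases "x = y")
  case False
  define t where "t n = 1 / real (Suc (Suc n))" for n
  define z where "z n = x + t n * (y - x)" for n
  have t: "0 < t n" "t n < 1" for n unfolding t_def by auto
  have t0: "t \<longlonglongrightarrow> 0" unfolding t_def by (intro LIMSEQ_Suc lim_1_over_n)
  have z_alt: "z n = (1 - t n) * x + t n * y" for n unfolding z_def by (simp add: algebra_simps)
  have z0: "z n \<ge> 0" for n
    unfolding z_alt using t[of n] x y by (intro add_nonneg_nonneg mult_nonneg_nonneg) auto
  have zx: "z n \<noteq> x" for n unfolding z_def using t[of n] False by auto
  have "z \<longlonglongrightarrow> x + 0 * (y - x)" unfolding z_def by (intro tendsto_intros t0)
  then have "filterlim z (at x within {0..}) sequentially"
    using zx z0 by (simp add: filterlim_at)
  moreover have "((\<lambda>w. (f w - f x) / (w - x)) \<longlongrightarrow> half_deriv f x) (at x within {0..})"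
    using regular_has_derivative[OF f x] unfolding has_field_derivative_iff .
  ultimately have "(\<lambda>n. (f (z n) - f x) / (z n - x)) \<longlonglongrightarrow> half_deriv f x"
    by (rule filterlim_compose[rotated])
  then have lim: "(\<lambda>n. (f (z n) - f x) / (z n - x) * (y - x)) \<longlonglongrightarrow> half_deriv f x * (y - x)"
    by (intro tendsto_intros)
  have "(f (z n) - f x) / (z n - x) * (y - x) \<le> f y - f x" for n
  proof -
    have "f (z n) \<le> (1 - t n) * f x + t n * f y"
      unfolding z_alt using t[of n] by (intro regular_convex f x y) auto
    then have "f (z n) - f x \<le> t n * (f y - f x)" by (simp add: algebra_simps)
    moreover have "(f (z n) - f x) / (z n - x) * (y - x) = (f (z n) - f x) / t n"
      unfolding z_def using False t[of n] by (simp add: field_simps)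
    ultimately show ?thesis using t[of n] by (simp add: divide_le_eq mult.commute)
  qed
  then show ?thesis by (intro LIMSEQ_le_const2[OF lim]) auto
qed auto

lemma regular_tangent_less:
  assumes f: "regular_Lagrangean f" and x: "0 \<le> x" and y: "0 \<le> y" and "x \<noteq> y"
  shows "half_deriv f x * (y - x) < f y - f x"
proof -
  have "half_deriv f x * ((x + y) / 2 - x) \<le> f ((x + y) / 2) - f x"
    using x y by (intro regular_tangent_le f) auto
  moreover have "(1 - 1/2) * x + (1/2) * y = (x + y) / 2" by (simp add: field_simps)
  then have "f ((x + y) / 2) < (1 - 1/2) * f x + 1/2 * f y"
    using regular_strict_convex[OF f x y \<open>x \<noteq> y\<close>, of "1/2"] by (metis half_gt_zero_iff less_numeral_extra(1) divide_less_eq_1_pos one_less_numeral_iff semiring_norm(76) zero_less_numeral)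
  ultimately show ?thesis by (simp add: field_simps)
qed

lemma regular_deriv_strict_mono:
  assumes f: "regular_Lagrangean f" and "0 \<le> x" "x < y"
  shows "half_deriv f x < half_deriv f y"
proof -
  have "half_deriv f x * (y - x) < f y - f x" "half_deriv f y * (x - y) < f x - f y"
    using assms by (auto intro!: regular_tangent_less)
  then have "0 < (half_deriv f y - half_deriv f x) * (y - x)" by (simp add: algebra_simps)
  then show ?thesis using \<open>x < y\<close> by (simp add: zero_less_mult_iff)
qed

lemma regular_deriv_mono:
  assumes "regular_Lagrangean f" and "0 \<le> x" "x \<le> y"
  shows "half_deriv f x \<le> half_deriv f y"
  using regular_deriv_strict_mono[of f x y] assms by (cases "x = y") auto

text \<open>The slope \<open>r\<close> is attached to the point \<open>\<rho>\<close> when the line of slope \<open>r\<close> through \<open>(\<rho>, f \<rho>)\<close>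
  stays below the graph of \<open>f\<close> on the half-line; at 0 these are all slopes up to \<open>f'(0)\<close>.  This
  is the Legendre correspondence, and \<open>\<rho>\<close> is then the point at which the supremum defining the
  conjugate is attained.\<close>

definition supports_at :: "(real \<Rightarrow> real) \<Rightarrow> real \<Rightarrow> real \<Rightarrow> bool" where
  "supports_at f r \<rho> \<longleftrightarrow> \<rho> \<ge> 0 \<and> (r = half_deriv f \<rho> \<or> \<rho> = 0 \<and> r \<le> half_deriv f 0)"

lemma supports_at_max:
  assumes f: "regular_Lagrangean f" and s: "supports_at f r \<rho>" and "0 \<le> \<sigma>"
  shows "\<sigma> * r - f \<sigma> \<le> \<rho> * r - f \<rho>"
proof (cases "r = half_deriv f \<rho>")
  case True
  then show ?thesis using regular_tangent_le[OF f, of \<rho> \<sigma>] s \<open>0 \<le> \<sigma>\<close>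
    unfolding supports_at_def by (simp add: algebra_simps)
next
  case False
  then have "\<rho> = 0" "r \<le> half_deriv f 0" using s unfolding supports_at_def by auto
  then have "r * \<sigma> \<le> half_deriv f 0 * \<sigma>" using \<open>0 \<le> \<sigma>\<close> by (intro mult_right_mono) auto
  also have "\<dots> \<le> f \<sigma> - f 0" using regular_tangent_le[OF f, of 0 \<sigma>] \<open>0 \<le> \<sigma>\<close> by simp
  finally show ?thesis using \<open>\<rho> = 0\<close> by (simp add: algebra_simps)
qed

lemma conjugate_eq:
  assumes f: "regular_Lagrangean f" and s: "supports_at f r \<rho>"
  shows "conjugate_Lagrangean f r = \<rho> * r - f \<rho>"
  unfolding conjugate_Lagrangean_def
proof (rule cSup_eq_maximum)
  show "\<rho> * r - f \<rho> \<in> (\<lambda>\<rho>. \<rho> * r - f \<rho>) ` {0..}" using s unfolding supports_at_def by auto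
qed (use supports_at_max[OF f s] in auto)

text \<open>As \<open>f'\<close> is continuous and strictly increasing, the intermediate value theorem shows that the
  attaching point depends continuously on the slope.\<close>

lemma supports_at_nearby:
  assumes f: "regular_Lagrangean f" and s: "supports_at f r \<rho>" and "e > 0"
  shows "\<exists>d>0. \<forall>r'. \<bar>r' - r\<bar> < d \<longrightarrow> (\<exists>\<rho>'. supports_at f r' \<rho>' \<and> \<bar>\<rho>' - \<rho>\<bar> \<le> e)"
proof -
  have \<rho>: "\<rho> \<ge> 0" using s unfolding supports_at_def by auto
  have ivt: "\<exists>\<sigma>. a \<le> \<sigma> \<and> \<sigma> \<le> b \<and> half_deriv f \<sigma> = r'"
    if "0 \<le> a" "a \<le> b" "half_deriv f a \<le> r'" "r' \<le> half_deriv f b" for a b r'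
    using that by (intro IVT' continuous_on_subset[OF regular_continuous_deriv[OF f]]) auto
  have up: "r < half_deriv f (\<rho> + e)"
    using s regular_deriv_strict_mono[OF f, of \<rho> "\<rho> + e"] \<rho> \<open>e > 0\<close> unfolding supports_at_def by auto
  show ?thesis
  proof (cases "\<rho> = 0")
    case True
    show ?thesis
    proof (rule exI[of _ "half_deriv f (\<rho> + e) - r"], intro conjI allI impI)
      show "half_deriv f (\<rho> + e) - r > 0" using up by simp
      fix r' assume r': "\<bar>r' - r\<bar> < half_deriv f (\<rho> + e) - r"
      show "\<exists>\<rho>'. supports_at f r' \<rho>' \<and> \<bar>\<rho>' - \<rho>\<bar> \<le> e"
      proof (cases "r' \<le> half_deriv f 0")
        case True then show ?thesis
          using \<open>\<rho> = 0\<close> \<open>e > 0\<close> by (intro exI[of _ 0]) (auto simp: supports_at_def)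
      next
        case False
        then obtain \<sigma> where "0 \<le> \<sigma>" "\<sigma> \<le> e" "half_deriv f \<sigma> = r'"
          using ivt[of 0 e r'] r' \<open>\<rho> = 0\<close> \<open>e > 0\<close> by fastforce
        then show ?thesis using \<open>\<rho> = 0\<close> by (intro exI[of _ \<sigma>]) (auto simp: supports_at_def)
      qed
    qed
  next
    case False
    then have r: "r = half_deriv f \<rho>" using s unfolding supports_at_def by auto
    define a where "a = max 0 (\<rho> - e)"
    have a: "0 \<le> a" "a < \<rho>" "\<rho> - e \<le> a" using False \<rho> \<open>e > 0\<close> unfolding a_def by auto
    have low: "half_deriv f a < r" unfolding r using a by (intro regular_deriv_strict_mono f) auto
    show ?thesis
    proof (rule exI[of _ "min (half_deriv f (\<rho> + e) - r) (r - half_deriv f a)"], intro conjI allI impI)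
      show "min (half_deriv f (\<rho> + e) - r) (r - half_deriv f a) > 0" using up low by simp
      fix r' assume r': "\<bar>r' - r\<bar> < min (half_deriv f (\<rho> + e) - r) (r - half_deriv f a)"
      then obtain \<sigma> where "a \<le> \<sigma>" "\<sigma> \<le> \<rho> + e" "half_deriv f \<sigma> = r'"
        using ivt[of a "\<rho> + e" r'] a \<open>e > 0\<close> by fastforce
      then show "\<exists>\<rho>'. supports_at f r' \<rho>' \<and> \<bar>\<rho>' - \<rho>\<bar> \<le> e"
        using a by (intro exI[of _ \<sigma>]) (auto simp: supports_at_def)
    qed
  qed
qed

text \<open>The difference quotients of the conjugate at \<open>r\<close> lie between the points attached to \<open>r\<close> and to
  the nearby slope, so they converge: the derivative of the conjugate inverts \<open>f'\<close>, and it vanishes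
  on \<open>[0, f'(0)]\<close>.\<close>

lemma half_deriv_conjugate:
  assumes f: "regular_Lagrangean f" and s: "supports_at f r \<rho>" and r: "r \<ge> 0"
  shows "half_deriv (conjugate_Lagrangean f) r = \<rho>"
proof -
  let ?g = "conjugate_Lagrangean f"
  have "(?g has_derivative (\<lambda>h. \<rho> * h)) (at r within {0..})"
    unfolding has_derivative_within_alt
  proof (intro conjI allI impI)
    show "bounded_linear ((*) \<rho>)" by (rule bounded_linear_mult_right)
    fix e :: real assume "e > 0"
    obtain d where "d > 0" and d: "\<And>r'. \<bar>r' - r\<bar> < d \<Longrightarrow> \<exists>\<rho>'. supports_at f r' \<rho>' \<and> \<bar>\<rho>' - \<rho>\<bar> \<le> e"
      using supports_at_nearby[OF f s \<open>e > 0\<close>] by blast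
    show "\<exists>d>0. \<forall>y\<in>{0..}. norm (y - r) < d \<longrightarrow> norm (?g y - ?g r - \<rho> * (y - r)) \<le> e * norm (y - r)"
    proof (intro exI conjI ballI impI)
      show "d > 0" by fact
      fix y :: real assume "y \<in> {0..}" "norm (y - r) < d"
      then obtain \<sigma> where \<sigma>: "supports_at f y \<sigma>" "\<bar>\<sigma> - \<rho>\<bar> \<le> e" using d by auto
      have nn: "\<rho> \<ge> 0" "\<sigma> \<ge> 0" using s \<sigma> unfolding supports_at_def by auto
      have g: "?g y = \<sigma> * y - f \<sigma>" "?g r = \<rho> * r - f \<rho>" using conjugate_eq f s \<sigma> by auto
      have lo: "0 \<le> ?g y - ?g r - \<rho> * (y - r)"
        using supports_at_max[OF f \<sigma>(1) nn(1)] unfolding g by (simp add: algebra_simps)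
      have "?g y - ?g r - \<rho> * (y - r) \<le> (\<sigma> - \<rho>) * (y - r)"
        using supports_at_max[OF f s nn(2)] unfolding g by (simp add: algebra_simps)
      also have "\<dots> \<le> \<bar>\<sigma> - \<rho>\<bar> * \<bar>y - r\<bar>" by (metis abs_ge_self abs_mult)
      also have "\<dots> \<le> e * \<bar>y - r\<bar>" using \<sigma> by (intro mult_right_mono) auto
      finally show "norm (?g y - ?g r - \<rho> * (y - r)) \<le> e * norm (y - r)" using lo by simp
    qed
  qed
  then have "(?g has_vector_derivative \<rho>) (at r within {0..})"
    unfolding has_vector_derivative_def by (simp add: mult.commute)
  then show ?thesis
    unfolding half_deriv_def using half_line_nontrivial[OF r] by (rule vector_derivative_within[rotated])
qed


section \<open>Derivatives along a uniformly convergent sequence of Lagrangeans\<close>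

lemma uniform_limit_along:
  assumes "continuous_on {0..} f" "uniform_limit {0..} fn f sequentially"
    and "\<rho> \<longlonglongrightarrow> l" "\<And>n. \<rho> n \<ge> (0::real)" "l \<ge> 0"
  shows "(\<lambda>n. fn n (\<rho> n)) \<longlonglongrightarrow> (f l :: real)"
proof -
  have "(\<lambda>n. f (\<rho> n)) \<longlonglongrightarrow> f l"
    using assms by (intro continuous_on_tendsto_compose[of "{0..}" f]) auto
  moreover have "(\<lambda>n. fn n (\<rho> n) - f (\<rho> n)) \<longlonglongrightarrow> 0"
  proof (rule LIMSEQ_I)
    fix e :: real assume "e > 0"
    then obtain N where N: "\<And>n. n \<ge> N \<Longrightarrow> \<forall>x\<in>{0..}. dist (fn n x) (f x) < e"
      using uniform_limitD[OF assms(2)] unfolding eventually_sequentially by blast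
    have "norm (fn n (\<rho> n) - f (\<rho> n) - 0) < e" if "n \<ge> N" for n
      using N[OF that] assms(4)[of n] by (simp add: dist_norm)
    then show "\<exists>N. \<forall>n\<ge>N. norm (fn n (\<rho> n) - f (\<rho> n) - 0) < e" by blast
  qed
  ultimately have "(\<lambda>n. (fn n (\<rho> n) - f (\<rho> n)) + f (\<rho> n)) \<longlonglongrightarrow> 0 + f l" by (intro tendsto_add)
  then show ?thesis by simp
qed

text \<open>Convexity squeezes \<open>f\<^sub>n'\<close> between difference quotients of \<open>f\<^sub>n\<close> with a fixed step, and these
  converge to difference quotients of \<open>f\<close>.  At 0 only the upper estimate survives: \<open>f\<^sub>n'(0)\<close> may
  be 0 for all \<open>n\<close> while \<open>f'(0) > 0\<close>.\<close>

lemma deriv_eventually_less: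
  assumes f: "regular_Lagrangean f" and fn: "\<And>n. regular_Lagrangean (fn n)"
    and lim: "uniform_limit {0..} fn f sequentially"
    and \<rho>: "\<rho> \<longlonglongrightarrow> l" "\<And>n. \<rho> n \<ge> 0" "l \<ge> 0" and c: "half_deriv f l < c"
  shows "\<forall>\<^sub>F n in sequentially. half_deriv (fn n) (\<rho> n) < c"
proof -
  have "((\<lambda>x. half_deriv f x) \<longlongrightarrow> half_deriv f l) (at l within {0..})"
    using regular_continuous_deriv[OF f] \<open>l \<ge> 0\<close> by (auto simp: continuous_on_def)
  then have "\<forall>\<^sub>F x in at l within {0..}. half_deriv f x < c" using c by (rule order_tendstoD)
  then have "\<forall>\<^sub>F x in at_right l. half_deriv f x < c"
    by (rule filter_leD[rotated]) (use \<open>l \<ge> 0\<close> in \<open>auto intro!: at_le\<close>)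
  then have "\<forall>\<^sub>F x in at_right l. half_deriv f x < c \<and> l < x"
    by (intro eventually_conj eventually_at_right_less)
  then obtain x where x: "half_deriv f x < c" "l < x"
    using eventually_happens[of _ "at_right l"] by (metis (no_types, lifting) trivial_limit_at_right_real)
  define d where "d = x - l"
  have d: "d > 0" "x = l + d" using x unfolding d_def by auto
  have "(\<lambda>n. \<rho> n + d) \<longlonglongrightarrow> l + d" by (intro tendsto_intros \<rho>)
  then have "(\<lambda>n. fn n (\<rho> n + d)) \<longlonglongrightarrow> f (l + d)"
    using \<rho> d by (intro uniform_limit_along[OF regular_continuous[OF f] lim]) (auto intro: add_nonneg_nonneg less_imp_le)
  moreover have "(\<lambda>n. fn n (\<rho> n)) \<longlonglongrightarrow> f l"
    using \<rho> by (intro uniform_limit_along[OF regular_continuous[OF f] lim])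
  ultimately have "(\<lambda>n. (fn n (\<rho> n + d) - fn n (\<rho> n)) / d) \<longlonglongrightarrow> (f (l + d) - f l) / d"
    using d by (intro tendsto_intros) auto
  moreover have "(f (l + d) - f l) / d < c"
  proof -
    have "f (l + d) - f l \<le> half_deriv f x * d"
      using regular_tangent_le[OF f, of x l] d \<open>l \<ge> 0\<close> by (simp add: algebra_simps)
    also have "\<dots> < c * d" using x d by simp
    finally show ?thesis using d by (simp add: divide_less_eq)
  qed
  ultimately have "\<forall>\<^sub>F n in sequentially. (fn n (\<rho> n + d) - fn n (\<rho> n)) / d < c"
    by (rule order_tendstoD)
  then show ?thesis
  proof (rule eventually_mono)
    fix n assume *: "(fn n (\<rho> n + d) - fn n (\<rho> n)) / d < c"
    have "half_deriv (fn n) (\<rho> n) * d \<le> fn n (\<rho> n + d) - fn n (\<rho> n)"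
      using regular_tangent_le[OF fn, of "\<rho> n" "\<rho> n + d" n] \<rho>(2)[of n] d by simp
    then have "half_deriv (fn n) (\<rho> n) \<le> (fn n (\<rho> n + d) - fn n (\<rho> n)) / d"
      using d by (simp add: le_divide_eq)
    then show "half_deriv (fn n) (\<rho> n) < c" using * by linarith
  qed
qed

lemma deriv_eventually_greater:
  assumes f: "regular_Lagrangean f" and fn: "\<And>n. regular_Lagrangean (fn n)"
    and lim: "uniform_limit {0..} fn f sequentially"
    and \<rho>: "\<rho> \<longlonglongrightarrow> l" "\<And>n. \<rho> n \<ge> 0" "l > 0" and c: "c < half_deriv f l"
  shows "\<forall>\<^sub>F n in sequentially. c < half_deriv (fn n) (\<rho> n)"
proof -
  have "((\<lambda>x. half_deriv f x) \<longlongrightarrow> half_deriv f l) (at l)"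
    using regular_continuous_deriv[OF f] \<open>l > 0\<close>
    by (metis at_within_interior atLeast_iff continuous_on_def greaterThan_iff interior_real_atLeast less_imp_le)
  then have "\<forall>\<^sub>F x in at l. c < half_deriv f x" using c by (rule order_tendstoD)
  then have "\<forall>\<^sub>F x in at_left l. c < half_deriv f x"
    by (rule filter_leD[rotated]) (auto intro!: at_le)
  then have "\<forall>\<^sub>F x in at_left l. c < half_deriv f x \<and> x \<in> {0<..<l}"
    by (intro eventually_conj eventually_at_left_real \<open>l > 0\<close>)
  then obtain x where x: "c < half_deriv f x" "0 < x" "x < l"
    using eventually_happens[of _ "at_left l"]
    by (metis (no_types, lifting) greaterThanLessThan_iff trivial_limit_at_left_real)
  define d where "d = l - x"
  have d: "d > 0" "x = l - d" using x unfolding d_def by auto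
  have "(\<lambda>n. max 0 (\<rho> n - d)) \<longlonglongrightarrow> max 0 (l - d)" by (intro tendsto_intros \<rho>)
  moreover have "max 0 (l - d) = x" using x d by auto
  ultimately have "(\<lambda>n. max 0 (\<rho> n - d)) \<longlonglongrightarrow> x" by simp
  then have "(\<lambda>n. fn n (max 0 (\<rho> n - d))) \<longlonglongrightarrow> f x"
    using x by (intro uniform_limit_along[OF regular_continuous[OF f] lim]) auto
  moreover have "(\<lambda>n. fn n (\<rho> n)) \<longlonglongrightarrow> f l"
    using \<rho> by (intro uniform_limit_along[OF regular_continuous[OF f] lim]) auto
  ultimately have "(\<lambda>n. (fn n (\<rho> n) - fn n (max 0 (\<rho> n - d))) / d) \<longlonglongrightarrow> (f l - f x) / d"
    using d by (intro tendsto_intros) auto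
  moreover have "c < (f l - f x) / d"
  proof -
    have "c * d < half_deriv f x * d" using x d by simp
    also have "\<dots> \<le> f l - f x"
      using regular_tangent_le[OF f, of x l] x unfolding d_def by simp
    finally show ?thesis using d by (simp add: less_divide_eq)
  qed
  ultimately have "\<forall>\<^sub>F n in sequentially. c < (fn n (\<rho> n) - fn n (max 0 (\<rho> n - d))) / d"
    by (rule order_tendstoD)
  moreover have "\<forall>\<^sub>F n in sequentially. d < \<rho> n"
    using x d by (intro order_tendstoD[OF \<rho>(1)]) auto
  ultimately show ?thesis
  proof eventually_elim
    fix n assume *: "c < (fn n (\<rho> n) - fn n (max 0 (\<rho> n - d))) / d" and "d < \<rho> n"
    then have "max 0 (\<rho> n - d) = \<rho> n - d" by auto
    have "fn n (\<rho> n) - fn n (\<rho> n - d) \<le> half_deriv (fn n) (\<rho> n) * d"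
      using regular_tangent_le[OF fn, of "\<rho> n" "\<rho> n - d" n] \<rho>(2)[of n] \<open>d < \<rho> n\<close> by simp
    then have "(fn n (\<rho> n) - fn n (\<rho> n - d)) / d \<le> half_deriv (fn n) (\<rho> n)"
      using d by (simp add: divide_le_eq)
    then show "c < half_deriv (fn n) (\<rho> n)" using * \<open>max 0 (\<rho> n - d) = \<rho> n - d\<close> by simp
  qed
qed

lemma deriv_tendsto:
  assumes "regular_Lagrangean f" "\<And>n. regular_Lagrangean (fn n)"
    and "uniform_limit {0..} fn f sequentially"
    and "\<rho> \<longlonglongrightarrow> l" "\<And>n. \<rho> n \<ge> 0" "l > 0"
  shows "(\<lambda>n. half_deriv (fn n) (\<rho> n)) \<longlonglongrightarrow> half_deriv f l"
proof (rule order_tendstoI)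
  show "\<forall>\<^sub>F n in sequentially. c < half_deriv (fn n) (\<rho> n)" if "c < half_deriv f l" for c
    by (rule deriv_eventually_greater[OF assms that])
  show "\<forall>\<^sub>F n in sequentially. half_deriv (fn n) (\<rho> n) < c" if "half_deriv f l < c" for c
    by (rule deriv_eventually_less[OF assms(1-5) less_imp_le[OF assms(6)] that])
qed

text \<open>By monotonicity of \<open>f\<^sub>n'\<close> it suffices to bound the values at \<open>R\<close>, and these converge.\<close>

lemma deriv_bounded_on:
  assumes f: "regular_Lagrangean f" and fn: "\<And>n. regular_Lagrangean (fn n)"
    and "\<And>n. half_deriv (fn n) 0 = 0"
    and lim: "uniform_limit {0..} fn f sequentially" and R: "R > 0"
  shows "\<exists>B. \<forall>n. \<forall>r. 0 \<le> r \<and> r \<le> R \<longrightarrow> 0 \<le> half_deriv (fn n) r \<and> half_deriv (fn n) r \<le> B"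
proof -
  have "(\<lambda>n. half_deriv (fn n) R) \<longlonglongrightarrow> half_deriv f R"
    using R by (intro deriv_tendsto f fn lim) auto
  then have "Bseq (\<lambda>n. half_deriv (fn n) R)" by (intro convergent_imp_Bseq convergentI)
  then obtain B where B: "\<And>n. norm (half_deriv (fn n) R) \<le> B" by (elim BseqE) blast
  have "0 \<le> half_deriv (fn n) r \<and> half_deriv (fn n) r \<le> B" if "0 \<le> r" "r \<le> R" for n r
  proof
    show "0 \<le> half_deriv (fn n) r"
      using regular_deriv_mono[OF fn, of 0 r n] assms(3)[of n] that(1) by simp
    have "half_deriv (fn n) r \<le> half_deriv (fn n) R" by (rule regular_deriv_mono[OF fn that])
    also have "\<dots> \<le> B" using B[of n] by simp
    finally show "half_deriv (fn n) r \<le> B" .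
  qed
  then show ?thesis by blast
qed


section \<open>The integrand as a function of the gradient\<close>

lemma regular_strict_mono:
  assumes f: "regular_Lagrangean f" and "half_deriv f 0 = 0" and "0 \<le> x" "x < y"
  shows "f x < f y"
proof -
  have "half_deriv f x * (y - x) < f y - f x" using assms by (intro regular_tangent_less) auto
  moreover have "0 \<le> half_deriv f x" using regular_deriv_mono[OF f, of 0 x] assms by auto
  ultimately show ?thesis using \<open>x < y\<close> by (smt (verit) mult_nonneg_nonneg)
qed

lemma norm_convex_combination_less:
  fixes a b :: "'a::real_inner"
  assumes "norm a = norm b" "a \<noteq> b" "0 < s" "s < 1"
  shows "norm ((1 - s) *\<^sub>R a + s *\<^sub>R b) < norm a"
proof -
  have "(norm ((1 - s) *\<^sub>R a + s *\<^sub>R b))\<^sup>2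
      = (1 - s) * (norm a)\<^sup>2 + s * (norm b)\<^sup>2 - s * (1 - s) * (norm (a - b))\<^sup>2"
    unfolding power2_norm_eq_inner
    by (simp add: inner_simps inner_commute) (simp add: algebra_simps power2_eq_square)
  also have "\<dots> = (norm a)\<^sup>2 - s * (1 - s) * (norm (a - b))\<^sup>2"
    unfolding assms(1)[symmetric] by (simp add: algebra_simps)
  also have "\<dots> < (norm a)\<^sup>2" using assms by simp
  finally show ?thesis by (rule power_less_imp_less_base) simp
qed

text \<open>Between vectors of different length strict convexity comes from \<open>f\<close>; between vectors of equal
  length it comes from the roundness of the ball, because \<open>f'(0) = 0\<close> makes \<open>f\<close> strictly
  increasing.\<close>

lemma integrand_strict_convex:
  fixes a b :: "'a::real_inner"
  assumes f: "regular_Lagrangean f" and f0: "half_deriv f 0 = 0"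
    and "a \<noteq> b" "0 < s" "s < 1"
  shows "f (norm ((1 - s) *\<^sub>R a + s *\<^sub>R b)) < (1 - s) * f (norm a) + s * f (norm b)"
proof (cases "norm a = norm b")
  case True
  have "norm ((1 - s) *\<^sub>R a + s *\<^sub>R b) < norm a"
    by (rule norm_convex_combination_less[OF True assms(3-5)])
  then have "f (norm ((1 - s) *\<^sub>R a + s *\<^sub>R b)) < f (norm a)"
    by (rule regular_strict_mono[OF f f0 norm_ge_zero])
  also have "f (norm a) = (1 - s) * f (norm a) + s * f (norm b)"
    unfolding True[symmetric] by (simp add: left_diff_distrib)
  finally show ?thesis .
next
  case False
  have "norm ((1 - s) *\<^sub>R a + s *\<^sub>R b) \<le> norm ((1 - s) *\<^sub>R a) + norm (s *\<^sub>R b)"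
    by (rule norm_triangle_ineq)
  also have "\<dots> = (1 - s) * norm a + s * norm b" using assms(4,5) by simp
  finally have le: "norm ((1 - s) *\<^sub>R a + s *\<^sub>R b) \<le> (1 - s) * norm a + s * norm b" .
  have "f (norm ((1 - s) *\<^sub>R a + s *\<^sub>R b)) \<le> f ((1 - s) * norm a + s * norm b)"
  proof (cases "norm ((1 - s) *\<^sub>R a + s *\<^sub>R b) = (1 - s) * norm a + s * norm b")
    case False
    with le have "norm ((1 - s) *\<^sub>R a + s *\<^sub>R b) < (1 - s) * norm a + s * norm b" by linarith
    from regular_strict_mono[OF f f0 norm_ge_zero this] show ?thesis by (rule less_imp_le)
  qed (rule eq_refl, rule arg_cong)
  also have "\<dots> < (1 - s) * f (norm a) + s * f (norm b)"
    by (rule regular_strict_convex[OF f norm_ge_zero norm_ge_zero False assms(4,5)])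
  finally show ?thesis .
qed

lemma integrand_subgradient:
  fixes p :: "'a::real_inner"
  assumes f: "regular_Lagrangean f" and f0: "half_deriv f 0 = 0"
  shows "\<exists>\<xi>. \<forall>q. f (norm p) + \<xi> \<bullet> q \<le> f (norm (p + q))"
proof (rule exI[of _ "(half_deriv f (norm p) / norm p) *\<^sub>R p"], rule allI)
  fix q :: 'a
  have "half_deriv f (norm p) * (p \<bullet> q / norm p) \<le> half_deriv f (norm p) * (norm (p + q) - norm p)"
  proof (intro mult_left_mono)
    show "p \<bullet> q / norm p \<le> norm (p + q) - norm p"
    proof (cases "p = 0")
      case False
      have "p \<bullet> q + (norm p)\<^sup>2 = p \<bullet> (p + q)" by (simp add: inner_simps power2_norm_eq_inner)
      also have "\<dots> \<le> norm p * norm (p + q)" by (rule norm_cauchy_schwarz)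
      finally show ?thesis using False by (simp add: field_simps power2_eq_square)
    qed auto
    show "0 \<le> half_deriv f (norm p)" using regular_deriv_mono[OF f, of 0 "norm p"] f0 by simp
  qed
  also have "\<dots> \<le> f (norm (p + q)) - f (norm p)" by (intro regular_tangent_le f) auto
  finally show "f (norm p) + ((half_deriv f (norm p) / norm p) *\<^sub>R p) \<bullet> q \<le> f (norm (p + q))"
    by (simp add: algebra_simps)
qed

lemma integrand_continuous:
  assumes "regular_Lagrangean f"
  shows "continuous_on UNIV (\<lambda>p::'a::real_normed_vector. f (norm p))"
  by (rule continuous_on_compose2[OF regular_continuous[OF assms] continuous_on_norm[OF continuous_on_id]]) auto


section \<open>Smooth bump functions\<close>

lemma frechet_derivative_eq: "(f has_derivative D) (at x) \<Longrightarrow> frechet_derivative f (at x) = D"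
  by (rule frechet_derivative_at[symmetric])

lemma Ck_differentiable: "Ck (Suc k) \<phi> \<Longrightarrow> \<phi> differentiable (at x)"
  by (simp add: differentiable_on_def)

lemma Ck_has_derivative: "Ck (Suc k) \<phi> \<Longrightarrow> (\<phi> has_derivative frechet_derivative \<phi> (at x)) (at x)"
  using Ck_differentiable frechet_derivative_works by blast

lemma Ck_SucI:
  assumes "\<And>x. (\<phi> has_derivative D x) (at x)" "\<And>b. b \<in> Basis \<Longrightarrow> Ck k (\<lambda>x. D x b)"
  shows "Ck (Suc k) \<phi>"
proof -
  have "frechet_derivative \<phi> (at x) = D x" for x by (rule frechet_derivative_eq[OF assms(1)])
  then show ?thesis
    using assms by (auto simp: differentiable_on_def differentiable_def)
qed

lemma Ck_SucD: "Ck (Suc k) \<phi> \<Longrightarrow> Ck k \<phi>"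
proof (induction k arbitrary: \<phi>)
  case 0 then show ?case by (simp add: differentiable_imp_continuous_on)
next
  case (Suc k) then show ?case by simp
qed

lemma Ck_const: "Ck k (\<lambda>x. c)"
proof (induction k arbitrary: c)
  case (Suc k)
  show ?case by (rule Ck_SucI[where D = "\<lambda>x h. 0"]) (auto intro: Suc.IH)
qed simp

lemma Ck_add: "Ck k \<phi> \<Longrightarrow> Ck k \<theta> \<Longrightarrow> Ck k (\<lambda>x. \<phi> x + \<theta> x)"
proof (induction k arbitrary: \<phi> \<theta>)
  case 0 then show ?case by (simp add: continuous_on_add)
next
  case (Suc k)
  show ?case
    by (rule Ck_SucI, rule has_derivative_add[OF Ck_has_derivative[OF Suc.prems(1)] Ck_has_derivative[OF Suc.prems(2)]])
       (use Suc in auto)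
qed

lemma Ck_mult: "Ck k \<phi> \<Longrightarrow> Ck k \<theta> \<Longrightarrow> Ck k (\<lambda>x. \<phi> x * \<theta> x)"
proof (induction k arbitrary: \<phi> \<theta>)
  case 0 then show ?case by (simp add: continuous_on_mult)
next
  case (Suc k)
  show ?case
    by (rule Ck_SucI, rule has_derivative_mult[OF Ck_has_derivative[OF Suc.prems(1)] Ck_has_derivative[OF Suc.prems(2)]])
       (use Suc.prems Ck_SucD in \<open>auto intro!: Ck_add Suc.IH simp del: Ck.simps(2)\<close>, (simp | blast)+)
qed

lemma Ck_prod: "finite S \<Longrightarrow> (\<And>i. i \<in> S \<Longrightarrow> Ck k (\<phi> i)) \<Longrightarrow> Ck k (\<lambda>x. \<Prod>i\<in>S. \<phi> i x)"
  by (induction S rule: finite_induct) (auto intro: Ck_const Ck_mult)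

text \<open>The classical flat function \<open>exp (- c / t)\<close>, together with its quotients by powers of \<open>t\<close>:
  this family is closed under differentiation, which makes smoothness an easy induction.  The
  parameter \<open>c\<close> is there because the functions tend to the indicator of the half-line as \<open>c\<close>
  tends to 0.\<close>

definition flat :: "real \<Rightarrow> nat \<Rightarrow> real \<Rightarrow> real" where
  "flat c j t = (if t > 0 then exp (- (c / t)) / t ^ j else 0)"

lemma flat_tendsto_0:
  assumes "c > 0" shows "((\<lambda>t. flat c j t) \<longlongrightarrow> 0) (at_right 0)"
proof -
  have "filterlim (\<lambda>t. c / t) at_top (at_right 0)"
    unfolding divide_inverse
    by (rule filterlim_tendsto_pos_mult_at_top[OF tendsto_const assms filterlim_inverse_at_top_right])
  then have "((\<lambda>t. (c / t) ^ j / exp (c / t)) \<longlongrightarrow> 0) (at_right 0)"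
    by (rule filterlim_compose[OF tendsto_power_div_exp_0])
  then have "((\<lambda>t. (c / t) ^ j / exp (c / t) / c ^ j) \<longlongrightarrow> 0 / c ^ j) (at_right 0)"
    using assms by (intro tendsto_intros) auto
  then have "((\<lambda>t. (c / t) ^ j / exp (c / t) / c ^ j) \<longlongrightarrow> 0) (at_right 0)" by simp
  then show ?thesis
    by (rule Lim_transform_eventually)
       (use assms in \<open>auto simp: flat_def eventually_at_right_less exp_minus field_simps
         intro!: eventually_mono[OF eventually_at_right_less[of 0]]\<close>)
qed

lemma flat_derivative:
  assumes c: "c > 0"
  shows "(flat c j has_real_derivative (c * flat c (j + 2) t - real j * flat c (j + 1) t)) (at t)"
proof -
  consider "t > 0" | "t < 0" | "t = 0" by linarith
  then show ?thesis
  proof cases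
    case 1
    have "((\<lambda>t. exp (- (c / t)) / t ^ j) has_real_derivative (c * flat c (j + 2) t - real j * flat c (j + 1) t)) (at t)"
      using 1 by (auto intro!: derivative_eq_intros simp: flat_def field_simps power2_eq_square)
        (cases j; simp add: field_simps)+
    then show ?thesis
      by (rule has_field_derivative_transform_within_open[of _ _ _ "{0<..}"]) (use 1 in \<open>auto simp: flat_def\<close>)
  next
    case 2
    have "((\<lambda>t. 0) has_real_derivative (c * flat c (j + 2) t - real j * flat c (j + 1) t)) (at t)"
      using 2 by (simp add: flat_def)
    then show ?thesis
      by (rule has_field_derivative_transform_within_open[of _ _ _ "{..<0}"]) (use 2 in \<open>auto simp: flat_def\<close>)
  next
    case 3
    have "((\<lambda>h. flat c j h / h) \<longlongrightarrow> 0) (at_right 0)"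
      by (rule Lim_transform_eventually[OF flat_tendsto_0[OF c, of "Suc j"]])
         (auto simp: flat_def intro!: eventually_mono[OF eventually_at_right_less[of 0]])
    moreover have "((\<lambda>h. flat c j h / h) \<longlongrightarrow> 0) (at_left 0)"
      by (rule Lim_transform_eventually[OF tendsto_const[of 0]])
         (auto simp: flat_def intro!: eventually_mono[OF eventually_at_left_real[of "-1" 0]])
    ultimately have "((\<lambda>h. flat c j h / h) \<longlongrightarrow> 0) (at 0)" by (simp add: filterlim_split_at)
    then show ?thesis using 3 by (simp add: DERIV_def flat_def)
  qed
qed

lemma Ck_flat_affine:
  assumes c: "c > 0"
  shows "Ck k (\<lambda>x. flat c j (l \<bullet> x + d))"
proof (induction k arbitrary: j)
  case 0
  have "isCont (flat c j) t" for t using flat_derivative[OF c] by (rule DERIV_isCont)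
  then have "continuous_on UNIV (flat c j)" by (simp add: continuous_at_imp_continuous_on)
  moreover have "continuous_on UNIV (\<lambda>x. l \<bullet> x + d)" by (intro continuous_intros)
  ultimately show ?case using continuous_on_compose2[of UNIV "flat c j" UNIV "\<lambda>x. l \<bullet> x + d"] by simp
next
  case (Suc k)
  show ?case
  proof (rule Ck_SucI)
    show "((\<lambda>x. flat c j (l \<bullet> x + d)) has_derivative
        (\<lambda>h. (l \<bullet> h) * (c * flat c (j + 2) (l \<bullet> x + d) + (- real j) * flat c (j + 1) (l \<bullet> x + d)))) (at x)" for x
      by (rule has_derivative_eq_rhs,
          rule has_derivative_compose[of "\<lambda>x. l \<bullet> x + d" _ x UNIV "flat c j", OF _ flat_derivative[OF c, unfolded has_field_derivative_def]])
         (auto intro!: derivative_eq_intros)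
  qed (intro Ck_mult Ck_add Ck_const Suc.IH)
qed

definition bump :: "real \<Rightarrow> 'a \<Rightarrow> 'a \<Rightarrow> 'a::euclidean_space \<Rightarrow> real" where
  "bump c p q x = (\<Prod>b\<in>Basis. flat c 0 ((x - p) \<bullet> b) * flat c 0 ((q - x) \<bullet> b))"

lemma Ck_bump:
  assumes "c > 0" shows "Ck k (bump c p q)"
proof -
  have "Ck k (\<lambda>x. flat c 0 (b \<bullet> x + (- (p \<bullet> b))) * flat c 0 ((- b) \<bullet> x + q \<bullet> b))" for b
    by (intro Ck_mult Ck_flat_affine assms)
  then have "Ck k (\<lambda>x. \<Prod>b\<in>Basis. flat c 0 (b \<bullet> x + (- (p \<bullet> b))) * flat c 0 ((- b) \<bullet> x + q \<bullet> b))"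
    by (intro Ck_prod) auto
  then show ?thesis
    by (simp add: bump_def[abs_def] inner_simps inner_commute algebra_simps)
qed

lemma flat_bounds: "c \<ge> 0 \<Longrightarrow> 0 \<le> flat c 0 t" "c \<ge> 0 \<Longrightarrow> flat c 0 t \<le> 1"
  by (auto simp: flat_def)

lemma bump_nonneg: "c \<ge> 0 \<Longrightarrow> 0 \<le> bump c p q x"
  unfolding bump_def by (intro prod_nonneg ballI mult_nonneg_nonneg flat_bounds)

lemma bump_le_1: "c \<ge> 0 \<Longrightarrow> bump c p q x \<le> 1"
  unfolding bump_def by (intro prod_le_1 conjI mult_nonneg_nonneg mult_le_one flat_bounds)

lemma bump_eq_0: "x \<notin> box p q \<Longrightarrow> bump c p q x = 0"
proof -
  assume "x \<notin> box p q"
  then obtain b where "b \<in> Basis" "\<not> (p \<bullet> b < x \<bullet> b \<and> x \<bullet> b < q \<bullet> b)" by (auto simp: mem_box)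
  then have "flat c 0 ((x - p) \<bullet> b) * flat c 0 ((q - x) \<bullet> b) = 0" by (auto simp: flat_def inner_simps)
  then show ?thesis unfolding bump_def using \<open>b \<in> Basis\<close> by (intro prod_zero) auto
qed

lemma bump_pos:
  assumes "x \<in> box p q" shows "0 < bump c p q x"
  unfolding bump_def using assms by (intro prod_pos) (auto simp: flat_def inner_simps mem_box)

lemma bump_translate: "bump c p q (x - v) = bump c (p + v) (q + v) x"
  by (simp add: bump_def algebra_simps)

lemma bump_tendsto:
  assumes "x \<in> box p q"
  shows "(\<lambda>n. bump (1 / Suc n) p q x) \<longlonglongrightarrow> 1"
proof -
  have "(\<lambda>n. flat (1 / Suc n) 0 t) \<longlonglongrightarrow> 1" if "t > 0" for t
  proof -
    have "(\<lambda>n. exp (- (1 / Suc n * (1 / t)))) \<longlonglongrightarrow> exp (- (0 * (1 / t)))"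
      by (intro tendsto_intros LIMSEQ_Suc[OF lim_1_over_n])
    then show ?thesis using that by (simp add: flat_def)
  qed
  then have "(\<lambda>n. bump (1 / Suc n) p q x) \<longlonglongrightarrow> (\<Prod>b\<in>(Basis::'a set). 1 * 1)"
    unfolding bump_def using assms by (intro tendsto_prod tendsto_mult) (auto simp: inner_simps mem_box)
  then show ?thesis by simp
qed

lemma test_function_bump:
  assumes "c > 0" "cbox p q \<subseteq> \<Omega>"
  shows "test_function \<Omega> (bump c p q)"
proof -
  have "bump c p q x = 0" if "x \<notin> cbox p q" for x
    using that box_subset_cbox[of p q] by (intro bump_eq_0) auto
  then have "compact (cbox p q) \<and> cbox p q \<subseteq> \<Omega> \<and> (\<forall>x. x \<notin> cbox p q \<longrightarrow> bump c p q x = 0)"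
    using assms(2) by simp
  then show ?thesis unfolding test_function_def using Ck_bump[OF assms(1)] by blast
qed


section \<open>Integrating against test functions\<close>

lemma test_function_has_derivative:
  "test_function \<Omega> \<phi> \<Longrightarrow> (\<phi> has_derivative frechet_derivative \<phi> (at x)) (at x)"
  unfolding test_function_def using Ck_has_derivative by blast

lemma test_function_continuous: "test_function \<Omega> \<phi> \<Longrightarrow> continuous_on UNIV \<phi>"
  unfolding test_function_def by (metis Ck.simps(1))

text \<open>The weak gradient is defined through basis vectors; this expansion gives access to arbitrary
  directions.\<close>

lemma frechet_derivative_expand:
  assumes "test_function \<Omega> \<phi>"
  shows "frechet_derivative \<phi> (at x) e = (\<Sum>b\<in>Basis. (e \<bullet> b) * frechet_derivative \<phi> (at x) b)"
proof -
  interpret bounded_linear "frechet_derivative \<phi> (at x)"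
    using test_function_has_derivative[OF assms] by (rule has_derivative_bounded_linear)
  have "frechet_derivative \<phi> (at x) e = frechet_derivative \<phi> (at x) (\<Sum>b\<in>Basis. (e \<bullet> b) *\<^sub>R b)"
    by (simp add: euclidean_representation)
  then show ?thesis by (simp add: sum scaleR)
qed

lemma test_function_continuous_derivative:
  assumes "test_function \<Omega> \<phi>"
  shows "continuous_on UNIV (\<lambda>x. frechet_derivative \<phi> (at x) e)"
proof -
  have "Ck (Suc 0) \<phi>" using assms unfolding test_function_def by blast
  then have "continuous_on UNIV (\<lambda>x. \<Sum>b\<in>Basis. (e \<bullet> b) * frechet_derivative \<phi> (at x) b)"
    by (intro continuous_on_sum continuous_on_mult continuous_on_const) simp
  moreover have "(\<lambda>x. \<Sum>b\<in>Basis. (e \<bullet> b) * frechet_derivative \<phi> (at x) b) = (\<lambda>x. frechet_derivative \<phi> (at x) e)"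
    by (rule ext, rule frechet_derivative_expand[OF assms, symmetric])
  ultimately show ?thesis by (simp only:)
qed

lemma test_function_support:
  assumes "test_function \<Omega> \<phi>"
  obtains K where "compact K" "K \<subseteq> \<Omega>" "\<And>x. x \<notin> K \<Longrightarrow> \<phi> x = 0"
    "\<And>x e. x \<notin> K \<Longrightarrow> frechet_derivative \<phi> (at x) e = 0"
proof -
  obtain K where K: "compact K" "K \<subseteq> \<Omega>" "\<And>x. x \<notin> K \<Longrightarrow> \<phi> x = 0"
    using assms unfolding test_function_def by auto
  have "frechet_derivative \<phi> (at x) e = 0" if "x \<notin> K" for x e
  proof -
    have "((\<lambda>x. 0) has_derivative (\<lambda>h. 0)) (at x)" by simp
    then have "(\<phi> has_derivative (\<lambda>h. 0)) (at x)"
      by (rule has_derivative_transform_within_open[of _ _ _ _ "- K"])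
         (use K that in \<open>auto simp: compact_imp_closed open_Compl\<close>)
    then show ?thesis by (simp add: frechet_derivative_eq)
  qed
  then show ?thesis using that K by blast
qed

lemma bounded_of_compact_support:
  fixes \<phi> :: "'a::euclidean_space \<Rightarrow> real"
  assumes "continuous_on UNIV \<phi>" "compact K" "\<And>x. x \<notin> K \<Longrightarrow> \<phi> x = 0"
  obtains B where "B \<ge> 0" "\<And>x. \<bar>\<phi> x\<bar> \<le> B"
proof -
  have "compact (\<phi> ` K)" using assms by (intro compact_continuous_image continuous_on_subset[OF assms(1)]) auto
  then obtain B where "\<And>x. x \<in> K \<Longrightarrow> \<bar>\<phi> x\<bar> \<le> B"
    by (metis bounded_iff compact_imp_bounded imageI real_norm_def)
  then have "\<bar>\<phi> x\<bar> \<le> max B 0" for x using assms(3)[of x] by (cases "x \<in> K") (auto simp: le_max_iff_disj)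
  then show ?thesis using that[of "max B 0"] by auto
qed

lemma integrable_mult_compact_support:
  fixes h :: "'a::euclidean_space \<Rightarrow> real"
  assumes "locally_integrable_on \<Omega> h" "continuous_on UNIV \<phi>" "compact K" "K \<subseteq> \<Omega>" "\<And>x. x \<notin> K \<Longrightarrow> \<phi> x = 0"
  shows "integrable lebesgue (\<lambda>x. h x * \<phi> x)"
proof -
  obtain B where B: "B \<ge> 0" "\<And>x. \<bar>\<phi> x\<bar> \<le> B"
    using bounded_of_compact_support[OF assms(2,3,5)] by blast
  have hK: "integrable lebesgue (\<lambda>x. indicator K x *\<^sub>R h x)"
    using assms unfolding locally_integrable_on_def set_integrable_def by auto
  have "\<phi> \<in> borel_measurable lebesgue"
    using borel_measurable_continuous_onI[OF assms(2)] by (intro measurable_completion) simp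
  then have meas: "(\<lambda>x. (indicator K x *\<^sub>R h x) * \<phi> x) \<in> borel_measurable lebesgue"
    using hK by (intro borel_measurable_times) auto
  have "integrable lebesgue (\<lambda>x. (indicator K x *\<^sub>R h x) * \<phi> x)"
  proof (rule Bochner_Integration.integrable_bound[OF integrable_mult_right[OF hK, of B] meas])
    show "AE x in lebesgue. norm (indicator K x *\<^sub>R h x * \<phi> x) \<le> norm (B * (indicator K x *\<^sub>R h x))"
      using B by (auto simp: abs_mult indicator_def mult.commute intro!: mult_right_mono)
  qed
  moreover have "(\<lambda>x. (indicator K x *\<^sub>R h x) * \<phi> x) = (\<lambda>x. h x * \<phi> x)"
    using assms(5) by (auto simp: indicator_def fun_eq_iff)
  ultimately show ?thesis by (simp only:)
qed

lemma integrable_mult_test: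
  fixes h :: "'a::euclidean_space \<Rightarrow> real"
  assumes "locally_integrable_on \<Omega> h" "test_function \<Omega> \<phi>"
  shows "integrable lebesgue (\<lambda>x. h x * \<phi> x)"
    and "integrable lebesgue (\<lambda>x. h x * frechet_derivative \<phi> (at x) e)"
proof -
  obtain K where K: "compact K" "K \<subseteq> \<Omega>" "\<And>x. x \<notin> K \<Longrightarrow> \<phi> x = 0"
    "\<And>x e. x \<notin> K \<Longrightarrow> frechet_derivative \<phi> (at x) e = 0"
    using test_function_support[OF assms(2)] by blast
  show "integrable lebesgue (\<lambda>x. h x * \<phi> x)"
    by (rule integrable_mult_compact_support[OF assms(1) test_function_continuous[OF assms(2)] K(1-3)])
  show "integrable lebesgue (\<lambda>x. h x * frechet_derivative \<phi> (at x) e)"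
    by (rule integrable_mult_compact_support[OF assms(1) test_function_continuous_derivative[OF assms(2)] K(1,2,4)])
qed

lemma LINT_on_eq_LINT:
  fixes h :: "'a::euclidean_space \<Rightarrow> real"
  assumes "open \<Omega>" "\<And>x. x \<notin> \<Omega> \<Longrightarrow> h x = 0"
  shows "(LINT x|lebesgue_on \<Omega>. h x) = (LINT x|lebesgue. h x)"
proof -
  have "(LINT x|lebesgue_on \<Omega>. h x) = (LINT x|lebesgue. indicator \<Omega> x *\<^sub>R h x)"
    using assms(1) by (subst integral_restrict_space) (auto simp: borel_open)
  also have "\<dots> = (LINT x|lebesgue. h x)"
    using assms(2) by (intro Bochner_Integration.integral_cong) (auto simp: indicator_def)
  finally show ?thesis .
qed

text \<open>Over the whole space the integrals can be translated and differentiated in a parameter without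
  keeping track of the domain.\<close>

lemma has_weak_partial_iff:
  fixes w :: "'a::euclidean_space \<Rightarrow> real"
  assumes "open \<Omega>"
  shows "has_weak_partial \<Omega> b w h \<longleftrightarrow> locally_integrable_on \<Omega> w \<and> locally_integrable_on \<Omega> h \<and>
     (\<forall>\<phi>. test_function \<Omega> \<phi> \<longrightarrow>
        (LINT x|lebesgue. w x * frechet_derivative \<phi> (at x) b) = - (LINT x|lebesgue. h x * \<phi> x))"
proof -
  have "(LINT x|lebesgue_on \<Omega>. w x * frechet_derivative \<phi> (at x) b) = (LINT x|lebesgue. w x * frechet_derivative \<phi> (at x) b)"
    "(LINT x|lebesgue_on \<Omega>. h x * \<phi> x) = (LINT x|lebesgue. h x * \<phi> x)" if \<phi>: "test_function \<Omega> \<phi>" for \<phi>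
  proof -
    have off: "\<phi> x = 0 \<and> frechet_derivative \<phi> (at x) b = 0" if "x \<notin> \<Omega>" for x
      by (rule test_function_support[OF \<phi>]) (use that in blast)
    then show "(LINT x|lebesgue_on \<Omega>. w x * frechet_derivative \<phi> (at x) b) = (LINT x|lebesgue. w x * frechet_derivative \<phi> (at x) b)"
      "(LINT x|lebesgue_on \<Omega>. h x * \<phi> x) = (LINT x|lebesgue. h x * \<phi> x)"
      by (intro LINT_on_eq_LINT assms; simp add: off)+
  qed
  then show ?thesis unfolding has_weak_partial_def by auto
qed

text \<open>Bump functions tend boundedly to indicators of boxes, so the hypothesis passes to integrals
  over boxes, and the Lebesgue differentiation theorem recovers the pointwise sign.\<close>

lemma fundamental_lemma_nonneg:
  fixes H :: "'a::euclidean_space \<Rightarrow> real"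
  assumes op: "open \<Omega>" and H: "locally_integrable_on \<Omega> H"
    and pos: "\<And>\<phi>. test_function \<Omega> \<phi> \<Longrightarrow> (\<And>x. 0 \<le> \<phi> x) \<Longrightarrow> 0 \<le> (LINT x|lebesgue. H x * \<phi> x)"
  shows "AE x in lebesgue_on \<Omega>. 0 \<le> H x"
proof -
  have Hc: "integrable lebesgue (\<lambda>x. indicator (cbox p q) x * H x)" if "cbox p q \<subseteq> \<Omega>" for p q
    using H that unfolding locally_integrable_on_def set_integrable_def by auto
  have box: "0 \<le> integral (cbox p q) H" if sub: "cbox p q \<subseteq> \<Omega>" for p q
  proof -
    have lim: "(\<lambda>n. LINT x|lebesgue. H x * bump (1 / Suc n) p q x) \<longlonglongrightarrow> (LINT x|lebesgue. indicator (box p q) x * H x)"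
    proof (rule integral_dominated_convergence[where w = "\<lambda>x. norm (indicator (cbox p q) x * H x)"])
      show "integrable lebesgue (\<lambda>x. norm (indicator (cbox p q) x * H x))"
        using Hc[OF sub] by (rule integrable_norm)
      show "(\<lambda>x. H x * bump (1 / Suc n) p q x) \<in> borel_measurable lebesgue" for n
        by (rule borel_measurable_integrable, rule integrable_mult_test[OF H test_function_bump[OF _ sub]]) simp
      have "(\<lambda>x. indicator (box p q) x * (indicator (cbox p q) x * H x)) \<in> borel_measurable lebesgue"
        using Hc[OF sub] by (intro borel_measurable_times borel_measurable_indicator borel_measurable_integrable) auto
      moreover have "indicator (box p q) x * (indicator (cbox p q) x * H x) = indicator (box p q) x * H x" for x
        using box_subset_cbox[of p q] by (auto simp: indicator_def)
      ultimately show "(\<lambda>x. indicator (box p q) x * H x) \<in> borel_measurable lebesgue" by simp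
      show "AE x in lebesgue. (\<lambda>n. H x * bump (1 / Suc n) p q x) \<longlonglongrightarrow> indicator (box p q) x * H x"
      proof (rule AE_I2)
        fix x
        show "(\<lambda>n. H x * bump (1 / Suc n) p q x) \<longlonglongrightarrow> indicator (box p q) x * H x"
        proof (cases "x \<in> box p q")
          case True
          have "(\<lambda>n. H x * bump (1 / Suc n) p q x) \<longlonglongrightarrow> H x * 1"
            by (intro tendsto_mult tendsto_const bump_tendsto True)
          then show ?thesis using True by simp
        qed (simp add: bump_eq_0)
      qed
      show "AE x in lebesgue. norm (H x * bump (1 / Suc n) p q x) \<le> norm (indicator (cbox p q) x * H x)" for n
      proof (rule AE_I2)
        fix x
        show "norm (H x * bump (1 / Suc n) p q x) \<le> norm (indicator (cbox p q) x * H x)"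
          using bump_nonneg[of "1 / Suc n" p q x] bump_le_1[of "1 / Suc n" p q x] bump_eq_0[of x p q "1 / Suc n"]
            box_subset_cbox[of p q]
          by (cases "x \<in> box p q") (auto simp: abs_mult mult_left_le indicator_def)
      qed
    qed
    have "0 \<le> (LINT x|lebesgue. H x * bump (1 / Suc n) p q x)" for n
      by (intro pos test_function_bump bump_nonneg sub) auto
    then have "0 \<le> (LINT x|lebesgue. indicator (box p q) x * H x)"
      by (intro LIMSEQ_le_const[OF lim]) auto
    moreover have "H absolutely_integrable_on box p q"
      using H sub unfolding locally_integrable_on_def
      by (meson absolutely_integrable_on_open_interval compact_cbox)
    then have "(LINT x|lebesgue. indicator (box p q) x * H x) = integral (box p q) H"
      using set_lebesgue_integral_eq_integral(2) unfolding set_lebesgue_integral_def by fastforce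
    ultimately show ?thesis by (simp add: integral_open_interval)
  qed
  obtain D where D: "countable D" "D \<subseteq> Pow \<Omega>" "\<And>X. X \<in> D \<Longrightarrow> \<exists>a b. X = cbox a b" "\<Union>D = \<Omega>"
    using open_countable_Union_open_cbox[OF op] by metis
  have "AE x in lebesgue. x \<in> cbox a b \<longrightarrow> 0 \<le> H x" if sub: "cbox a b \<subseteq> \<Omega>" for a b
  proof -
    define F where "F x = (if x \<in> cbox a b then H x else 0)" for x
    have "H absolutely_integrable_on cbox a b" using H sub unfolding locally_integrable_on_def by auto
    then have "H integrable_on cbox a b" by (rule set_lebesgue_integral_eq_integral)
    then have "F integrable_on UNIV"
      unfolding F_def using integrable_restrict_UNIV by blast
    then have "F integrable_on cbox p q" for p q by (rule integrable_on_subcbox) auto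
    then obtain N where N: "negligible N"
      "\<And>x e. \<lbrakk>x \<notin> N; 0 < e\<rbrakk> \<Longrightarrow> \<exists>d>0. \<forall>h. 0 < h \<and> h < d \<longrightarrow>
          norm (integral (cbox x (x + h *\<^sub>R One)) F /\<^sub>R h ^ DIM('a) - F x) < e"
      using integrable_ccontinuous_explicit[of F] by blast
    have nonneg: "0 \<le> H x" if x: "x \<in> box a b" "x \<notin> N" for x
    proof (rule ccontr)
      assume "\<not> 0 \<le> H x"
      then have neg: "F x < 0" using x box_subset_cbox[of a b] unfolding F_def by auto
      obtain d where d: "d > 0" "\<And>h. 0 < h \<Longrightarrow> h < d \<Longrightarrow>
          norm (integral (cbox x (x + h *\<^sub>R One)) F /\<^sub>R h ^ DIM('a) - F x) < - F x"
        using N(2)[OF x(2), of "- F x"] neg by auto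
      define m where "m = Min ((\<lambda>i. b \<bullet> i - x \<bullet> i) ` (Basis::'a set))"
      have m: "m > 0" unfolding m_def using x by (subst Min_gr_iff) (auto simp: mem_box)
      have mi: "m \<le> b \<bullet> i - x \<bullet> i" if "i \<in> Basis" for i
        unfolding m_def using that by (intro Min_le) auto
      define h where "h = min m d / 2"
      have h: "0 < h" "h < d" "h \<le> m" using m d unfolding h_def by auto
      have hsub: "cbox x (x + h *\<^sub>R One) \<subseteq> cbox a b"
      proof
        fix y assume y: "y \<in> cbox x (x + h *\<^sub>R One)"
        show "y \<in> cbox a b"
          unfolding mem_box
        proof (intro ballI conjI)
          fix i :: 'a assume i: "i \<in> Basis"
          have "a \<bullet> i < x \<bullet> i" "x \<bullet> i \<le> y \<bullet> i" "y \<bullet> i \<le> x \<bullet> i + h"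
            using x y i by (auto simp: mem_box inner_simps)
          then show "a \<bullet> i \<le> y \<bullet> i" "y \<bullet> i \<le> b \<bullet> i" using mi[OF i] h by auto
        qed
      qed
      have "integral (cbox x (x + h *\<^sub>R One)) F = integral (cbox x (x + h *\<^sub>R One)) H"
        using hsub by (intro integral_cong) (auto simp: F_def)
      then have "0 \<le> integral (cbox x (x + h *\<^sub>R One)) F" using box hsub sub by auto
      then have "0 \<le> integral (cbox x (x + h *\<^sub>R One)) F /\<^sub>R h ^ DIM('a)" using h by simp
      then show False using d(2)[OF h(1,2)] by auto
    qed
    have "negligible (N \<union> (cbox a b - box a b))"
      using N(1) negligible_frontier_interval by (intro negligible_Un) auto
    then have null: "N \<union> (cbox a b - box a b) \<in> null_sets lebesgue" by (simp add: negligible_iff_null_sets)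
    show ?thesis by (rule AE_I'[OF null]) (use nonneg in auto)
  qed
  then have "\<forall>X\<in>D. AE x in lebesgue. x \<in> X \<longrightarrow> 0 \<le> H x" using D by (metis PowD subsetD)
  then have "AE x in lebesgue. \<forall>X\<in>D. x \<in> X \<longrightarrow> 0 \<le> H x" using AE_ball_countable[OF D(1), of "\<lambda>x X. x \<in> X \<longrightarrow> 0 \<le> H x" lebesgue] by simp
  then have "AE x in lebesgue. x \<in> \<Omega> \<longrightarrow> 0 \<le> H x" by (rule AE_mp) (use D(4) in auto)
  then show ?thesis using op by (simp add: AE_restrict_space_iff borel_open)
qed

lemma locally_integrable_diff:
  "locally_integrable_on \<Omega> g \<Longrightarrow> locally_integrable_on \<Omega> h \<Longrightarrow> locally_integrable_on \<Omega> (\<lambda>x. g x - h x)"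
  unfolding locally_integrable_on_def by (auto intro: set_integral_diff)

lemma fundamental_lemma_le:
  fixes g h :: "'a::euclidean_space \<Rightarrow> real"
  assumes "open \<Omega>" and g: "locally_integrable_on \<Omega> g" and h: "locally_integrable_on \<Omega> h"
    and le: "\<And>\<phi>. test_function \<Omega> \<phi> \<Longrightarrow> (\<And>x. 0 \<le> \<phi> x) \<Longrightarrow>
      (LINT x|lebesgue. g x * \<phi> x) \<le> (LINT x|lebesgue. h x * \<phi> x)"
  shows "AE x in lebesgue_on \<Omega>. g x \<le> h x"
proof -
  have "AE x in lebesgue_on \<Omega>. 0 \<le> h x - g x"
  proof (rule fundamental_lemma_nonneg[OF assms(1) locally_integrable_diff[OF h g]])
    fix \<phi> assume \<phi>: "test_function \<Omega> \<phi>" "\<And>x. 0 \<le> \<phi> x"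
    have "(LINT x|lebesgue. (h x - g x) * \<phi> x) = (LINT x|lebesgue. h x * \<phi> x) - (LINT x|lebesgue. g x * \<phi> x)"
      using integrable_mult_test[OF g \<phi>(1)] integrable_mult_test[OF h \<phi>(1)] by (simp add: left_diff_distrib)
    then show "0 \<le> (LINT x|lebesgue. (h x - g x) * \<phi> x)" using le[OF \<phi>] by simp
  qed
  then show ?thesis by simp
qed

lemma weak_partial_unique:
  fixes w :: "'a::euclidean_space \<Rightarrow> real"
  assumes op: "open \<Omega>" and g: "has_weak_partial \<Omega> b w g" and h: "has_weak_partial \<Omega> b w h"
  shows "AE x in lebesgue_on \<Omega>. g x = h x"
proof -
  have "AE x in lebesgue_on \<Omega>. g x \<le> h x" "AE x in lebesgue_on \<Omega>. h x \<le> g x"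
    using g h unfolding has_weak_partial_iff[OF op] by (auto intro!: fundamental_lemma_le[OF op])
  then show ?thesis by eventually_elim auto
qed

lemma weak_gradient_unique:
  fixes w :: "'a::euclidean_space \<Rightarrow> real"
  assumes op: "open \<Omega>" and G: "has_weak_gradient \<Omega> w G" and H: "has_weak_gradient \<Omega> w H"
  shows "AE x in lebesgue_on \<Omega>. G x = H x"
proof -
  have "\<forall>b\<in>Basis. AE x in lebesgue_on \<Omega>. G x \<bullet> b = H x \<bullet> b"
    using G H unfolding has_weak_gradient_def by (auto intro!: weak_partial_unique[OF op])
  then have "AE x in lebesgue_on \<Omega>. \<forall>b\<in>Basis. G x \<bullet> b = H x \<bullet> b" by (subst AE_ball_countable) (auto intro: countable_finite)
  then show ?thesis by eventually_elim (rule euclidean_eqI, blast)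
qed

lemma weak_gradient_AE_eq:
  fixes w :: "'a::euclidean_space \<Rightarrow> real"
  assumes op: "open \<Omega>" and G: "has_weak_gradient \<Omega> w G"
  shows "has_weak_gradient \<Omega> w (weak_gradient \<Omega> w)"
    and "AE x in lebesgue_on \<Omega>. weak_gradient \<Omega> w x = G x"
proof -
  show *: "has_weak_gradient \<Omega> w (weak_gradient \<Omega> w)"
    unfolding weak_gradient_def using someI[of "has_weak_gradient \<Omega> w", OF G] .
  show "AE x in lebesgue_on \<Omega>. weak_gradient \<Omega> w x = G x"
    by (rule weak_gradient_unique[OF op * G])
qed


section \<open>Integrals over the whole space\<close>

lemma locally_integrable_bounded:
  fixes h :: "'a::euclidean_space \<Rightarrow> 'b::euclidean_space"
  assumes meas: "h \<in> borel_measurable lebesgue" and bd: "AE x in lebesgue. x \<in> \<Omega> \<longrightarrow> norm (h x) \<le> B"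
  shows "locally_integrable_on \<Omega> h"
  unfolding locally_integrable_on_def
proof (intro allI impI)
  fix K assume K: "compact K \<and> K \<subseteq> \<Omega>"
  have "integrable lebesgue (\<lambda>x. indicator K x *\<^sub>R (max B 0))"
    using lmeasurable_compact[of K] K unfolding fmeasurable_def
    by (intro integrable_scaleR_left integrable_real_indicator) auto
  moreover have "(\<lambda>x. indicator K x *\<^sub>R h x) \<in> borel_measurable lebesgue"
    using K meas by (intro borel_measurable_scaleR borel_measurable_indicator) (auto simp: lmeasurable_compact fmeasurableD)
  moreover have "AE x in lebesgue. norm (indicator K x *\<^sub>R h x) \<le> norm (indicator K x *\<^sub>R (max B 0))"
    using bd by eventually_elim (use K in \<open>auto simp: indicator_def\<close>)
  ultimately show "h absolutely_integrable_on K"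
    unfolding set_integrable_def by (rule Bochner_Integration.integrable_bound)
qed

lemma borel_imp_lebesgue: "h \<in> borel_measurable borel \<Longrightarrow> h \<in> borel_measurable lebesgue"
  by (intro measurable_completion) simp

lemma locally_integrable_continuous:
  fixes w :: "'a::euclidean_space \<Rightarrow> real"
  assumes "continuous_on UNIV w" shows "locally_integrable_on \<Omega> w"
  unfolding locally_integrable_on_def
proof (intro allI impI)
  fix K assume K: "compact K \<and> K \<subseteq> \<Omega>"
  then have "compact (w ` K)" by (intro compact_continuous_image continuous_on_subset[OF assms]) auto
  then obtain B where B: "\<And>x. x \<in> K \<Longrightarrow> norm (w x) \<le> B"
    by (metis bounded_iff compact_imp_bounded imageI)
  have "locally_integrable_on K w"
    by (rule locally_integrable_bounded[where B = B])
       (use borel_imp_lebesgue[OF borel_measurable_continuous_onI[OF assms]] B in auto)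
  then show "w absolutely_integrable_on K" using K unfolding locally_integrable_on_def by auto
qed

lemma integrable_continuous_compact_support:
  fixes g :: "'a::euclidean_space \<Rightarrow> real"
  assumes "continuous_on UNIV g" "compact K" "\<And>x. x \<notin> K \<Longrightarrow> g x = 0"
  shows "integrable lebesgue g"
  using integrable_mult_compact_support[OF locally_integrable_continuous[OF continuous_on_const[of UNIV 1]] assms(1,2) subset_UNIV assms(3)]
  by simp

lemma LINT_translate:
  fixes g :: "'a::euclidean_space \<Rightarrow> real"
  assumes "g \<in> borel_measurable borel"
  shows "(LINT x|lebesgue. g (x + c)) = (LINT x|lebesgue. g x)"
proof -
  have m: "(\<lambda>x. g (x + c)) \<in> borel_measurable lborel" using assms by measurable
  have "(LINT x|lebesgue. g (x + c)) = (LINT x|lborel. g (c + x))"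
    using m by (subst integral_completion) (auto simp: add.commute)
  also have "\<dots> = (LINT x|distr lborel borel ((+) c). g x)"
    using assms by (intro integral_distr[symmetric]) auto
  also have "\<dots> = (LINT x|lebesgue. g x)"
    using assms by (simp add: lborel_distr_plus integral_completion)
  finally show ?thesis .
qed

lemma LINT_eq_integral_cbox:
  fixes g :: "'a::euclidean_space \<Rightarrow> real"
  assumes "continuous_on UNIV g" "\<And>x. x \<notin> cbox p q \<Longrightarrow> g x = 0"
  shows "(LINT x|lebesgue. g x) = integral (cbox p q) g"
proof -
  have "g absolutely_integrable_on cbox p q"
    by (rule absolutely_integrable_continuous[OF continuous_on_subset[OF assms(1) subset_UNIV]])
  then have "integral (cbox p q) g = (LINT x|lebesgue. indicator (cbox p q) x *\<^sub>R g x)"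
    using set_lebesgue_integral_eq_integral(2)[of "cbox p q" g] by (simp add: set_lebesgue_integral_def)
  moreover have "(\<lambda>x. indicator (cbox p q) x *\<^sub>R g x) = g"
    using assms(2) by (auto simp: fun_eq_iff indicator_def)
  ultimately show ?thesis by (simp only:)
qed


section \<open>Weak gradients control increments along segments\<close>

lemma weak_gradient_directional:
  fixes v :: "'a::euclidean_space \<Rightarrow> real"
  assumes op: "open \<Omega>" and G: "has_weak_gradient \<Omega> v G" and \<phi>: "test_function \<Omega> \<phi>"
  shows "integrable lebesgue (\<lambda>x. (G x \<bullet> e) * \<phi> x)"
    and "(LINT x|lebesgue. v x * frechet_derivative \<phi> (at x) e) = - (LINT x|lebesgue. (G x \<bullet> e) * \<phi> x)"
proof -
  have part: "has_weak_partial \<Omega> b v (\<lambda>x. G x \<bullet> b)" if "b \<in> Basis" for b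
    using G that unfolding has_weak_gradient_def by auto
  have int1: "integrable lebesgue (\<lambda>x. v x * frechet_derivative \<phi> (at x) b)" if "b \<in> Basis" for b
    using part[OF that] \<phi> unfolding has_weak_partial_iff[OF op] by (auto intro: integrable_mult_test)
  have int2: "integrable lebesgue (\<lambda>x. (G x \<bullet> b) * \<phi> x)" if "b \<in> Basis" for b
    using part[OF that] \<phi> unfolding has_weak_partial_iff[OF op] by (auto intro: integrable_mult_test)
  have eq: "(G x \<bullet> e) * \<phi> x = (\<Sum>b\<in>Basis. (e \<bullet> b) * ((G x \<bullet> b) * \<phi> x))" for x
    by (subst euclidean_inner) (simp add: sum_distrib_left sum_distrib_right mult_ac)
  show "integrable lebesgue (\<lambda>x. (G x \<bullet> e) * \<phi> x)"
    unfolding eq by (intro Bochner_Integration.integrable_sum integrable_mult_right int2)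
  have eq1: "(\<lambda>x. v x * frechet_derivative \<phi> (at x) e)
      = (\<lambda>x. \<Sum>b\<in>Basis. (e \<bullet> b) * (v x * frechet_derivative \<phi> (at x) b))"
    by (rule ext, subst frechet_derivative_expand[OF \<phi>]) (simp add: sum_distrib_left mult_ac)
  have "(LINT x|lebesgue. v x * frechet_derivative \<phi> (at x) e)
      = (\<Sum>b\<in>Basis. (e \<bullet> b) * (LINT x|lebesgue. v x * frechet_derivative \<phi> (at x) b))"
    unfolding eq1 by (subst Bochner_Integration.integral_sum) (auto intro!: integrable_mult_right int1)
  also have "\<dots> = (\<Sum>b\<in>Basis. (e \<bullet> b) * - (LINT x|lebesgue. (G x \<bullet> b) * \<phi> x))"
    using part \<phi> unfolding has_weak_partial_iff[OF op] by (intro sum.cong) auto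
  also have "\<dots> = - (\<Sum>b\<in>Basis. (LINT x|lebesgue. (e \<bullet> b) * ((G x \<bullet> b) * \<phi> x)))"
    by (simp add: sum_negf)
  also have "(\<Sum>b\<in>Basis. (LINT x|lebesgue. (e \<bullet> b) * ((G x \<bullet> b) * \<phi> x))) = (LINT x|lebesgue. (G x \<bullet> e) * \<phi> x)"
    unfolding eq by (subst Bochner_Integration.integral_sum) (auto intro!: integrable_mult_right int2)
  finally show "(LINT x|lebesgue. v x * frechet_derivative \<phi> (at x) e) = - (LINT x|lebesgue. (G x \<bullet> e) * \<phi> x)" .
qed

lemma LINT_bump_pos:
  fixes p :: "'a::euclidean_space"
  assumes "box p q \<noteq> {}" "c > 0"
  shows "0 < (LINT x|lebesgue. bump c p q x)"
proof -
  have "test_function UNIV (bump c p q)" using assms by (intro test_function_bump) auto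
  then have int: "integrable lebesgue (bump c p q)"
  proof (intro integrable_continuous_compact_support[OF test_function_continuous, where K = "cbox p q"])
    show "bump c p q x = 0" if "x \<notin> cbox p q" for x
      by (rule bump_eq_0) (use that box_subset_cbox[of p q] in blast)
  qed auto
  have nn: "AE x in lebesgue. 0 \<le> bump c p q x" using assms by (intro AE_I2 bump_nonneg) auto
  have "(LINT x|lebesgue. bump c p q x) \<noteq> 0"
  proof
    assume "(LINT x|lebesgue. bump c p q x) = 0"
    then have "AE x in lebesgue. bump c p q x = 0"
      using integral_nonneg_eq_0_iff_AE[OF int nn] by simp
    then have "AE x in lebesgue. x \<notin> box p q"
      by eventually_elim (metis bump_pos less_irrefl)
    then have "box p q \<in> null_sets lebesgue"
      by (subst (asm) AE_iff_null_sets[symmetric]) auto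
    then show False
      using open_not_negligible[OF open_box assms(1)] by (simp add: negligible_iff_null_sets)
  qed
  moreover have "0 \<le> (LINT x|lebesgue. bump c p q x)" using nn by (rule integral_nonneg_AE)
  ultimately show ?thesis by linarith
qed

text \<open>Average \<open>v\<close> against a bump that is moved along the segment: the derivative of this average
  with respect to the displacement is the average of the directional weak derivative.  Shrinking the
  bump gives the pointwise statement for continuous \<open>v\<close>.\<close>

lemma weak_gradient_mean_value:
  fixes v :: "'a::euclidean_space \<Rightarrow> real"
  assumes op: "open \<Omega>" and v: "continuous_on UNIV v" and G: "has_weak_gradient \<Omega> v G"
    and bd: "AE x in lebesgue_on \<Omega>. G x \<bullet> e \<le> B"
    and seg: "closed_segment x (x + e) \<subseteq> \<Omega>"
  shows "v (x + e) - v x \<le> B"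
proof (rule field_le_epsilon)
  fix \<epsilon> :: real assume "\<epsilon> > 0"
  obtain d0 where d0: "d0 > 0" "(\<Union>y\<in>closed_segment x (x + e). ball y d0) \<subseteq> \<Omega>"
    using compact_subset_open_imp_ball_epsilon_subset[OF compact_segment op seg] .
  have "isCont v y" for y using v by (simp add: continuous_on_eq_continuous_at)
  then have "\<exists>d>0. \<forall>z. dist z y < d \<longrightarrow> dist (v z) (v y) < \<epsilon> / 2" for y
    using \<open>\<epsilon> > 0\<close> unfolding continuous_at_eps_delta dist_norm by (metis half_gt_zero)
  then obtain d1 d2 where d12: "d1 > 0" "\<And>z. dist z x < d1 \<Longrightarrow> \<bar>v z - v x\<bar> < \<epsilon> / 2"
    "d2 > 0" "\<And>z. dist z (x + e) < d2 \<Longrightarrow> \<bar>v z - v (x + e)\<bar> < \<epsilon> / 2"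
    unfolding dist_real_def by metis
  define d where "d = min d0 (min d1 d2)"
  have d: "d > 0" "d \<le> d0" "d \<le> d1" "d \<le> d2" unfolding d_def using d0 d12 by auto
  obtain p q where pq: "cbox p q \<subseteq> ball x d" "x \<in> box p q"
    using open_contains_cbox[OF open_ball, of x x d] d(1) by (metis centre_in_ball)
  define \<phi> where "\<phi> = bump 1 p q"
  define I where "I = (LINT z|lebesgue. \<phi> z)"
  have I: "I > 0" unfolding I_def \<phi>_def using pq(2) by (intro LINT_bump_pos) auto
  have \<phi>0: "\<phi> z = 0" if "z \<notin> ball x d" for z
    unfolding \<phi>_def using that pq(1) box_subset_cbox[of p q] by (intro bump_eq_0) auto
  have \<phi>nn: "0 \<le> \<phi> z" for z unfolding \<phi>_def by (rule bump_nonneg) simp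
  have tf: "test_function UNIV \<phi>" unfolding \<phi>_def by (intro test_function_bump) auto
  have c\<phi>: "continuous_on UNIV \<phi>" by (rule test_function_continuous[OF tf])
  have b\<phi>: "\<phi> \<in> borel_measurable borel" by (rule borel_measurable_continuous_onI[OF c\<phi>])
  have test: "test_function \<Omega> (\<lambda>z. \<phi> (z - t *\<^sub>R e))" if t: "0 \<le> t" "t \<le> 1" for t
  proof -
    have "cbox (p + t *\<^sub>R e) (q + t *\<^sub>R e) \<subseteq> \<Omega>"
    proof
      fix z assume "z \<in> cbox (p + t *\<^sub>R e) (q + t *\<^sub>R e)"
      then have "z - t *\<^sub>R e \<in> cbox p q" by (simp add: mem_box inner_simps algebra_simps)
      then have "dist (x + t *\<^sub>R e) z < d0"
        using pq(1) d(2) by (auto simp: dist_norm algebra_simps)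
      moreover have "x + t *\<^sub>R e \<in> closed_segment x (x + e)"
        using t unfolding closed_segment_def by (auto intro!: exI[of _ t] simp: algebra_simps)
      ultimately have "z \<in> (\<Union>y\<in>closed_segment x (x + e). ball y d0)" by (intro UN_I[of "x + t *\<^sub>R e"]) auto
      then show "z \<in> \<Omega>" using d0(2) by (rule subsetD[rotated])
    qed
    then have "test_function \<Omega> (bump 1 (p + t *\<^sub>R e) (q + t *\<^sub>R e))" by (intro test_function_bump) auto
    then show ?thesis unfolding \<phi>_def bump_translate .
  qed
  have Dt: "frechet_derivative (\<lambda>z. \<phi> (z - c)) (at z) = frechet_derivative \<phi> (at (z - c))" for z c
  proof (rule frechet_derivative_eq)
    have "((\<lambda>z. z - c) has_derivative (\<lambda>h. h)) (at z)" by (auto intro!: derivative_eq_intros)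
    from has_derivative_compose[OF this test_function_has_derivative[OF tf]]
    show "((\<lambda>z. \<phi> (z - c)) has_derivative frechet_derivative \<phi> (at (z - c))) (at z)" .
  qed
  define \<Phi> where "\<Phi> t = (LINT z|lebesgue. v z * \<phi> (z - t *\<^sub>R e))" for t
  have It: "(LINT z|lebesgue. \<phi> (z - t *\<^sub>R e)) = I" for t
    unfolding I_def using LINT_translate[OF b\<phi>, of "- (t *\<^sub>R e)"] by simp
  \<comment> \<open>one box carries all translates of the bump\<close>
  define W where "W = (\<lambda>(t, z). z + t *\<^sub>R e) ` ({0..1} \<times> cbox p q)"
  have "compact W" unfolding W_def
    by (intro compact_continuous_image compact_Times continuous_intros) (auto simp: split_beta intro!: continuous_intros)
  then obtain m M where mM: "W \<subseteq> cbox m M"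
    using bounded_subset_cbox_symmetric[OF compact_imp_bounded] by metis
  have off: "\<phi> (z - t *\<^sub>R e) = 0" "frechet_derivative \<phi> (at (z - t *\<^sub>R e)) e = 0"
    if "0 \<le> t" "t \<le> 1" "z \<notin> cbox m M" for t z
  proof -
    have "z - t *\<^sub>R e \<notin> cbox p q"
    proof
      assume "z - t *\<^sub>R e \<in> cbox p q"
      then have "z \<in> W" unfolding W_def using that by (auto intro!: image_eqI[of _ _ "(t, z - t *\<^sub>R e)"])
      then show False using mM that by auto
    qed
    then have out: "z - t *\<^sub>R e \<in> - cbox p q" by simp
    have zero: "\<phi> y = 0" if "y \<in> - cbox p q" for y
      unfolding \<phi>_def using that box_subset_cbox[of p q] by (intro bump_eq_0) auto
    show "\<phi> (z - t *\<^sub>R e) = 0" using zero out by auto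
    have "((\<lambda>x. 0) has_derivative (\<lambda>h. 0)) (at (z - t *\<^sub>R e))" by simp
    then have "(\<phi> has_derivative (\<lambda>h. 0)) (at (z - t *\<^sub>R e))"
      by (rule has_derivative_transform_within_open[of _ _ _ _ "- cbox p q"])
         (use zero out in \<open>auto simp: closed_cbox open_Compl\<close>)
    then show "frechet_derivative \<phi> (at (z - t *\<^sub>R e)) e = 0" by (simp add: frechet_derivative_eq)
  qed
  have cD: "continuous_on UNIV (\<lambda>y. frechet_derivative \<phi> (at y) e)"
    by (rule test_function_continuous_derivative[OF tf])
  have \<Phi>int: "\<Phi> t = integral (cbox m M) (\<lambda>z. v z * \<phi> (z - t *\<^sub>R e))" if "0 \<le> t" "t \<le> 1" for t
    unfolding \<Phi>_def
  proof (rule LINT_eq_integral_cbox)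
    show "continuous_on UNIV (\<lambda>z. v z * \<phi> (z - t *\<^sub>R e))"
      by (intro continuous_on_mult v continuous_on_compose2[OF c\<phi>] continuous_on_diff continuous_on_id continuous_on_const) auto
  qed (simp add: off that)
  have \<Phi>D: "(\<Phi> has_real_derivative (LINT z|lebesgue. v z * - frechet_derivative \<phi> (at (z - t *\<^sub>R e)) e)) (at t within {0..1})"
    if t: "t \<in> {0..1}" for t
  proof -
    have 1: "((\<lambda>t. integral (cbox m M) (\<lambda>z. v z * \<phi> (z - t *\<^sub>R e))) has_real_derivative
        integral (cbox m M) (\<lambda>z. v z * - frechet_derivative \<phi> (at (z - t *\<^sub>R e)) e)) (at t within {0..1})"
    proof (rule leibniz_rule_field_derivative[where fx = "\<lambda>t z. v z * - frechet_derivative \<phi> (at (z - t *\<^sub>R e)) e"])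
      fix t z
      have "((\<lambda>t. z - t *\<^sub>R e) has_derivative (\<lambda>h. - (h *\<^sub>R e))) (at t within {0..1})"
        by (auto intro!: derivative_eq_intros)
      from has_derivative_compose[OF this test_function_has_derivative[OF tf]]
      have "((\<lambda>t. \<phi> (z - t *\<^sub>R e)) has_derivative (\<lambda>h. frechet_derivative \<phi> (at (z - t *\<^sub>R e)) (- (h *\<^sub>R e)))) (at t within {0..1})" .
      moreover have "frechet_derivative \<phi> (at (z - t *\<^sub>R e)) (- (h *\<^sub>R e)) = - frechet_derivative \<phi> (at (z - t *\<^sub>R e)) e * h" for h
        using linear_scale[OF has_derivative_linear[OF test_function_has_derivative[OF tf]], of "z - t *\<^sub>R e" "- h" e] by simp
      ultimately have "((\<lambda>t. \<phi> (z - t *\<^sub>R e)) has_real_derivative - frechet_derivative \<phi> (at (z - t *\<^sub>R e)) e) (at t within {0..1})"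
        unfolding has_field_derivative_def by (simp only:)
      then show "((\<lambda>t. v z * \<phi> (z - t *\<^sub>R e)) has_real_derivative v z * - frechet_derivative \<phi> (at (z - t *\<^sub>R e)) e) (at t within {0..1})"
        by (rule DERIV_cmult)
    next
      fix t
      show "(\<lambda>z. v z * \<phi> (z - t *\<^sub>R e)) integrable_on cbox m M"
        by (intro integrable_continuous continuous_on_mult continuous_on_subset[OF v] continuous_on_compose2[OF c\<phi>] continuous_on_diff continuous_on_id continuous_on_const) auto
    next
      show "continuous_on ({0..1} \<times> cbox m M) (\<lambda>(t, z). v z * - frechet_derivative \<phi> (at (z - t *\<^sub>R e)) e)"
        unfolding split_beta
        by (intro continuous_on_mult continuous_on_minus continuous_on_compose2[OF v] continuous_on_compose2[OF cD]
            continuous_on_diff continuous_on_fst continuous_on_snd continuous_on_scaleR continuous_on_id continuous_on_const) auto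
    qed (use t in auto)
    have 2: "(LINT z|lebesgue. v z * - frechet_derivative \<phi> (at (z - t *\<^sub>R e)) e)
        = integral (cbox m M) (\<lambda>z. v z * - frechet_derivative \<phi> (at (z - t *\<^sub>R e)) e)"
    proof (rule LINT_eq_integral_cbox)
      show "continuous_on UNIV (\<lambda>z. v z * - frechet_derivative \<phi> (at (z - t *\<^sub>R e)) e)"
        by (intro continuous_on_mult continuous_on_minus v continuous_on_compose2[OF cD] continuous_on_diff continuous_on_id continuous_on_const) auto
    qed (use off t in auto)
    show ?thesis
      unfolding 2 by (rule has_field_derivative_transform_within[OF 1, where d = 1]) (use \<Phi>int t in auto)
  qed
  have D_le: "(LINT z|lebesgue. v z * - frechet_derivative \<phi> (at (z - t *\<^sub>R e)) e) \<le> B * I" if t: "0 \<le> t" "t \<le> 1" for t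
  proof -
    note tst = test[OF t]
    have "(LINT z|lebesgue. v z * - frechet_derivative \<phi> (at (z - t *\<^sub>R e)) e)
        = (LINT z|lebesgue. (G z \<bullet> e) * \<phi> (z - t *\<^sub>R e))"
      using weak_gradient_directional(2)[OF op G tst, of e] unfolding Dt by simp
    also have "\<dots> \<le> (LINT z|lebesgue. B * \<phi> (z - t *\<^sub>R e))"
    proof (rule integral_mono_AE)
      show "integrable lebesgue (\<lambda>z. (G z \<bullet> e) * \<phi> (z - t *\<^sub>R e))" by (rule weak_gradient_directional[OF op G tst])
      show "integrable lebesgue (\<lambda>z. B * \<phi> (z - t *\<^sub>R e))"
        by (rule integrable_mult_test[OF locally_integrable_continuous tst]) simp
      have "AE z in lebesgue. z \<in> \<Omega> \<longrightarrow> G z \<bullet> e \<le> B"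
        using bd op by (simp add: AE_restrict_space_iff borel_open)
      then show "AE z in lebesgue. (G z \<bullet> e) * \<phi> (z - t *\<^sub>R e) \<le> B * \<phi> (z - t *\<^sub>R e)"
      proof eventually_elim
        fix z assume z: "z \<in> \<Omega> \<longrightarrow> G z \<bullet> e \<le> B"
        show "(G z \<bullet> e) * \<phi> (z - t *\<^sub>R e) \<le> B * \<phi> (z - t *\<^sub>R e)"
        proof (cases "z \<in> \<Omega>")
          case True then show ?thesis using z \<phi>nn by (intro mult_right_mono) auto
        next
          case False
          then have "\<phi> (z - t *\<^sub>R e) = 0" using tst unfolding test_function_def by blast
          then show ?thesis by simp
        qed
      qed
    qed
    also have "\<dots> = B * I" using It by simp
    finally show ?thesis .
  qed
  have "\<exists>\<xi>\<in>{0..1}. \<Phi> 1 - \<Phi> 0 = (LINT z|lebesgue. v z * - frechet_derivative \<phi> (at (z - \<xi> *\<^sub>R e)) e) * (1 - 0)"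
    by (rule mvt_very_simple[OF zero_le_one \<Phi>D[unfolded has_field_derivative_def]]) simp
  then have Bound: "\<Phi> 1 - \<Phi> 0 \<le> B * I" using D_le by auto
  have int_test: "integrable lebesgue (\<lambda>z. g z * \<phi> (z - t *\<^sub>R e))"
    if "continuous_on UNIV g" "0 \<le> t" "t \<le> 1" for g t
    by (rule integrable_mult_test(1)[OF locally_integrable_continuous[OF that(1)] test[OF that(2,3)]])
  have "\<Phi> 0 \<le> (v x + \<epsilon> / 2) * I"
  proof -
    have "\<Phi> 0 \<le> (LINT z|lebesgue. (v x + \<epsilon> / 2) * \<phi> (z - 0 *\<^sub>R e))"
      unfolding \<Phi>_def
    proof (intro integral_mono_AE int_test v continuous_on_const AE_I2)
      fix z
      show "v z * \<phi> (z - 0 *\<^sub>R e) \<le> (v x + \<epsilon> / 2) * \<phi> (z - 0 *\<^sub>R e)"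
      proof (cases "z \<in> ball x d")
        case True
        then have "\<bar>v z - v x\<bar> < \<epsilon> / 2" using d(3) by (intro d12(2)) (simp add: dist_commute)
        then have "v z \<le> v x + \<epsilon> / 2" by linarith
        then show ?thesis by (rule mult_right_mono[OF _ \<phi>nn])
      qed (simp add: \<phi>0)
    qed auto
    then show ?thesis using It[of 0] by simp
  qed
  moreover have "(v (x + e) - \<epsilon> / 2) * I \<le> \<Phi> 1"
  proof -
    have "(LINT z|lebesgue. (v (x + e) - \<epsilon> / 2) * \<phi> (z - 1 *\<^sub>R e)) \<le> \<Phi> 1"
      unfolding \<Phi>_def
    proof (intro integral_mono_AE int_test v continuous_on_const AE_I2)
      fix z
      have dz: "dist z (x + e) = dist x (z - e)" by (simp add: dist_norm norm_minus_commute algebra_simps)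
      show "(v (x + e) - \<epsilon> / 2) * \<phi> (z - 1 *\<^sub>R e) \<le> v z * \<phi> (z - 1 *\<^sub>R e)"
      proof (cases "z - e \<in> ball x d")
        case True
        then have "\<bar>v z - v (x + e)\<bar> < \<epsilon> / 2" using d(4) dz by (intro d12(4)) simp
        then have "v (x + e) - \<epsilon> / 2 \<le> v z" by linarith
        then show ?thesis by (rule mult_right_mono[OF _ \<phi>nn])
      qed (simp add: \<phi>0)
    qed auto
    then show ?thesis using It[of 1] by simp
  qed
  ultimately have "(v (x + e) - v x - \<epsilon>) * I \<le> B * I" using Bound by (simp add: algebra_simps)
  then show "v (x + e) - v x \<le> B + \<epsilon>" using I by simp
qed


section \<open>Differentiability of Lipschitz functions almost everywhere\<close>

text \<open>After adding a linear function, \<open>s\<close> becomes a bi-Lipschitz increasing homeomorphism \<open>F\<close>.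
  The image of Lebesgue measure under the inverse of \<open>F\<close> is the Stieltjes measure of \<open>F\<close>; it is
  absolutely continuous because Lipschitz maps preserve null sets, and its Radon--Nikodym density
  is the derivative of \<open>F\<close> by the Lebesgue differentiation theorem.\<close>

lemma lipschitz_real_right_quotients_converge:
  fixes s :: "real \<Rightarrow> real"
  assumes s: "C-lipschitz_on UNIV s"
  shows "AE t in lborel. convergent (\<lambda>n. real (Suc n) * (s (t + 1 / real (Suc n)) - s t))"
proof -
  define k where "k = C + 1"
  define F where "F t = s t + k * t" for t
  have C: "C \<ge> 0" using s by (rule lipschitz_on_nonneg)
  have sC: "\<bar>s a - s b\<bar> \<le> C * \<bar>a - b\<bar>" for a b
    using lipschitz_onD[OF s, of a b] by (simp add: dist_real_def)
  have Fge: "b - a \<le> F b - F a" if "a \<le> b" for a b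
    using sC[of b a] that unfolding F_def k_def by (simp add: algebra_simps)
  have Fle: "\<bar>F b - F a\<bar> \<le> (C + k) * \<bar>b - a\<bar>" for a b
  proof -
    have "F b - F a = (s b - s a) + k * (b - a)" unfolding F_def by (simp add: algebra_simps)
    also have "\<bar>\<dots>\<bar> \<le> \<bar>s b - s a\<bar> + \<bar>k * (b - a)\<bar>" by (rule abs_triangle_ineq)
    also have "\<dots> \<le> C * \<bar>b - a\<bar> + k * \<bar>b - a\<bar>"
      using sC[of b a] C by (simp add: abs_mult k_def)
    finally show ?thesis by (simp add: distrib_right)
  qed
  have mono: "strict_mono F" 
  proof (rule strict_monoI)
    show "F a < F b" if "a < b" for a b using Fge[of a b] that by linarith
  qed
  have contF: "continuous_on UNIV F"
    unfolding F_def using lipschitz_on_continuous_on[OF s] by (intro continuous_intros)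
  have surj: "\<exists>t. F t = y" for y
  proof -
    define M where "M = \<bar>y - F 0\<bar>"
    have "F (- M) \<le> y" "y \<le> F M" "- M \<le> M"
      using Fge[of "- M" 0] Fge[of 0 M] unfolding M_def by auto
    then show ?thesis
      using IVT'[of F "- M" y M] continuous_on_subset[OF contF] by blast
  qed
  define G where "G = inv F"
  have FG: "F (G y) = y" for y unfolding G_def using surj by (metis f_inv_into_f rangeI)
  have GF: "G (F t) = t" for t unfolding G_def using mono by (simp add: strict_mono_imp_inj_on)
  have "1-lipschitz_on UNIV G"
  proof (rule lipschitz_onI)
    fix y z
    show "dist (G y) (G z) \<le> 1 * dist y z"
      using Fge[of "G y" "G z"] Fge[of "G z" "G y"] unfolding FG dist_real_def
      by (cases "G y \<le> G z") auto
  qed simp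
  then have G_meas[measurable]: "G \<in> borel_measurable borel"
    by (rule borel_measurable_continuous_onI[OF lipschitz_on_continuous_on])
  define \<mu> where "\<mu> = distr lborel borel G"
  have vim: "G -` A = F ` A" for A
  proof (intro set_eqI iffI)
    show "y \<in> F ` A" if "y \<in> G -` A" for y by (rule image_eqI[of _ _ "G y"]) (use that FG in auto)
  qed (auto simp: GF)
  have \<mu>_Icc: "emeasure \<mu> {a..b} = ennreal (F b - F a)" if "a \<le> b" for a b
  proof -
    have "G -` {a..b} = {F a..F b}"
    proof (intro set_eqI)
      fix y
      have "a \<le> G y \<longleftrightarrow> F a \<le> y" "G y \<le> b \<longleftrightarrow> y \<le> F b"
        using strict_mono_less_eq[OF mono, of a "G y"] strict_mono_less_eq[OF mono, of "G y" b] unfolding FG by simp_all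
      then show "y \<in> G -` {a..b} \<longleftrightarrow> y \<in> {F a..F b}" by auto
    qed
    moreover have "F a \<le> F b" using Fge[OF that] that by simp
    ultimately show ?thesis unfolding \<mu>_def by (subst emeasure_distr) auto
  qed
  have ac: "absolutely_continuous lborel \<mu>"
    unfolding absolutely_continuous_def
  proof
    fix N :: "real set" assume N: "N \<in> null_sets lborel"
    then have "negligible N" by (simp add: negligible_iff_null_sets null_sets_completionI)
    then have "negligible (F ` N)"
      by (rule negligible_locally_Lipschitz_image[OF order_refl])
         (use Fle in \<open>auto intro!: exI[of _ UNIV] exI[of _ "C + k"]\<close>)
    moreover have "G -` N \<in> sets lborel" using N measurable_sets[OF G_meas, of N] by auto
    ultimately have "G -` N \<in> null_sets lborel"
      unfolding vim[symmetric] by (simp add: negligible_iff_null_sets null_sets_completion_iff)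
    then show "N \<in> null_sets \<mu>"
      using N unfolding \<mu>_def null_sets_def by (auto simp: emeasure_distr)
  qed
  have "sets \<mu> = sets lborel" unfolding \<mu>_def by simp
  then obtain f where f[measurable]: "f \<in> borel_measurable lborel" and dens: "density lborel f = \<mu>"
    using sigma_finite_measure.Radon_Nikodym[OF sigma_finite_lborel ac] by blast
  have f_int: "(\<integral>\<^sup>+t. f t * indicator {a..b} t \<partial>lborel) = ennreal (F b - F a)" if "a \<le> b" for a b
    using \<mu>_Icc[OF that] unfolding dens[symmetric] by (subst (asm) emeasure_density) auto
  have "AE t in lborel. f t * indicator {- real n..real n} t \<noteq> \<infinity>" for n
  proof (rule nn_integral_PInf_AE)
    show "(\<integral>\<^sup>+t. f t * indicator {- real n..real n} t \<partial>lborel) \<noteq> \<infinity>"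
      using f_int[of "- real n" "real n"] by simp
  qed measurable
  then have "AE t in lborel. \<forall>n. f t * indicator {- real n..real n} t \<noteq> \<infinity>" by (simp add: AE_all_countable)
  then have fin: "AE t in lborel. ennreal (enn2real (f t)) = f t"
  proof eventually_elim
    fix t assume *: "\<forall>n. f t * indicator {- real n..real n} t \<noteq> \<infinity>"
    obtain n where "\<bar>t\<bar> \<le> real n" using real_arch_simple by blast
    then have "f t \<noteq> \<infinity>" using *[rule_format, of n] by (auto simp: indicator_def abs_le_iff)
    then show "ennreal (enn2real (f t)) = f t" by (simp add: less_top)
  qed
  define h where "h t = enn2real (f t)" for t
  have h_int: "(h has_integral (F b - F a)) {a..b}" if "a \<le> b" for a b
  proof -
    have "((\<lambda>t. indicator {a..b} t * h t) has_integral (F b - F a)) UNIV"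
    proof (rule nn_integral_has_integral)
      show "(\<lambda>t. indicator {a..b} t * h t) \<in> borel_measurable borel" unfolding h_def by measurable
      show "0 \<le> indicator {a..b} t * h t" for t unfolding h_def by simp
      show "0 \<le> F b - F a" using Fge[OF that] that by simp
      have "(\<integral>\<^sup>+t. ennreal (indicator {a..b} t * h t) \<partial>lborel) = (\<integral>\<^sup>+t. f t * indicator {a..b} t \<partial>lborel)"
        by (rule nn_integral_cong_AE) (use fin in \<open>eventually_elim, auto simp: h_def indicator_def\<close>)
      then show "(\<integral>\<^sup>+t. ennreal (indicator {a..b} t * h t) \<partial>lborel) = ennreal (F b - F a)"
        using f_int[OF that] by simp
    qed
    moreover have "(\<lambda>t. indicator {a..b} t * h t) = (\<lambda>t. if t \<in> {a..b} then h t else 0)"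
      by (auto simp: fun_eq_iff)
    ultimately show ?thesis using has_integral_restrict_UNIV[of "{a..b}" h] by simp
  qed
  have "h integrable_on cbox a b" for a b
    using h_int[of a b] by (cases "a \<le> b") (auto simp: integrable_on_def)
  then obtain N where N: "negligible N"
    "\<And>x e. \<lbrakk>x \<notin> N; 0 < e\<rbrakk> \<Longrightarrow> \<exists>d>0. \<forall>r. 0 < r \<and> r < d \<longrightarrow>
        norm (integral (cbox x (x + r *\<^sub>R One)) h /\<^sub>R r ^ DIM(real) - h x) < e"
    using integrable_ccontinuous_explicit[of h] by blast
  have conv: "convergent (\<lambda>n. real (Suc n) * (s (t + 1 / real (Suc n)) - s t))" if tN: "t \<notin> N" for t
  proof -
    have "(\<lambda>n. real (Suc n) * (s (t + 1 / real (Suc n)) - s t)) \<longlonglongrightarrow> h t - k"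
    proof (rule LIMSEQ_I)
      fix e :: real assume "e > 0"
      then obtain d where d: "d > 0" "\<And>r. 0 < r \<Longrightarrow> r < d \<Longrightarrow> norm (integral (cbox t (t + r *\<^sub>R One)) h /\<^sub>R r ^ DIM(real) - h t) < e"
        using N(2)[OF tN, of e] by blast
      obtain M where M: "1 / real (Suc M) < d" using d(1) reals_Archimedean[of d] by (auto simp: inverse_eq_divide)
      have "norm (real (Suc n) * (s (t + 1 / real (Suc n)) - s t) - (h t - k)) < e" if "n \<ge> M" for n
      proof -
        define r where "r = 1 / real (Suc n)"
        have "r \<le> 1 / real (Suc M)" unfolding r_def using that by (intro divide_left_mono) auto
        then have r: "0 < r" "r < d" using M unfolding r_def by auto
        have "integral {t..t + r} h = F (t + r) - F t" using r by (intro integral_unique h_int) auto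
        then have "\<bar>(F (t + r) - F t) / r - h t\<bar> < e"
          using d(2)[OF r] by (simp add: divide_inverse mult.commute)
        moreover have "(F (t + r) - F t) / r = (s (t + r) - s t) / r + k"
          unfolding F_def using r by (simp add: field_simps)
        ultimately have "\<bar>(s (t + r) - s t) / r - (h t - k)\<bar> < e" by (simp add: algebra_simps)
        then show ?thesis unfolding r_def by (simp add: mult.commute)
      qed
      then show "\<exists>M. \<forall>n\<ge>M. norm (real (Suc n) * (s (t + 1 / real (Suc n)) - s t) - (h t - k)) < e" by blast
    qed
    then show ?thesis by (rule convergentI)
  qed
  have null: "N \<in> null_sets lebesgue" using N(1) by (simp add: negligible_iff_null_sets)
  have "AE t in lebesgue. convergent (\<lambda>n. real (Suc n) * (s (t + 1 / real (Suc n)) - s t))"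
    by (rule AE_I'[OF null]) (use conv in auto)
  then show ?thesis by (simp add: AE_completion_iff)
qed

text \<open>Fubini's theorem for the map \<open>(x, t) \<mapsto> x + t *\<^sub>R e\<close>: a Borel set that meets every line of
  direction \<open>e\<close> in a null set is a null set.  This map treats all directions alike.\<close>

lemma null_set_by_lines:
  fixes E :: "'a::euclidean_space set"
  assumes E[measurable]: "E \<in> sets borel"
    and lines: "\<And>x. AE t in lborel. x + t *\<^sub>R e \<notin> E"
  shows "E \<in> null_sets lborel"
proof -
  have m: "(\<lambda>(x, t). indicator E (x + t *\<^sub>R e) :: ennreal) \<in> borel_measurable ((lborel :: 'a measure) \<Otimes>\<^sub>M (lborel :: real measure))"
    by measurable
  have "(\<integral>\<^sup>+ x. indicator E (x + t *\<^sub>R e) \<partial>lborel) = emeasure lborel E" for t :: real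
  proof -
    have "(\<integral>\<^sup>+ x. indicator E (x + t *\<^sub>R e) \<partial>lborel) = (\<integral>\<^sup>+ x. indicator E ((t *\<^sub>R e) + x) \<partial>lborel)"
      by (simp add: add.commute)
    also have "\<dots> = (\<integral>\<^sup>+ x. indicator E x \<partial>distr lborel borel ((+) (t *\<^sub>R e)))"
      by (subst nn_integral_distr) auto
    also have "\<dots> = emeasure lborel E" by (simp add: lborel_distr_plus)
    finally show ?thesis .
  qed
  then have "(\<integral>\<^sup>+ (t::real). emeasure lborel E \<partial>lborel)
      = (\<integral>\<^sup>+ t. (\<integral>\<^sup>+ x. indicator E (x + t *\<^sub>R e) \<partial>lborel) \<partial>lborel)" by simp
  also have "\<dots> = (\<integral>\<^sup>+ x. (\<integral>\<^sup>+ t. indicator E (x + t *\<^sub>R e) \<partial>lborel) \<partial>lborel)"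
    using lborel_pair.Fubini'[OF m] .
  also have "\<dots> = (\<integral>\<^sup>+ x. 0 \<partial>(lborel :: 'a measure))"
  proof (rule nn_integral_cong)
    fix x :: 'a
    have "(\<integral>\<^sup>+ t. indicator E (x + t *\<^sub>R e) \<partial>lborel) = (\<integral>\<^sup>+ (t::real). 0 \<partial>lborel)"
      using lines[of x] by (intro nn_integral_cong_AE) (auto simp: indicator_def)
    then show "(\<integral>\<^sup>+ t. indicator E (x + t *\<^sub>R e) \<partial>lborel) = 0" by simp
  qed
  finally have "emeasure lborel E = 0" by simp
  then show ?thesis by (simp add: null_sets_def)
qed

text \<open>Restricting the steps to a sequence makes the limit Borel measurable by construction.\<close>

definition diff_quotient :: "'a \<Rightarrow> ('a::euclidean_space \<Rightarrow> real) \<Rightarrow> nat \<Rightarrow> 'a \<Rightarrow> real" where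
  "diff_quotient e w n x = real (Suc n) * (w (x + (1 / real (Suc n)) *\<^sub>R e) - w x)"

definition slope_limit :: "'a \<Rightarrow> ('a::euclidean_space \<Rightarrow> real) \<Rightarrow> 'a \<Rightarrow> real" where
  "slope_limit e w x = lim (\<lambda>n. diff_quotient e w n x)"

lemma diff_quotient_borel[measurable]:
  assumes "continuous_on UNIV w" shows "diff_quotient e w n \<in> borel_measurable borel"
proof -
  have [measurable]: "w \<in> borel_measurable borel" using assms by (rule borel_measurable_continuous_onI)
  show ?thesis unfolding diff_quotient_def by measurable
qed

lemma slope_limit_borel:
  assumes "continuous_on UNIV w" shows "slope_limit e w \<in> borel_measurable borel"
  unfolding slope_limit_def by (rule borel_measurable_lim_metric) (rule diff_quotient_borel[OF assms])

lemma diff_quotient_bounded: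
  assumes "C-lipschitz_on UNIV w" shows "\<bar>diff_quotient e w n x\<bar> \<le> C * norm e"
proof -
  have "\<bar>w (x + (1 / real (Suc n)) *\<^sub>R e) - w x\<bar> \<le> C * norm ((1 / real (Suc n)) *\<^sub>R e)"
    using lipschitz_onD[OF assms, of "x + (1 / real (Suc n)) *\<^sub>R e" x] by (simp add: dist_norm)
  then have "real (Suc n) * \<bar>w (x + (1 / real (Suc n)) *\<^sub>R e) - w x\<bar> \<le> real (Suc n) * (C * norm ((1 / real (Suc n)) *\<^sub>R e))"
    by (intro mult_left_mono) auto
  then show ?thesis unfolding diff_quotient_def by (simp add: abs_mult)
qed

lemma diff_quotient_converges:
  fixes w :: "'a::euclidean_space \<Rightarrow> real"
  assumes w: "C-lipschitz_on UNIV w"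
  shows "AE x in lborel. convergent (\<lambda>n. diff_quotient e w n x)"
proof -
  have cw: "continuous_on UNIV w" using w by (rule lipschitz_on_continuous_on)
  define E where "E = {x. \<not> convergent (\<lambda>n. diff_quotient e w n x)}"
  have "{x \<in> space borel. Cauchy (\<lambda>n. diff_quotient e w n x)} \<in> sets borel"
    by (rule sets_Collect_Cauchy) (rule diff_quotient_borel[OF cw])
  then have "{x. convergent (\<lambda>n. diff_quotient e w n x)} \<in> sets borel"
    by (simp add: Cauchy_convergent_iff)
  then have "- {x. convergent (\<lambda>n. diff_quotient e w n x)} \<in> sets borel" by (rule borel_comp)
  then have E: "E \<in> sets borel" unfolding E_def by (simp add: Collect_neg_eq)
  have "E \<in> null_sets lborel"
  proof (rule null_set_by_lines[OF E, where e = e])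
    fix x
    have "(C * norm e)-lipschitz_on UNIV (\<lambda>t. w (x + t *\<^sub>R e))"
    proof (rule lipschitz_onI)
      fix t t' :: real
      have "dist (x + t *\<^sub>R e) (x + t' *\<^sub>R e) = norm e * dist t t'"
        unfolding dist_norm real_norm_def by (simp add: scaleR_diff_left[symmetric] mult.commute)
      then show "dist (w (x + t *\<^sub>R e)) (w (x + t' *\<^sub>R e)) \<le> C * norm e * dist t t'"
        using lipschitz_onD[OF w, of "x + t *\<^sub>R e" "x + t' *\<^sub>R e"] by (simp only: mult.assoc UNIV_I)
    qed (use lipschitz_on_nonneg[OF w] in simp)
    from lipschitz_real_right_quotients_converge[OF this]
    show "AE t in lborel. x + t *\<^sub>R e \<notin> E"
      by eventually_elim (simp add: E_def diff_quotient_def algebra_simps)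
  qed
  then show ?thesis by (rule AE_I') (auto simp: E_def)
qed

lemma diff_quotient_tendsto:
  assumes w: "C-lipschitz_on UNIV w"
  shows "AE x in lebesgue. (\<lambda>n. diff_quotient e w n x) \<longlonglongrightarrow> slope_limit e w x"
proof -
  have "AE x in lebesgue. convergent (\<lambda>n. diff_quotient e w n x)"
    using diff_quotient_converges[OF w] by (rule AE_completion)
  then show ?thesis by eventually_elim (simp add: convergent_LIMSEQ_iff slope_limit_def)
qed

lemma slope_limit_bounded:
  assumes w: "C-lipschitz_on UNIV w"
  shows "AE x in lebesgue. \<bar>slope_limit e w x\<bar> \<le> C * norm e"
  using diff_quotient_tendsto[OF w, of e]
proof eventually_elim
  fix x assume "(\<lambda>n. diff_quotient e w n x) \<longlonglongrightarrow> slope_limit e w x"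
  then have "(\<lambda>n. \<bar>diff_quotient e w n x\<bar>) \<longlonglongrightarrow> \<bar>slope_limit e w x\<bar>" by (rule tendsto_rabs)
  then show "\<bar>slope_limit e w x\<bar> \<le> C * norm e"
    by (rule LIMSEQ_le_const2) (use diff_quotient_bounded[OF w] in auto)
qed

lemma test_function_lipschitz:
  assumes \<phi>: "test_function \<Omega> \<phi>"
  obtains B where "B-lipschitz_on UNIV \<phi>"
proof -
  obtain K where "compact K" "K \<subseteq> \<Omega>" "\<And>x. x \<notin> K \<Longrightarrow> \<phi> x = 0"
    and off: "\<And>x e. x \<notin> K \<Longrightarrow> frechet_derivative \<phi> (at x) e = 0"
    using test_function_support[OF \<phi>] by blast
  have "\<exists>B. \<forall>x. \<bar>frechet_derivative \<phi> (at x) b\<bar> \<le> B" for b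
    by (rule bounded_of_compact_support[OF test_function_continuous_derivative[OF \<phi>, of b] \<open>compact K\<close> off]) auto
  then obtain B where B: "\<And>x b. \<bar>frechet_derivative \<phi> (at x) b\<bar> \<le> B b" by metis
  define M where "M = (\<Sum>b\<in>Basis. B b)"
  have B0: "0 \<le> B b" for b using B[of undefined b] by simp
  have onorm: "onorm (frechet_derivative \<phi> (at x)) \<le> M" for x
  proof (rule onorm_le)
    fix e
    have "norm (frechet_derivative \<phi> (at x) e) \<le> (\<Sum>b\<in>Basis. \<bar>(e \<bullet> b) * frechet_derivative \<phi> (at x) b\<bar>)"
      by (subst frechet_derivative_expand[OF \<phi>]) simp
    also have "\<dots> \<le> (\<Sum>b\<in>Basis. norm e * B b)"
      using B B0 by (intro sum_mono) (auto simp: abs_mult intro!: mult_mono Basis_le_norm)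
    finally show "norm (frechet_derivative \<phi> (at x) e) \<le> M * norm e"
      unfolding M_def by (simp add: sum_distrib_left mult.commute)
  qed
  have "M-lipschitz_on UNIV \<phi>"
  proof (rule lipschitz_onI)
    fix x y
    have "norm (\<phi> x - \<phi> y) \<le> M * norm (x - y)"
      by (rule differentiable_bound[where S = UNIV and f' = "\<lambda>x. frechet_derivative \<phi> (at x)"])
         (use test_function_has_derivative[OF \<phi>] onorm in auto)
    then show "dist (\<phi> x) (\<phi> y) \<le> M * dist x y" by (simp add: dist_norm)
  qed (use B0 in \<open>auto simp: M_def intro: sum_nonneg\<close>)
  then show ?thesis by (rule that)
qed

text \<open>Summation by parts for difference quotients, passed to the limit by dominated convergence.\<close>

lemma slope_limit_weak_partial:
  fixes w :: "'a::euclidean_space \<Rightarrow> real"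
  assumes op: "open \<Omega>" and w: "C-lipschitz_on UNIV w"
  shows "has_weak_partial \<Omega> e w (slope_limit e w)"
  unfolding has_weak_partial_iff[OF op]
proof (intro conjI allI impI)
  have cw: "continuous_on UNIV w" using w by (rule lipschitz_on_continuous_on)
  note bw = borel_measurable_continuous_onI[OF cw]
  show "locally_integrable_on \<Omega> w" by (rule locally_integrable_continuous[OF cw])
  show lis: "locally_integrable_on \<Omega> (slope_limit e w)"
    by (rule locally_integrable_bounded[OF borel_imp_lebesgue[OF slope_limit_borel[OF cw]], where B = "C * norm e"])
       (use slope_limit_bounded[OF w, of e] in \<open>eventually_elim, auto\<close>)
  fix \<phi> :: "'a \<Rightarrow> real" assume \<phi>: "test_function \<Omega> \<phi>"
  obtain K where K: "compact K" "\<And>x. x \<notin> K \<Longrightarrow> \<phi> x = 0" using \<phi> unfolding test_function_def by blast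
  have c\<phi>: "continuous_on UNIV \<phi>" by (rule test_function_continuous[OF \<phi>])
  note b\<phi> = borel_measurable_continuous_onI[OF c\<phi>]
  obtain B where B: "B-lipschitz_on UNIV \<phi>" using test_function_lipschitz[OF \<phi>] .
  obtain R where R: "K \<subseteq> cball 0 R" using compact_imp_bounded[OF K(1)] by (metis bounded_iff mem_cball_0 subsetI)
  define h where "h n = 1 / real (Suc n)" for n
  have h: "0 < h n" "h n \<le> 1" "h n * real (Suc n) = 1" for n unfolding h_def by auto
  have int_w\<phi>: "integrable lebesgue (\<lambda>x. w (x + c) * \<phi> x)" for c
    by (rule integrable_continuous_compact_support[OF _ K(1)])
       (auto simp: K(2) intro!: continuous_on_mult continuous_on_compose2[OF cw] c\<phi> continuous_on_add continuous_on_id continuous_on_const)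
  have shift: "(LINT x|lebesgue. w x * \<phi> (x + - (c *\<^sub>R e))) = (LINT x|lebesgue. w (x + c *\<^sub>R e) * \<phi> x)"
    and int_shift: "integrable lebesgue (\<lambda>x. w x * \<phi> (x + - (c *\<^sub>R e)))" for c
  proof -
    have "(\<lambda>x. w (x + c *\<^sub>R e) * \<phi> x) \<in> borel_measurable borel" using bw b\<phi> by measurable
    from LINT_translate[OF this, of "- (c *\<^sub>R e)"]
    show "(LINT x|lebesgue. w x * \<phi> (x + - (c *\<^sub>R e))) = (LINT x|lebesgue. w (x + c *\<^sub>R e) * \<phi> x)" by simp
    have "compact ((\<lambda>x. x + c *\<^sub>R e) ` K)" by (intro compact_continuous_image continuous_intros K)
    moreover have "\<phi> (x + - (c *\<^sub>R e)) = 0" if "x \<notin> (\<lambda>x. x + c *\<^sub>R e) ` K" for x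
      by (rule K(2)) (use that in \<open>auto simp: image_iff\<close>)
    ultimately show "integrable lebesgue (\<lambda>x. w x * \<phi> (x + - (c *\<^sub>R e)))"
      by (intro integrable_continuous_compact_support[where K = "(\<lambda>x. x + c *\<^sub>R e) ` K"] continuous_on_mult cw
          continuous_on_compose2[OF c\<phi>] continuous_on_add continuous_on_id continuous_on_const) auto
  qed
  have parts: "(LINT x|lebesgue. w x * diff_quotient (- e) \<phi> n x) = (LINT x|lebesgue. diff_quotient e w n x * \<phi> x)" for n
  proof -
    have "(LINT x|lebesgue. w x * diff_quotient (- e) \<phi> n x)
        = real (Suc n) * ((LINT x|lebesgue. w x * \<phi> (x + - (h n *\<^sub>R e))) - (LINT x|lebesgue. w (x + 0) * \<phi> x))"
      unfolding diff_quotient_def h_def[symmetric]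
      by (subst Bochner_Integration.integral_diff[OF int_shift int_w\<phi>, symmetric],
          subst integral_mult_right_zero[symmetric]) (simp add: algebra_simps)
    also have "\<dots> = (LINT x|lebesgue. diff_quotient e w n x * \<phi> x)"
      unfolding diff_quotient_def h_def[symmetric] shift
      by (subst Bochner_Integration.integral_diff[OF int_w\<phi> int_w\<phi>, symmetric],
          subst integral_mult_right_zero[symmetric]) (simp add: algebra_simps)
    finally show ?thesis .
  qed
  have "(\<lambda>n. LINT x|lebesgue. diff_quotient e w n x * \<phi> x) \<longlonglongrightarrow> (LINT x|lebesgue. slope_limit e w x * \<phi> x)"
  proof (rule integral_dominated_convergence[where w = "\<lambda>x. \<bar>C * norm e * \<phi> x\<bar>"])
    show "(\<lambda>x. slope_limit e w x * \<phi> x) \<in> borel_measurable lebesgue"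
      using integrable_mult_test(1)[OF lis \<phi>] by (rule borel_measurable_integrable)
    show "(\<lambda>x. diff_quotient e w n x * \<phi> x) \<in> borel_measurable lebesgue" for n
      by (intro borel_imp_lebesgue borel_measurable_times diff_quotient_borel[OF cw] b\<phi>)
    show "integrable lebesgue (\<lambda>x. \<bar>C * norm e * \<phi> x\<bar>)"
      by (intro integrable_abs integrable_mult_test(1)[OF locally_integrable_continuous \<phi>] continuous_on_const)
    show "AE x in lebesgue. (\<lambda>n. diff_quotient e w n x * \<phi> x) \<longlonglongrightarrow> slope_limit e w x * \<phi> x"
      using diff_quotient_tendsto[OF w, of e] by eventually_elim (intro tendsto_mult tendsto_const)
    show "AE x in lebesgue. norm (diff_quotient e w n x * \<phi> x) \<le> \<bar>C * norm e * \<phi> x\<bar>" for n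
    proof (rule AE_I2)
      fix x
      show "norm (diff_quotient e w n x * \<phi> x) \<le> \<bar>C * norm e * \<phi> x\<bar>"
        using diff_quotient_bounded[OF w, of e n x] lipschitz_on_nonneg[OF w]
        by (simp add: abs_mult mult_right_mono)
    qed
  qed
  moreover have "(\<lambda>n. LINT x|lebesgue. w x * diff_quotient (- e) \<phi> n x) \<longlonglongrightarrow> (LINT x|lebesgue. w x * - frechet_derivative \<phi> (at x) e)"
  proof (rule integral_dominated_convergence[where w = "\<lambda>x. indicator (cball 0 (R + norm e)) x * \<bar>w x * (B * norm e)\<bar>"])
    have "locally_integrable_on UNIV (\<lambda>x. \<bar>w x * (B * norm e)\<bar>)"
      by (rule locally_integrable_continuous) (intro continuous_on_rabs continuous_on_mult cw continuous_on_const)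
    then show "integrable lebesgue (\<lambda>x. indicator (cball 0 (R + norm e)) x * \<bar>w x * (B * norm e)\<bar>)"
      unfolding locally_integrable_on_def set_integrable_def real_scaleR_def by (meson compact_cball subset_UNIV)
    show "(\<lambda>x. w x * - frechet_derivative \<phi> (at x) e) \<in> borel_measurable lebesgue"
      by (intro borel_imp_lebesgue borel_measurable_times borel_measurable_uminus bw
          borel_measurable_continuous_onI[OF test_function_continuous_derivative[OF \<phi>]])
    show "(\<lambda>x. w x * diff_quotient (- e) \<phi> n x) \<in> borel_measurable lebesgue" for n
      by (intro borel_imp_lebesgue borel_measurable_times diff_quotient_borel[OF c\<phi>] bw)
    show "AE x in lebesgue. (\<lambda>n. w x * diff_quotient (- e) \<phi> n x) \<longlonglongrightarrow> w x * - frechet_derivative \<phi> (at x) e"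
    proof (intro AE_I2 tendsto_mult tendsto_const)
      fix x
      have "((\<lambda>t. x + t *\<^sub>R (- e)) has_derivative (\<lambda>t. t *\<^sub>R (- e))) (at 0)"
        by (auto intro!: derivative_eq_intros)
      from has_derivative_compose[OF this test_function_has_derivative[OF \<phi>]]
      have D: "((\<lambda>t. \<phi> (x + t *\<^sub>R (- e))) has_derivative (\<lambda>t. frechet_derivative \<phi> (at x) (t *\<^sub>R (- e)))) (at 0)" by simp
      have "frechet_derivative \<phi> (at x) (t *\<^sub>R (- e)) = - frechet_derivative \<phi> (at x) e * t" for t
        using linear_scale[OF has_derivative_linear[OF test_function_has_derivative[OF \<phi>]], of x "- t" e] by simp
      with D have "((\<lambda>t. \<phi> (x + t *\<^sub>R (- e))) has_real_derivative - frechet_derivative \<phi> (at x) e) (at 0)"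
        unfolding has_field_derivative_def by (simp only:)
      then have "((\<lambda>t. (\<phi> (x + t *\<^sub>R (- e)) - \<phi> x) / t) \<longlongrightarrow> - frechet_derivative \<phi> (at x) e) (at 0)"
        unfolding DERIV_def by simp
      moreover have "filterlim h (at 0) sequentially"
        unfolding h_def filterlim_at using LIMSEQ_Suc[OF lim_1_over_n] by auto
      ultimately have "(\<lambda>n. (\<phi> (x + h n *\<^sub>R (- e)) - \<phi> x) / h n) \<longlonglongrightarrow> - frechet_derivative \<phi> (at x) e"
        by (rule filterlim_compose)
      then show "(\<lambda>n. diff_quotient (- e) \<phi> n x) \<longlonglongrightarrow> - frechet_derivative \<phi> (at x) e"
        unfolding diff_quotient_def h_def by (simp add: mult.commute)
    qed
    show "AE x in lebesgue. norm (w x * diff_quotient (- e) \<phi> n x) \<le> indicator (cball 0 (R + norm e)) x * \<bar>w x * (B * norm e)\<bar>" for n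
    proof (rule AE_I2)
      fix x
      show "norm (w x * diff_quotient (- e) \<phi> n x) \<le> indicator (cball 0 (R + norm e)) x * \<bar>w x * (B * norm e)\<bar>"
      proof (cases "x \<in> cball 0 (R + norm e)")
        case True
        then show ?thesis
          using diff_quotient_bounded[OF B, of "- e" n x] lipschitz_on_nonneg[OF B] by (simp add: abs_mult mult_left_mono)
      next
        case False
        have "norm (h n *\<^sub>R e) \<le> norm e" using h[of n] by (simp add: mult_left_le_one_le)
        then have "x + h n *\<^sub>R (- e) \<notin> K" "x \<notin> K"
        proof -
          have inK: "norm y \<le> R" if "y \<in> K" for y using R that by auto
          have "norm x \<le> norm (x + h n *\<^sub>R (- e)) + norm (h n *\<^sub>R e)"
            using norm_triangle_ineq[of "x + h n *\<^sub>R (- e)" "h n *\<^sub>R e"] by simp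
          moreover have "norm x > R + norm e" using False by simp
          ultimately have "\<not> norm (x + h n *\<^sub>R (- e)) \<le> R" "\<not> norm x \<le> R"
            using \<open>norm (h n *\<^sub>R e) \<le> norm e\<close> norm_ge_zero[of e] by linarith+
          then show "x + h n *\<^sub>R (- e) \<notin> K" "x \<notin> K" using inK by blast+
        qed
        then have "diff_quotient (- e) \<phi> n x = 0" unfolding diff_quotient_def h_def by (simp add: K(2))
        then show ?thesis by simp
      qed
    qed
  qed
  ultimately have "(LINT x|lebesgue. slope_limit e w x * \<phi> x) = (LINT x|lebesgue. w x * - frechet_derivative \<phi> (at x) e)"
    unfolding parts by (rule LIMSEQ_unique)
  then show "(LINT x|lebesgue. w x * frechet_derivative \<phi> (at x) e) = - (LINT x|lebesgue. slope_limit e w x * \<phi> x)" by simp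
qed

definition grad :: "('a::euclidean_space \<Rightarrow> real) \<Rightarrow> 'a \<Rightarrow> 'a" where
  "grad w x = (\<Sum>b\<in>Basis. slope_limit b w x *\<^sub>R b)"

lemma grad_inner: "b \<in> Basis \<Longrightarrow> grad w x \<bullet> b = slope_limit b w x"
  unfolding grad_def by simp

lemma grad_borel: "continuous_on UNIV w \<Longrightarrow> grad w \<in> borel_measurable borel"
  unfolding grad_def using slope_limit_borel by (intro borel_measurable_sum borel_measurable_scaleR) auto

lemma lipschitz_has_weak_gradient:
  assumes "open \<Omega>" "C-lipschitz_on UNIV w"
  shows "has_weak_gradient \<Omega> w (grad w)"
  unfolding has_weak_gradient_def using slope_limit_weak_partial[OF assms] by (simp add: grad_inner)

lemma norm_le_of_components:
  fixes y :: "'a::euclidean_space"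
  assumes "\<And>b. b \<in> Basis \<Longrightarrow> \<bar>y \<bullet> b\<bar> \<le> B" shows "norm y \<le> real DIM('a) * B"
proof -
  have "norm y \<le> (\<Sum>b\<in>Basis. \<bar>y \<bullet> b\<bar>)" by (rule norm_le_l1)
  also have "\<dots> \<le> (\<Sum>b\<in>(Basis::'a set). B)" using assms by (rule sum_mono)
  finally show ?thesis by simp
qed

lemma grad_bounded:
  fixes w :: "'a::euclidean_space \<Rightarrow> real"
  assumes "C-lipschitz_on UNIV w"
  shows "AE x in lebesgue. norm (grad w x) \<le> real DIM('a) * C"
proof -
  have "\<forall>b\<in>Basis. AE x in lebesgue. \<bar>slope_limit b w x\<bar> \<le> C * norm b" using slope_limit_bounded[OF assms] by blast
  then have "AE x in lebesgue. \<forall>b\<in>Basis. \<bar>slope_limit b w x\<bar> \<le> C * norm b"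
    by (subst AE_ball_countable) (auto intro: countable_finite)
  then show ?thesis by eventually_elim (rule norm_le_of_components, simp add: grad_inner)
qed

text \<open>McShane's extension by an infimum of cones.\<close>

lemma lipschitz_extension:
  fixes w :: "'a::metric_space \<Rightarrow> real"
  assumes "C-lipschitz_on S w" "S \<noteq> {}"
  obtains W where "C-lipschitz_on UNIV W" "\<And>x. x \<in> S \<Longrightarrow> W x = w x"
proof -
  have C: "C \<ge> 0" using assms(1) by (rule lipschitz_on_nonneg)
  obtain s0 where s0: "s0 \<in> S" using assms(2) by auto
  have w: "\<bar>w y - w z\<bar> \<le> C * dist y z" if "y \<in> S" "z \<in> S" for y z
    using lipschitz_onD[OF assms(1) that] by (simp add: dist_real_def)
  define W where "W x = (INF y\<in>S. w y + C * dist x y)" for x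
  have tri: "C * dist a b \<le> C * dist a c + C * dist c b" for a b c
    using mult_left_mono[OF dist_triangle C] by (simp add: distrib_left)
  have low: "w s0 - C * dist x s0 \<le> w y + C * dist x y" if "y \<in> S" for x y
    using w[OF s0 that] tri[of s0 y x] by (simp add: dist_commute)
  have bdd: "bdd_below ((\<lambda>y. w y + C * dist x y) ` S)" for x
    using low by (intro bdd_belowI2[where m = "w s0 - C * dist x s0"]) auto
  have le: "W x \<le> W z + C * dist x z" for x z
  proof -
    have "W x - C * dist x z \<le> W z"
      unfolding W_def
    proof (rule cINF_greatest[OF assms(2)])
      fix y assume y: "y \<in> S"
      have "(INF y\<in>S. w y + C * dist x y) \<le> w y + C * dist x y" by (rule cINF_lower[OF bdd y])
      then show "(INF y\<in>S. w y + C * dist x y) - C * dist x z \<le> w y + C * dist z y" using tri[of x y z] by linarith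
    qed
    then show ?thesis by simp
  qed
  have "C-lipschitz_on UNIV W"
  proof (rule lipschitz_onI[OF _ C])
    fix x z show "dist (W x) (W z) \<le> C * dist x z"
      using le[of x z] le[of z x] by (simp add: dist_real_def dist_commute abs_le_iff)
  qed
  moreover have "W x = w x" if "x \<in> S" for x
  proof (rule antisym)
    show "W x \<le> w x" unfolding W_def using cINF_lower[OF bdd that, of x] by simp
    show "w x \<le> W x"
      unfolding W_def
    proof (rule cINF_greatest[OF assms(2)])
      fix y assume "y \<in> S"
      then show "w x \<le> w y + C * dist x y" using w[OF that, of y] by linarith
    qed
  qed
  ultimately show ?thesis using that by blast
qed


section \<open>Calculus for almost everywhere gradients\<close>

lemma quotients_tendsto_grad:
  fixes w :: "'a::euclidean_space \<Rightarrow> real"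
  assumes "C-lipschitz_on UNIV w"
  shows "AE x in lebesgue. \<forall>b\<in>Basis. (\<lambda>n. diff_quotient b w n x) \<longlonglongrightarrow> grad w x \<bullet> b"
proof -
  have "\<forall>b\<in>Basis. AE x in lebesgue. (\<lambda>n. diff_quotient b w n x) \<longlonglongrightarrow> slope_limit b w x"
    using diff_quotient_tendsto[OF assms] by blast
  then have "AE x in lebesgue. \<forall>b\<in>Basis. (\<lambda>n. diff_quotient b w n x) \<longlonglongrightarrow> slope_limit b w x"
    by (subst AE_ball_countable) (auto intro: countable_finite)
  then show ?thesis by eventually_elim (simp add: grad_inner)
qed

lemma grad_eqI:
  fixes w :: "'a::euclidean_space \<Rightarrow> real"
  assumes "\<And>b. b \<in> Basis \<Longrightarrow> (\<lambda>n. diff_quotient b w n x) \<longlonglongrightarrow> p \<bullet> b"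
  shows "grad w x = p"
proof (rule euclidean_eqI)
  fix b :: 'a assume "b \<in> Basis"
  then show "grad w x \<bullet> b = p \<bullet> b"
    using limI[OF assms] by (simp add: grad_inner slope_limit_def)
qed

lemma grad_add:
  assumes "C-lipschitz_on UNIV v" "D-lipschitz_on UNIV w"
  shows "AE x in lebesgue. grad (\<lambda>x. v x + w x) x = grad v x + grad w x"
  using quotients_tendsto_grad[OF assms(1)] quotients_tendsto_grad[OF assms(2)]
proof eventually_elim
  fix x
  assume *: "\<forall>b\<in>Basis. (\<lambda>n. diff_quotient b v n x) \<longlonglongrightarrow> grad v x \<bullet> b"
    "\<forall>b\<in>Basis. (\<lambda>n. diff_quotient b w n x) \<longlonglongrightarrow> grad w x \<bullet> b"
  show "grad (\<lambda>x. v x + w x) x = grad v x + grad w x"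
  proof (rule grad_eqI)
    fix b :: 'a assume b: "b \<in> Basis"
    have "diff_quotient b (\<lambda>x. v x + w x) n x = diff_quotient b v n x + diff_quotient b w n x" for n
      unfolding diff_quotient_def by (simp add: algebra_simps)
    then show "(\<lambda>n. diff_quotient b (\<lambda>x. v x + w x) n x) \<longlonglongrightarrow> (grad v x + grad w x) \<bullet> b"
      unfolding inner_add_left using * b by (simp add: tendsto_add)
  qed
qed

lemma shrinking_steps: "(\<lambda>n. x + (1 / real (Suc n)) *\<^sub>R b) \<longlonglongrightarrow> (x :: 'a::real_normed_vector)"
proof -
  have "(\<lambda>n. x + (1 / real (Suc n)) *\<^sub>R b) \<longlonglongrightarrow> x + 0 *\<^sub>R b"
    by (intro tendsto_intros LIMSEQ_Suc[OF lim_1_over_n])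
  then show ?thesis by simp
qed

lemma grad_square:
  assumes k: "D-lipschitz_on UNIV k"
  shows "AE x in lebesgue. grad (\<lambda>x. c * (k x)\<^sup>2) x = (2 * c * k x) *\<^sub>R grad k x"
  using quotients_tendsto_grad[OF k]
proof eventually_elim
  fix x
  assume *: "\<forall>b\<in>Basis. (\<lambda>n. diff_quotient b k n x) \<longlonglongrightarrow> grad k x \<bullet> b"
  show "grad (\<lambda>x. c * (k x)\<^sup>2) x = (2 * c * k x) *\<^sub>R grad k x"
  proof (rule grad_eqI)
    fix b :: 'a assume b: "b \<in> Basis"
    have "isCont k x" using lipschitz_on_continuous_on[OF k] by (simp add: continuous_on_eq_continuous_at)
    then have "(\<lambda>n. k (x + (1 / real (Suc n)) *\<^sub>R b)) \<longlonglongrightarrow> k x"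
      using isCont_tendsto_compose shrinking_steps by blast
    then have "(\<lambda>n. (c * (k (x + (1 / real (Suc n)) *\<^sub>R b) + k x)) * diff_quotient b k n x)
        \<longlonglongrightarrow> (c * (k x + k x)) * (grad k x \<bullet> b)"
      using * b by (intro tendsto_intros) auto
    moreover have "(c * (k (x + (1 / real (Suc n)) *\<^sub>R b) + k x)) * diff_quotient b k n x
        = diff_quotient b (\<lambda>x. c * (k x)\<^sup>2) n x" for n
      unfolding diff_quotient_def by (simp add: algebra_simps power2_eq_square)
    ultimately show "(\<lambda>n. diff_quotient b (\<lambda>x. c * (k x)\<^sup>2) n x) \<longlonglongrightarrow> ((2 * c * k x) *\<^sub>R grad k x) \<bullet> b"
      by (simp add: algebra_simps)
  qed
qed

lemma grad_translate: "grad (\<lambda>x. w (x + \<tau>)) x = grad w (x + \<tau>)"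
  unfolding grad_def slope_limit_def diff_quotient_def by (simp add: algebra_simps)

lemma grad_affine: "grad (\<lambda>x. l \<bullet> x + c) x = l"
  by (rule grad_eqI) (simp add: diff_quotient_def inner_simps)

lemma grad_local_difference:
  fixes U W k :: "'a::euclidean_space \<Rightarrow> real"
  assumes S: "open S" and k: "\<And>x. x \<in> S \<Longrightarrow> k x = W x - U x - M"
    and U: "C-lipschitz_on UNIV U" and W: "D-lipschitz_on UNIV W"
  shows "AE x in lebesgue. x \<in> S \<longrightarrow> grad k x = grad W x - grad U x"
  using quotients_tendsto_grad[OF U] quotients_tendsto_grad[OF W]
proof (eventually_elim, intro impI)
  fix x
  assume *: "\<forall>b\<in>Basis. (\<lambda>n. diff_quotient b U n x) \<longlonglongrightarrow> grad U x \<bullet> b"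
    "\<forall>b\<in>Basis. (\<lambda>n. diff_quotient b W n x) \<longlonglongrightarrow> grad W x \<bullet> b" and x: "x \<in> S"
  show "grad k x = grad W x - grad U x"
  proof (rule grad_eqI)
    fix b :: 'a assume b: "b \<in> Basis"
    have "(\<lambda>n. diff_quotient b W n x - diff_quotient b U n x) \<longlonglongrightarrow> grad W x \<bullet> b - grad U x \<bullet> b"
      using * b by (intro tendsto_diff) auto
    moreover have "\<forall>\<^sub>F n in sequentially. x + (1 / real (Suc n)) *\<^sub>R b \<in> S"
      using topological_tendstoD[OF shrinking_steps S x] .
    then have "\<forall>\<^sub>F n in sequentially. diff_quotient b W n x - diff_quotient b U n x = diff_quotient b k n x"
      by eventually_elim (simp add: diff_quotient_def k x algebra_simps)
    ultimately show "(\<lambda>n. diff_quotient b k n x) \<longlonglongrightarrow> (grad W x - grad U x) \<bullet> b"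
      unfolding inner_diff_left by (rule Lim_transform_eventually)
  qed
qed

lemma lipschitz_square:
  fixes k :: "'a::metric_space \<Rightarrow> real"
  assumes k: "D-lipschitz_on UNIV k" and B: "\<And>x. \<bar>k x\<bar> \<le> B"
  shows "(\<bar>c\<bar> * (2 * B * D))-lipschitz_on UNIV (\<lambda>x. c * (k x)\<^sup>2)"
proof (rule lipschitz_onI)
  have B0: "0 \<le> B" using B[of undefined] by (meson abs_ge_zero order_trans)
  have D: "0 \<le> D" using k by (rule lipschitz_on_nonneg)
  fix x y
  have "dist (c * (k x)\<^sup>2) (c * (k y)\<^sup>2) = \<bar>c\<bar> * (\<bar>k x + k y\<bar> * \<bar>k x - k y\<bar>)"
    unfolding dist_real_def by (simp add: abs_mult[symmetric] power2_eq_square algebra_simps)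
  also have "\<dots> \<le> \<bar>c\<bar> * ((2 * B) * (D * dist x y))"
  proof (intro mult_left_mono mult_mono)
    show "\<bar>k x + k y\<bar> \<le> 2 * B" using B[of x] B[of y] by linarith
    show "\<bar>k x - k y\<bar> \<le> D * dist x y" using lipschitz_onD[OF k, of x y] by (simp add: dist_real_def)
  qed (use B0 in auto)
  finally show "dist (c * (k x)\<^sup>2) (c * (k y)\<^sup>2) \<le> \<bar>c\<bar> * (2 * B * D) * dist x y" by (simp add: mult.assoc)
  show "0 \<le> \<bar>c\<bar> * (2 * B * D)" using B0 D by simp
qed

lemma integrable_bounded_support:
  fixes g :: "'a::euclidean_space \<Rightarrow> real"
  assumes m: "g \<in> borel_measurable lebesgue" and b: "AE x in lebesgue. \<bar>g x\<bar> \<le> B"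
    and z: "AE x in lebesgue. x \<notin> cball 0 R \<longrightarrow> g x = 0"
  shows "integrable lebesgue g"
proof -
  have "integrable lebesgue (\<lambda>x::'a. indicator (cball 0 R) x * max B 0)"
    using lmeasurable_cball[of "0::'a" R] unfolding fmeasurable_def
    by (intro integrable_mult_left integrable_real_indicator) auto
  then show ?thesis
  proof (rule Bochner_Integration.integrable_bound[OF _ m])
    show "AE x in lebesgue. norm (g x) \<le> norm (indicator (cball 0 R) x * max B 0)"
      using b z by eventually_elim (auto simp: indicator_def)
  qed
qed

text \<open>The integral of each difference quotient vanishes by translation invariance.\<close>

lemma integral_grad_compact_support:
  fixes w :: "'a::euclidean_space \<Rightarrow> real"
  assumes w: "C-lipschitz_on UNIV w" and z: "\<And>x. x \<notin> cball 0 R \<Longrightarrow> w x = 0"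
  shows "integrable lebesgue (\<lambda>x. \<xi> \<bullet> grad w x)" and "(LINT x|lebesgue. \<xi> \<bullet> grad w x) = 0"
proof -
  have cw: "continuous_on UNIV w" using w by (rule lipschitz_on_continuous_on)
  have iw: "integrable lebesgue (\<lambda>x. w (x + c))" for c
  proof (rule integrable_continuous_compact_support)
    show "continuous_on UNIV (\<lambda>x. w (x + c))"
      by (intro continuous_on_compose2[OF cw] continuous_on_add continuous_on_id continuous_on_const) auto
    show "compact (cball (- c) R)" by simp
    show "w (x + c) = 0" if "x \<notin> cball (- c) R" for x
      using that by (intro z) (auto simp: dist_norm norm_minus_commute algebra_simps)
  qed
  have q0: "(LINT x|lebesgue. diff_quotient b w n x) = 0" for b n
    unfolding diff_quotient_def using iw[of 0] iw[of "(1 / real (Suc n)) *\<^sub>R b"]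
      LINT_translate[OF borel_measurable_continuous_onI[OF cw], of "(1 / real (Suc n)) *\<^sub>R b"] by simp
  have zq: "diff_quotient b w n x = 0" if "b \<in> Basis" "x \<notin> cball 0 (R + 1)" for b n x
  proof -
    have "norm ((1 / real (Suc n)) *\<^sub>R b) \<le> 1" using that by simp
    moreover have "norm x \<le> norm (x + (1 / real (Suc n)) *\<^sub>R b) + norm ((1 / real (Suc n)) *\<^sub>R b)"
      using norm_triangle_ineq4[of "x + (1 / real (Suc n)) *\<^sub>R b" "(1 / real (Suc n)) *\<^sub>R b"] by simp
    moreover have "norm x > R + 1" using that by simp
    ultimately have "norm (x + (1 / real (Suc n)) *\<^sub>R b) > R" "norm x > R" by linarith+
    then have "w (x + (1 / real (Suc n)) *\<^sub>R b) = 0" "w x = 0" by (auto intro!: z)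
    then show ?thesis unfolding diff_quotient_def by simp
  qed
  have comp: "integrable lebesgue (slope_limit b w) \<and> (LINT x|lebesgue. slope_limit b w x) = 0" if b: "b \<in> Basis" for b
  proof -
    have lim: "AE x in lebesgue. (\<lambda>n. diff_quotient b w n x) \<longlonglongrightarrow> slope_limit b w x"
      by (rule diff_quotient_tendsto[OF w])
    have dom: "integrable lebesgue (\<lambda>x::'a. indicator (cball 0 (R + 1)) x * C)"
      using lmeasurable_cball[of "0::'a" "R + 1"] unfolding fmeasurable_def
      by (intro integrable_mult_left integrable_real_indicator) auto
    have bd: "AE x in lebesgue. norm (diff_quotient b w n x) \<le> indicator (cball 0 (R + 1)) x * C" for n
    proof (rule AE_I2)
      fix x
      show "norm (diff_quotient b w n x) \<le> indicator (cball 0 (R + 1)) x * C"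
        using diff_quotient_bounded[OF w, of b n x] zq[OF b, of x n] b by (cases "x \<in> cball 0 (R + 1)") auto
    qed
    have ms: "slope_limit b w \<in> borel_measurable lebesgue"
      by (rule borel_imp_lebesgue[OF slope_limit_borel[OF cw]])
    have mq: "diff_quotient b w n \<in> borel_measurable lebesgue" for n
      by (rule borel_imp_lebesgue[OF diff_quotient_borel[OF cw]])
    have "(\<lambda>n. LINT x|lebesgue. diff_quotient b w n x) \<longlonglongrightarrow> (LINT x|lebesgue. slope_limit b w x)"
      by (rule integral_dominated_convergence[OF ms mq dom lim bd])
    then have "(LINT x|lebesgue. slope_limit b w x) = 0"
      unfolding q0 by (simp add: LIMSEQ_const_iff)
    moreover have "integrable lebesgue (slope_limit b w)"
      by (rule integrable_dominated_convergence[OF ms mq dom lim bd])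
    ultimately show ?thesis by blast
  qed
  have eq: "\<xi> \<bullet> grad w x = (\<Sum>b\<in>Basis. (\<xi> \<bullet> b) * slope_limit b w x)" for x
    unfolding grad_def by (simp add: inner_sum_right mult.commute)
  show "integrable lebesgue (\<lambda>x. \<xi> \<bullet> grad w x)"
    unfolding eq using comp by (intro Bochner_Integration.integrable_sum integrable_mult_right) auto
  have "(LINT x|lebesgue. \<xi> \<bullet> grad w x) = (\<Sum>b\<in>Basis. (\<xi> \<bullet> b) * (LINT x|lebesgue. slope_limit b w x))"
    unfolding eq using comp by (subst Bochner_Integration.integral_sum) auto
  then show "(LINT x|lebesgue. \<xi> \<bullet> grad w x) = 0" using comp by simp
qed


section \<open>The comparison principle\<close>

definition energy_change :: "(real \<Rightarrow> real) \<Rightarrow> ('a::euclidean_space \<Rightarrow> real) \<Rightarrow> ('a \<Rightarrow> real) \<Rightarrow> 'a \<Rightarrow> real" where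
  "energy_change f U w x = f (norm (grad U x + grad w x)) - f (norm (grad U x))"

lemma integrand_bounded:
  fixes G :: "'a::euclidean_space \<Rightarrow> 'a"
  assumes "regular_Lagrangean f" "AE x in lebesgue. norm (G x) \<le> R"
  shows "\<exists>B. AE x in lebesgue. \<bar>f (norm (G x))\<bar> \<le> B"
proof -
  have "compact ((\<lambda>p::'a. f (norm p)) ` cball 0 R)"
    by (intro compact_continuous_image continuous_on_subset[OF integrand_continuous[OF assms(1)]]) auto
  then obtain B where B: "\<And>p::'a. p \<in> cball 0 R \<Longrightarrow> norm (f (norm p)) \<le> B"
    by (metis (no_types, lifting) bounded_iff compact_imp_bounded imageI)
  have "AE x in lebesgue. \<bar>f (norm (G x))\<bar> \<le> B"
    using assms(2) by eventually_elim (use B in auto)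
  then show ?thesis by blast
qed

lemma integrand_borel:
  fixes G :: "'a::euclidean_space \<Rightarrow> 'b::euclidean_space"
  assumes "regular_Lagrangean f" "G \<in> borel_measurable M"
  shows "(\<lambda>x. f (norm (G x))) \<in> borel_measurable M"
  using measurable_compose[OF assms(2) borel_measurable_continuous_onI[OF integrand_continuous[OF assms(1)]]] .

lemma energy_change_borel:
  assumes "regular_Lagrangean f" "continuous_on UNIV U" "continuous_on UNIV w"
  shows "energy_change f U w \<in> borel_measurable borel"
  unfolding energy_change_def
  by (intro borel_measurable_diff integrand_borel assms borel_measurable_add grad_borel)

lemma energy_change_bounded:
  fixes U :: "'a::euclidean_space \<Rightarrow> real"
  assumes f: "regular_Lagrangean f" and U: "C-lipschitz_on UNIV U" and w: "D-lipschitz_on UNIV w"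
  shows "\<exists>B. AE x in lebesgue. \<bar>energy_change f U w x\<bar> \<le> B"
proof -
  have "AE x in lebesgue. norm (grad U x + grad w x) \<le> real DIM('a) * C + real DIM('a) * D"
    using grad_bounded[OF U] grad_bounded[OF w] by eventually_elim (rule norm_triangle_mono)
  then obtain B1 where B1: "AE x in lebesgue. \<bar>f (norm (grad U x + grad w x))\<bar> \<le> B1"
    using integrand_bounded[OF f, of "\<lambda>x. grad U x + grad w x"] by blast
  obtain B2 where B2: "AE x in lebesgue. \<bar>f (norm (grad U x))\<bar> \<le> B2"
    using integrand_bounded[OF f grad_bounded[OF U]] by blast
  have "AE x in lebesgue. \<bar>energy_change f U w x\<bar> \<le> B1 + B2"
    using B1 B2 by eventually_elim (simp add: energy_change_def)
  then show ?thesis by blast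
qed

lemma energy_change_integrable:
  fixes U :: "'a::euclidean_space \<Rightarrow> real"
  assumes f: "regular_Lagrangean f" and U: "C-lipschitz_on UNIV U" and w: "D-lipschitz_on UNIV w"
    and off: "AE x in lebesgue. x \<notin> cball 0 R \<longrightarrow> grad w x = 0"
  shows "integrable lebesgue (energy_change f U w)"
proof -
  obtain B where B: "AE x in lebesgue. \<bar>energy_change f U w x\<bar> \<le> B"
    using energy_change_bounded[OF f U w] by blast
  show ?thesis
  proof (rule integrable_bounded_support[OF _ B])
    show "energy_change f U w \<in> borel_measurable lebesgue"
      by (intro borel_imp_lebesgue energy_change_borel f lipschitz_on_continuous_on[OF U] lipschitz_on_continuous_on[OF w])
    show "AE x in lebesgue. x \<notin> cball 0 R \<longrightarrow> energy_change f U w x = 0"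
      using off by eventually_elim (simp add: energy_change_def)
  qed
qed

text \<open>Where \<open>k > 0\<close>, the perturbations move the gradients of \<open>U\<close> and \<open>W\<close> towards each other by
  equal amounts, and strict convexity makes the sum of the two energy changes negative unless the
  gradients agree.  Using \<open>k\<^sup>2\<close> instead of \<open>k\<close> as the perturbation keeps its gradient
  \<open>2 k \<nabla>k\<close> under control on the set where \<open>k = 0\<close>, without any fine property of that set.\<close>

lemma comparison_core:
  fixes U W k :: "'a::euclidean_space \<Rightarrow> real"
  assumes f: "regular_Lagrangean f" and f0: "half_deriv f 0 = 0"
    and U: "C-lipschitz_on UNIV U" and W: "D-lipschitz_on UNIV W" and k: "E-lipschitz_on UNIV k"
    and k0: "\<And>x. 0 \<le> k x" and supp: "\<And>x. x \<notin> cball 0 R \<Longrightarrow> k x = 0"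
    and kS: "\<And>x. 0 < k x \<Longrightarrow> k x = W x - U x - M"
    and \<epsilon>: "\<epsilon> > 0" "\<And>x. 2 * \<epsilon> * k x < 1"
    and var1: "0 \<le> (LINT x|lebesgue. energy_change f U (\<lambda>x. \<epsilon> * (k x)\<^sup>2) x)"
    and var2: "0 \<le> (LINT x|lebesgue. energy_change f W (\<lambda>x. - \<epsilon> * (k x)\<^sup>2) x)"
  shows "k x = 0"
proof -
  have ck: "continuous_on UNIV k" "continuous_on UNIV U" "continuous_on UNIV W"
    using k U W by (auto intro: lipschitz_on_continuous_on)
  define B where "B = 1 / (2 * \<epsilon>)"
  have B: "\<bar>k x\<bar> \<le> B" for x using k0[of x] \<epsilon>(2)[of x] \<epsilon>(1) unfolding B_def by (simp add: field_simps)
  have sq: "(\<bar>c\<bar> * (2 * B * E))-lipschitz_on UNIV (\<lambda>x. c * (k x)\<^sup>2)" for c by (rule lipschitz_square[OF k B])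
  define S where "S = {x. 0 < k x}"
  have "open S" unfolding S_def using ck(1) by (intro open_Collect_less continuous_on_const) auto
  have gk: "AE x in lebesgue. x \<in> S \<longrightarrow> grad k x = grad W x - grad U x"
    by (rule grad_local_difference[OF \<open>open S\<close> _ U W, where M = M]) (unfold S_def mem_Collect_eq, rule kS)
  \<comment> \<open>both perturbed gradients are convex combinations of \<open>\<nabla>U\<close> and \<open>\<nabla>W\<close> with weight \<open>2 \<epsilon> k\<close>, so the total change has a sign\<close>
  define A where "A x = energy_change f U (\<lambda>x. \<epsilon> * (k x)\<^sup>2) x + energy_change f W (\<lambda>x. - \<epsilon> * (k x)\<^sup>2) x" for x
  have g1: "AE x in lebesgue. grad (\<lambda>x. \<epsilon> * (k x)\<^sup>2) x = (2 * \<epsilon> * k x) *\<^sub>R grad k x"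
    and g2: "AE x in lebesgue. grad (\<lambda>x. - \<epsilon> * (k x)\<^sup>2) x = (2 * - \<epsilon> * k x) *\<^sub>R grad k x"
    by (rule grad_square[OF k])+
  have off: "AE x in lebesgue. x \<notin> cball 0 R \<longrightarrow> grad (\<lambda>x. c * (k x)\<^sup>2) x = 0" for c
    using grad_square[OF k, of c] by eventually_elim (simp add: supp)
  have int: "integrable lebesgue (energy_change f U (\<lambda>x. \<epsilon> * (k x)\<^sup>2))"
    "integrable lebesgue (energy_change f W (\<lambda>x. - \<epsilon> * (k x)\<^sup>2))"
    by (rule energy_change_integrable[OF f U sq off], rule energy_change_integrable[OF f W sq off])
  have sign: "AE x in lebesgue. A x \<le> 0 \<and> (A x = 0 \<longrightarrow> k x = 0 \<or> grad k x = 0)"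
    using g1 g2 gk
  proof eventually_elim
    fix x
    assume g: "grad (\<lambda>x. \<epsilon> * (k x)\<^sup>2) x = (2 * \<epsilon> * k x) *\<^sub>R grad k x"
      "grad (\<lambda>x. - \<epsilon> * (k x)\<^sup>2) x = (2 * - \<epsilon> * k x) *\<^sub>R grad k x"
      and S: "x \<in> S \<longrightarrow> grad k x = grad W x - grad U x"
    show "A x \<le> 0 \<and> (A x = 0 \<longrightarrow> k x = 0 \<or> grad k x = 0)"
    proof (cases "k x = 0 \<or> grad k x = 0")
      case True
      then have "A x = 0" unfolding A_def energy_change_def g by auto
      then show ?thesis using True by simp
    next
      case False
      define s where "s = 2 * \<epsilon> * k x"
      have s: "0 < s" "s < 1" using False k0[of x] \<epsilon> unfolding s_def by auto
      have "x \<in> S" using False k0[of x] unfolding S_def by simp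
      then have gk: "grad k x = grad W x - grad U x" using S by blast
      then have ne: "grad U x \<noteq> grad W x" using False by auto
      have 1: "grad U x + grad (\<lambda>x. \<epsilon> * (k x)\<^sup>2) x = (1 - s) *\<^sub>R grad U x + s *\<^sub>R grad W x"
        unfolding g gk s_def[symmetric] by (simp add: algebra_simps)
      have 2: "grad W x + grad (\<lambda>x. - \<epsilon> * (k x)\<^sup>2) x = (1 - s) *\<^sub>R grad W x + s *\<^sub>R grad U x"
        unfolding g gk s_def by (simp add: algebra_simps)
      have "A x < 0"
        using integrand_strict_convex[OF f f0 ne s] integrand_strict_convex[OF f f0 ne[symmetric] s]
        unfolding A_def energy_change_def 1 2 by (simp add: algebra_simps)
      then show ?thesis by simp
    qed
  qed
  have intA: "integrable lebesgue A" unfolding A_def using int by (intro Bochner_Integration.integrable_add)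
  have "(LINT x|lebesgue. A x) \<ge> 0" unfolding A_def using int var1 var2 by simp
  then have "(LINT x|lebesgue. - A x) \<le> 0" by simp
  moreover have nn: "AE x in lebesgue. 0 \<le> - A x" using sign by eventually_elim simp
  then have "0 \<le> (LINT x|lebesgue. - A x)" by (rule integral_nonneg_AE)
  ultimately have "(LINT x|lebesgue. - A x) = 0" by simp
  then have "AE x in lebesgue. - A x = 0"
    using integral_nonneg_eq_0_iff_AE[OF _ nn] intA by simp
  \<comment> \<open>hence \<open>k\<^sup>2\<close> is constant, and it vanishes far away\<close>
  then have zero: "AE x in lebesgue. grad (\<lambda>x. 1 * (k x)\<^sup>2) x = 0"
    using sign grad_square[OF k, of 1] by eventually_elim auto
  have k2: "1 * (k (x + e))\<^sup>2 - 1 * (k x)\<^sup>2 \<le> 0" for x e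
  proof (rule weak_gradient_mean_value[OF open_UNIV lipschitz_on_continuous_on[OF sq]])
    show "has_weak_gradient UNIV (\<lambda>x. 1 * (k x)\<^sup>2) (grad (\<lambda>x. 1 * (k x)\<^sup>2))"
      by (rule lipschitz_has_weak_gradient[OF open_UNIV sq])
    show "AE x in lebesgue_on UNIV. grad (\<lambda>x. 1 * (k x)\<^sup>2) x \<bullet> e \<le> 0"
      using zero unfolding lebesgue_on_UNIV_eq by eventually_elim simp
  qed simp
  obtain y :: 'a where "y \<notin> cball 0 R"
    using vector_choose_size[of "\<bar>R\<bar> + 1"] by (metis abs_ge_self add.commute add_increasing abs_ge_zero dist_0_norm less_add_one linorder_not_le mem_cball order_le_less_trans zero_le_one)
  then have "(k x)\<^sup>2 \<le> 0" using k2[of y "x - y"] supp[of y] by simp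
  then show ?thesis by simp
qed

lemma inner_affine_lipschitz: "(norm l)-lipschitz_on UNIV (\<lambda>x::'a::real_inner. l \<bullet> x + c)"
proof (rule lipschitz_onI)
  fix x y show "dist (l \<bullet> x + c) (l \<bullet> y + c) \<le> norm l * dist x y"
    using Cauchy_Schwarz_ineq2[of l "x - y"] by (simp add: dist_norm inner_diff_right)
qed simp

text \<open>An affine function is its own minimizer: Jensen's inequality, in the form that a subgradient
  of the integrand at the constant gradient, paired with the gradient of a compactly supported
  perturbation, integrates to zero.\<close>

lemma affine_energy_change_nonneg:
  fixes l :: "'a::euclidean_space"
  assumes f: "regular_Lagrangean f" and f0: "half_deriv f 0 = 0"
    and w: "D-lipschitz_on UNIV w" and supp: "\<And>x. x \<notin> cball 0 R \<Longrightarrow> w x = 0"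
    and ae: "AE x in lebesgue. x \<notin> cball 0 R \<longrightarrow> grad w x = 0"
  shows "0 \<le> (LINT x|lebesgue. energy_change f (\<lambda>x. l \<bullet> x + c) w x)"
proof -
  obtain \<xi> where \<xi>: "\<And>q. f (norm l) + \<xi> \<bullet> q \<le> f (norm (l + q))" using integrand_subgradient[OF f f0] by blast
  note L = inner_affine_lipschitz[of l c]
  have "integrable lebesgue (energy_change f (\<lambda>x. l \<bullet> x + c) w)"
    by (rule energy_change_integrable[OF f L w ae])
  then have "(LINT x|lebesgue. \<xi> \<bullet> grad w x) \<le> (LINT x|lebesgue. energy_change f (\<lambda>x. l \<bullet> x + c) w x)"
  proof (intro integral_mono_AE integral_grad_compact_support[OF w supp] AE_I2)
    show "\<xi> \<bullet> grad w x \<le> energy_change f (\<lambda>x. l \<bullet> x + c) w x" for x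
      using \<xi>[of "grad w x"] unfolding energy_change_def grad_affine by simp
  qed auto
  then show ?thesis using integral_grad_compact_support(2)[OF w supp] by simp
qed

lemma LINT_on_eq_indicator:
  fixes g :: "'a::euclidean_space \<Rightarrow> real"
  assumes "open \<Omega>"
  shows "(LINT x|lebesgue_on \<Omega>. g x) = (LINT x|lebesgue. indicator \<Omega> x * g x)"
  using assms by (subst integral_restrict_space) (auto simp: borel_open)

lemma has_weak_gradient_cong:
  fixes v w :: "'a::euclidean_space \<Rightarrow> real"
  assumes G: "has_weak_gradient \<Omega> w G" and eq: "\<And>x. x \<in> \<Omega> \<Longrightarrow> w x = v x"
  shows "has_weak_gradient \<Omega> v G"
  unfolding has_weak_gradient_def
proof
  fix b :: 'a assume "b \<in> Basis"
  then have w: "has_weak_partial \<Omega> b w (\<lambda>x. G x \<bullet> b)" using G unfolding has_weak_gradient_def by blast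
  have "v absolutely_integrable_on K \<longleftrightarrow> w absolutely_integrable_on K" if "K \<subseteq> \<Omega>" for K
    unfolding set_integrable_def
    by (rule Bochner_Integration.integrable_cong) (use that eq in \<open>auto simp: indicator_def\<close>)
  then have "locally_integrable_on \<Omega> v"
    using w unfolding has_weak_partial_def locally_integrable_on_def by simp
  moreover have "(LINT x|lebesgue_on \<Omega>. v x * frechet_derivative \<phi> (at x) b)
      = (LINT x|lebesgue_on \<Omega>. w x * frechet_derivative \<phi> (at x) b)" for \<phi>
    by (rule Bochner_Integration.integral_cong) (use eq in auto)
  ultimately show "has_weak_partial \<Omega> b v (\<lambda>x. G x \<bullet> b)"
    using w unfolding has_weak_partial_def by simp
qed

lemma LINT_on_cong_AE:
  fixes g h :: "'a::euclidean_space \<Rightarrow> real"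
  assumes op: "open \<Omega>" and h: "h \<in> borel_measurable lebesgue" and eq: "AE x in lebesgue_on \<Omega>. g x = h x"
  shows "(LINT x|lebesgue_on \<Omega>. g x) = (LINT x|lebesgue_on \<Omega>. h x)"
  unfolding LINT_on_eq_indicator[OF op]
proof (rule integral_cong_AE)
  have ind: "(indicator \<Omega> :: 'a \<Rightarrow> real) \<in> borel_measurable lebesgue"
    using op by (intro borel_measurable_indicator) (auto simp: borel_open)
  show m: "(\<lambda>x. indicator \<Omega> x * h x) \<in> borel_measurable lebesgue" by (intro borel_measurable_times ind h)
  have "AE x in lebesgue. x \<in> \<Omega> \<longrightarrow> g x = h x"
    using eq op by (simp add: AE_restrict_space_iff borel_open)
  then show ae: "AE x in lebesgue. indicator \<Omega> x * g x = indicator \<Omega> x * h x"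
    by eventually_elim (auto simp: indicator_def)
  show "(\<lambda>x. indicator \<Omega> x * g x) \<in> borel_measurable lebesgue"
  proof (rule borel_measurable_AE[OF m])
    show "AE x in lebesgue. indicator \<Omega> x * h x = indicator \<Omega> x * g x"
      using ae by eventually_elim (rule sym)
  qed
qed

lemma weak_gradient_extension:
  assumes op: "open \<Omega>" and U: "C-lipschitz_on UNIV U" and eq: "\<And>x. x \<in> \<Omega> \<Longrightarrow> U x = u x"
  shows "has_weak_gradient \<Omega> u (weak_gradient \<Omega> u)"
    and "AE x in lebesgue_on \<Omega>. weak_gradient \<Omega> u x = grad U x"
proof -
  have G: "has_weak_gradient \<Omega> u (grad U)"
    by (rule has_weak_gradient_cong[OF lipschitz_has_weak_gradient[OF op U] eq])
  show "has_weak_gradient \<Omega> u (weak_gradient \<Omega> u)" by (rule weak_gradient_AE_eq(1)[OF op G])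
  show "AE x in lebesgue_on \<Omega>. weak_gradient \<Omega> u x = grad U x" by (rule weak_gradient_AE_eq(2)[OF op G])
qed

lemma energy_eq:
  assumes op: "open \<Omega>" and f: "regular_Lagrangean f" and U: "C-lipschitz_on UNIV U"
    and eq: "\<And>x. x \<in> \<Omega> \<Longrightarrow> U x = u x"
  shows "energy \<Omega> f u = (LINT x|lebesgue_on \<Omega>. f (norm (grad U x)))"
  unfolding energy_def
proof (rule LINT_on_cong_AE[OF op])
  show "(\<lambda>x. f (norm (grad U x))) \<in> borel_measurable lebesgue"
    by (intro integrand_borel f borel_imp_lebesgue grad_borel lipschitz_on_continuous_on[OF U])
  have "AE x in lebesgue_on \<Omega>. weak_gradient \<Omega> u x = grad U x" by (rule weak_gradient_extension(2)[OF op U eq])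
  then show "AE x in lebesgue_on \<Omega>. f (norm (weak_gradient \<Omega> u x)) = f (norm (grad U x))"
    by eventually_elim simp
qed

text \<open>Minimality over \<open>\<Omega>\<close> turns into a statement about integrals over the whole space,
  which can be translated freely.\<close>

lemma minimizer_energy_change_nonneg:
  fixes \<Omega> :: "'a::euclidean_space set"
  assumes op: "open \<Omega>" and bdd: "bounded \<Omega>" and f: "regular_Lagrangean f"
    and min: "is_minimizer \<Omega> \<psi> f u"
    and U: "C-lipschitz_on UNIV U" and eq: "\<And>x. x \<in> closure \<Omega> \<Longrightarrow> U x = u x"
    and k: "D-lipschitz_on UNIV k" and B: "\<And>x. \<bar>k x\<bar> \<le> B" and off: "\<And>x. x \<notin> \<Omega> \<Longrightarrow> k x = 0"
  shows "0 \<le> (LINT x|lebesgue. energy_change f U (\<lambda>x. c * (k x)\<^sup>2) x)"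
proof -
  define w where "w x = c * (k x)\<^sup>2" for x
  have w: "(\<bar>c\<bar> * (2 * B * D))-lipschitz_on UNIV w" unfolding w_def by (rule lipschitz_square[OF k B])
  have gw: "AE x in lebesgue. x \<notin> \<Omega> \<longrightarrow> grad w x = 0"
    unfolding w_def using grad_square[OF k, of c] by eventually_elim (simp add: off)
  define V where "V x = U x + w x" for x
  have V: "(C + \<bar>c\<bar> * (2 * B * D))-lipschitz_on UNIV V" unfolding V_def by (rule lipschitz_on_add[OF U w])
  have gV: "AE x in lebesgue. grad V x = grad U x + grad w x" unfolding V_def by (rule grad_add[OF U w])
  have sub: "\<Omega> \<subseteq> closure \<Omega>" by (rule closure_subset)
  have fr: "frontier \<Omega> = closure \<Omega> - \<Omega>" using op by (simp add: frontier_def interior_open)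
  have "V \<in> competitors \<Omega> \<psi>"
  proof -
    have "V \<in> Lip (closure \<Omega>)" unfolding Lip_def using lipschitz_on_subset[OF V] by blast
    moreover have "V x = \<psi> x" if "x \<in> frontier \<Omega>" for x
      using that min eq[of x] off[of x] unfolding is_minimizer_def competitors_def fr V_def w_def by auto
    ultimately show ?thesis unfolding competitors_def by blast
  qed
  then have "energy \<Omega> f u \<le> energy \<Omega> f V" using min unfolding is_minimizer_def by blast
  also have "energy \<Omega> f u = (LINT x|lebesgue. indicator \<Omega> x * f (norm (grad U x)))"
    unfolding LINT_on_eq_indicator[OF op, symmetric] using eq sub by (intro energy_eq[OF op f U]) auto
  also have "energy \<Omega> f V = (LINT x|lebesgue. indicator \<Omega> x * f (norm (grad V x)))"
    unfolding LINT_on_eq_indicator[OF op, symmetric] by (intro energy_eq[OF op f V]) auto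
  finally have le: "(LINT x|lebesgue. indicator \<Omega> x * f (norm (grad U x)))
      \<le> (LINT x|lebesgue. indicator \<Omega> x * f (norm (grad V x)))" .
  obtain R where R: "\<Omega> \<subseteq> cball 0 R" using bdd by (metis bounded_iff mem_cball_0 subsetI)
  have ind: "(indicator \<Omega> :: 'a \<Rightarrow> real) \<in> borel_measurable lebesgue"
    using op by (intro borel_measurable_indicator) (auto simp: borel_open)
  have int: "integrable lebesgue (\<lambda>x. indicator \<Omega> x * f (norm (grad W x)))" if W: "E-lipschitz_on UNIV W" for W :: "'a \<Rightarrow> real" and E
  proof -
    obtain A where A: "AE x in lebesgue. \<bar>f (norm (grad W x))\<bar> \<le> A"
      using integrand_bounded[OF f grad_bounded[OF W]] by blast
    show ?thesis
    proof (rule integrable_bounded_support[where B = "max A 0" and R = R])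
      show "(\<lambda>x. indicator \<Omega> x * f (norm (grad W x))) \<in> borel_measurable lebesgue"
        by (intro borel_measurable_times ind integrand_borel f borel_imp_lebesgue grad_borel lipschitz_on_continuous_on[OF W])
      show "AE x in lebesgue. \<bar>indicator \<Omega> x * f (norm (grad W x))\<bar> \<le> max A 0"
        using A by eventually_elim (auto simp: indicator_def)
      show "AE x in lebesgue. x \<notin> cball 0 R \<longrightarrow> indicator \<Omega> x * f (norm (grad W x)) = 0"
        using R by (intro AE_I2) (auto simp: indicator_def)
    qed
  qed
  have "(LINT x|lebesgue. energy_change f U w x)
      = (LINT x|lebesgue. indicator \<Omega> x * f (norm (grad V x)) - indicator \<Omega> x * f (norm (grad U x)))"
  proof (rule integral_cong_AE)
    show "energy_change f U w \<in> borel_measurable lebesgue"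
      by (intro borel_imp_lebesgue energy_change_borel f lipschitz_on_continuous_on[OF U] lipschitz_on_continuous_on[OF w])
    show "(\<lambda>x. indicator \<Omega> x * f (norm (grad V x)) - indicator \<Omega> x * f (norm (grad U x))) \<in> borel_measurable lebesgue"
      using int[OF V] int[OF U] by (intro borel_measurable_diff borel_measurable_integrable)
    show "AE x in lebesgue. energy_change f U w x
        = indicator \<Omega> x * f (norm (grad V x)) - indicator \<Omega> x * f (norm (grad U x))"
      using gV gw by eventually_elim (auto simp: energy_change_def indicator_def)
  qed
  also have "\<dots> = (LINT x|lebesgue. indicator \<Omega> x * f (norm (grad V x))) - (LINT x|lebesgue. indicator \<Omega> x * f (norm (grad U x)))"
    by (rule Bochner_Integration.integral_diff[OF int[OF V] int[OF U]])
  finally show ?thesis using le unfolding w_def by simp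
qed

definition cutoff :: "'a set \<Rightarrow> ('a \<Rightarrow> real) \<Rightarrow> 'a \<Rightarrow> real" where
  "cutoff S h x = (if x \<in> S then max 0 (h x) else 0)"

lemma cutoff_lipschitz:
  fixes S :: "'a::euclidean_space set"
  assumes S: "open S" and h: "C-lipschitz_on UNIV h" and fr: "\<And>x. x \<in> frontier S \<Longrightarrow> h x \<le> 0"
  shows "C-lipschitz_on UNIV (cutoff S h)"
proof -
  have C: "C \<ge> 0" using h by (rule lipschitz_on_nonneg)
  have h': "\<bar>h x - h y\<bar> \<le> C * dist x y" for x y
    using lipschitz_onD[OF h, of x y] by (simp add: dist_real_def)
  have mixed: "\<bar>cutoff S h x - cutoff S h y\<bar> \<le> C * dist x y" if "x \<in> S" "y \<notin> S" for x y
  proof -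
    have "closed_segment x y \<inter> S \<noteq> {}" "closed_segment x y - S \<noteq> {}" using that by auto
    then obtain z where z: "z \<in> closed_segment x y" "z \<in> frontier S"
      using connected_Int_frontier[OF connected_segment] by blast
    then have "dist x z \<le> dist x y" by (metis dist_commute dist_in_closed_segment)
    then have "C * dist x z \<le> C * dist x y" using C by (rule mult_left_mono)
    then show ?thesis using that fr[OF z(2)] h'[of x z] unfolding cutoff_def by auto
  qed
  show ?thesis
  proof (rule lipschitz_onI[OF _ C])
    fix x y
    show "dist (cutoff S h x) (cutoff S h y) \<le> C * dist x y"
      using mixed[of x y] mixed[of y x] h'[of x y] C
      unfolding dist_real_def
      by (cases "x \<in> S"; cases "y \<in> S") (auto simp: cutoff_def dist_commute abs_minus_commute max_def)
  qed
qed

lemma cutoff_bounded: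
  fixes S :: "'a::euclidean_space set"
  assumes "bounded S" and h: "C-lipschitz_on UNIV h"
  shows "\<exists>B>0. \<forall>x. \<bar>cutoff S h x\<bar> \<le> B"
proof -
  have "compact (closure S)" using assms(1) by simp
  then have "compact (h ` closure S)"
    by (intro compact_continuous_image lipschitz_on_continuous_on[OF lipschitz_on_subset[OF h]]) auto
  then obtain B where "\<And>x. x \<in> closure S \<Longrightarrow> norm (h x) \<le> B" by (metis bounded_iff compact_imp_bounded imageI)
  then have B: "\<bar>h x\<bar> \<le> B" if "x \<in> S" for x using that closure_subset[of S] by auto
  have "\<bar>cutoff S h x\<bar> \<le> max B 1" for x
    using B[of x] unfolding cutoff_def by (auto simp: max_def)
  then show ?thesis by (intro exI[of _ "max B 1"]) auto
qed

lemma cutoff_props: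
  "0 \<le> cutoff S h x" "x \<notin> S \<Longrightarrow> cutoff S h x = 0" "0 < cutoff S h x \<Longrightarrow> cutoff S h x = h x"
  "0 < cutoff S h x \<Longrightarrow> x \<in> S" "x \<in> S \<Longrightarrow> cutoff S h x = 0 \<Longrightarrow> h x \<le> 0"
  by (auto simp: cutoff_def max_def split: if_splits)

lemma lipschitz_translate:
  fixes w :: "'a::real_normed_vector \<Rightarrow> 'b::metric_space"
  assumes "C-lipschitz_on UNIV w" shows "C-lipschitz_on UNIV (\<lambda>x. w (x + \<tau>))"
proof (rule lipschitz_onI[OF _ lipschitz_on_nonneg[OF assms]])
  show "dist (w (x + \<tau>)) (w (y + \<tau>)) \<le> C * dist x y" for x y
    using lipschitz_onD[OF assms, of "x + \<tau>" "y + \<tau>"] by simp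
qed

text \<open>Minimality with respect to perturbations by multiples of squares supported in a set.  Unlike
  minimality with given boundary values it restricts to smaller sets and applies verbatim to
  translates.\<close>

definition minimal_on :: "(real \<Rightarrow> real) \<Rightarrow> 'a::euclidean_space set \<Rightarrow> ('a \<Rightarrow> real) \<Rightarrow> bool" where
  "minimal_on f S U \<longleftrightarrow>
     (\<forall>c k D B. D-lipschitz_on UNIV k \<and> (\<forall>x. \<bar>k x\<bar> \<le> B) \<and> (\<forall>x. x \<notin> S \<longrightarrow> k x = 0) \<longrightarrow>
        0 \<le> (LINT x|lebesgue. energy_change f U (\<lambda>x. c * (k x)\<^sup>2) x))"

lemma minimal_onD:
  assumes "minimal_on f S U" "D-lipschitz_on UNIV k" "\<And>x. \<bar>k x\<bar> \<le> B" "\<And>x. x \<notin> S \<Longrightarrow> k x = 0"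
  shows "0 \<le> (LINT x|lebesgue. energy_change f U (\<lambda>x. c * (k x)\<^sup>2) x)"
  using assms unfolding minimal_on_def by blast

lemma minimal_on_subset: "minimal_on f S U \<Longrightarrow> T \<subseteq> S \<Longrightarrow> minimal_on f T U"
  unfolding minimal_on_def by blast

lemma minimizer_minimal_on:
  assumes "open \<Omega>" "bounded \<Omega>" "regular_Lagrangean f" "is_minimizer \<Omega> \<psi> f u"
    and "C-lipschitz_on UNIV U" "\<And>x. x \<in> closure \<Omega> \<Longrightarrow> U x = u x"
  shows "minimal_on f \<Omega> U"
  unfolding minimal_on_def
  by (intro allI impI, elim conjE) (rule minimizer_energy_change_nonneg[OF assms], auto)

lemma affine_minimal_on:
  fixes S :: "'a::euclidean_space set"
  assumes "bounded S" and f: "regular_Lagrangean f" "half_deriv f 0 = 0"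
  shows "minimal_on f S (\<lambda>x. l \<bullet> x + c)"
  unfolding minimal_on_def
proof (intro allI impI, elim conjE)
  fix a D B :: real and k :: "'a \<Rightarrow> real"
  assume k: "D-lipschitz_on UNIV k" and B: "\<forall>x. \<bar>k x\<bar> \<le> B" and off: "\<forall>x. x \<notin> S \<longrightarrow> k x = 0"
  obtain R where "S \<subseteq> cball 0 R" using assms(1) by (metis bounded_iff mem_cball_0 subsetI)
  then have koff: "k x = 0" if "x \<notin> cball 0 R" for x using that off by blast
  show "0 \<le> (LINT x|lebesgue. energy_change f (\<lambda>x. l \<bullet> x + c) (\<lambda>x. a * (k x)\<^sup>2) x)"
  proof (rule affine_energy_change_nonneg[OF f lipschitz_square[OF k, of B]])
    show "a * (k x)\<^sup>2 = 0" if "x \<notin> cball 0 R" for x using koff[OF that] by simp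
    show "AE x in lebesgue. x \<notin> cball 0 R \<longrightarrow> grad (\<lambda>x. a * (k x)\<^sup>2) x = 0"
      using grad_square[OF k, of a] by eventually_elim (simp add: koff)
  qed (use B in auto)
qed

lemma minimal_on_translate:
  fixes U :: "'a::euclidean_space \<Rightarrow> real"
  assumes f: "regular_Lagrangean f" and U: "C-lipschitz_on UNIV U" and min: "minimal_on f S U"
  shows "minimal_on f ((\<lambda>x. x + \<tau>) -` S) (\<lambda>x. U (x + \<tau>))"
  unfolding minimal_on_def
proof (intro allI impI, elim conjE)
  fix c D B :: real and k :: "'a \<Rightarrow> real"
  assume k: "D-lipschitz_on UNIV k" and B: "\<forall>x. \<bar>k x\<bar> \<le> B" and off: "\<forall>x. x \<notin> (\<lambda>x. x + \<tau>) -` S \<longrightarrow> k x = 0"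
  define k' where "k' x = k (x + - \<tau>)" for x
  have k': "D-lipschitz_on UNIV k'" unfolding k'_def by (rule lipschitz_translate[OF k])
  have "0 \<le> (LINT x|lebesgue. energy_change f U (\<lambda>x. c * (k' x)\<^sup>2) x)"
    by (rule minimal_onD[OF min k', of B]) (use B off in \<open>auto simp: k'_def\<close>)
  also have "\<dots> = (LINT x|lebesgue. energy_change f U (\<lambda>x. c * (k' x)\<^sup>2) (x + \<tau>))"
    by (rule LINT_translate[symmetric])
       (intro energy_change_borel f lipschitz_on_continuous_on[OF U] continuous_on_mult continuous_on_power
         continuous_on_const lipschitz_on_continuous_on[OF k'])
  also have "(\<lambda>x. energy_change f U (\<lambda>x. c * (k' x)\<^sup>2) (x + \<tau>)) = energy_change f (\<lambda>x. U (x + \<tau>)) (\<lambda>x. c * (k x)\<^sup>2)"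
    unfolding energy_change_def grad_translate[symmetric] k'_def by simp
  finally show "0 \<le> (LINT x|lebesgue. energy_change f (\<lambda>x. U (x + \<tau>)) (\<lambda>x. c * (k x)\<^sup>2) x)" .
qed

text \<open>The admissible perturbation is the square of the truncated excess of \<open>W - U\<close> over \<open>M\<close>.\<close>

lemma comparison_principle:
  fixes S :: "'a::euclidean_space set"
  assumes f: "regular_Lagrangean f" "half_deriv f 0 = 0" and S: "open S" "bounded S"
    and U: "C-lipschitz_on UNIV U" "minimal_on f S U" and W: "D-lipschitz_on UNIV W" "minimal_on f S W"
    and fr: "\<And>x. x \<in> frontier S \<Longrightarrow> W x - U x \<le> M" and x: "x \<in> S"
  shows "W x - U x \<le> M"
proof -
  define h where "h x = W x - U x - M" for x
  have h: "(D + C + 0)-lipschitz_on UNIV h"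
    unfolding h_def by (intro lipschitz_on_diff W U lipschitz_on_constant)
  define k where "k = cutoff S h"
  have k: "(D + C + 0)-lipschitz_on UNIV k"
    unfolding k_def by (rule cutoff_lipschitz[OF S(1) h]) (use fr in \<open>simp add: h_def\<close>)
  obtain B where B: "B > 0" "\<And>x. \<bar>k x\<bar> \<le> B" using cutoff_bounded[OF S(2) h] unfolding k_def by blast
  have koff: "k x = 0" if "x \<notin> S" for x using that unfolding k_def by (rule cutoff_props)
  obtain R where R: "S \<subseteq> cball 0 R" using S(2) by (metis bounded_iff mem_cball_0 subsetI)
  define \<epsilon> where "\<epsilon> = 1 / (4 * B)"
  have "k x = 0"
  proof (rule comparison_core[OF f U(1) W(1) k])
    show "0 \<le> k x" for x unfolding k_def by (rule cutoff_props)
    show "k x = 0" if "x \<notin> cball 0 R" for x using that R by (intro koff) blast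
    show "k x = W x - U x - M" if "0 < k x" for x
      using cutoff_props(3)[of S h x] that unfolding k_def h_def by simp
    show "\<epsilon> > 0" using B unfolding \<epsilon>_def by simp
    show "2 * \<epsilon> * k x < 1" for x using B(1) B(2)[of x] unfolding \<epsilon>_def by (simp add: field_simps)
    show "0 \<le> (LINT x|lebesgue. energy_change f U (\<lambda>x. \<epsilon> * (k x)\<^sup>2) x)"
      by (rule minimal_onD[OF U(2) k B(2) koff])
    show "0 \<le> (LINT x|lebesgue. energy_change f W (\<lambda>x. - \<epsilon> * (k x)\<^sup>2) x)"
      by (rule minimal_onD[OF W(2) k B(2) koff])
  qed
  then show ?thesis using cutoff_props(5)[OF x, of h] unfolding k_def h_def by simp
qed


section \<open>Gradient bounds for minimizers\<close>

lemma minimizer_extension: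
  fixes \<Omega> :: "'a::euclidean_space set"
  assumes "is_minimizer \<Omega> \<psi> f u" "\<Omega> \<noteq> {}"
  obtains C U where "C-lipschitz_on UNIV U" "\<And>x. x \<in> closure \<Omega> \<Longrightarrow> U x = u x"
proof -
  obtain C where C: "C-lipschitz_on (closure \<Omega>) u"
    using assms(1) unfolding is_minimizer_def competitors_def Lip_def by blast
  have "closure \<Omega> \<noteq> {}" using assms(2) by simp
  then show ?thesis using lipschitz_extension[OF C] that by blast
qed

lemma minimizer_vs_affine:
  fixes \<Omega> :: "'a::euclidean_space set"
  assumes op: "open \<Omega>" and bdd: "bounded \<Omega>"
    and f: "regular_Lagrangean f" and f0: "half_deriv f 0 = 0"
    and min: "is_minimizer \<Omega> \<psi> f u" and x: "x \<in> closure \<Omega>"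
  shows "(\<And>x. x \<in> frontier \<Omega> \<Longrightarrow> \<psi> x \<le> l \<bullet> x + c) \<Longrightarrow> u x \<le> l \<bullet> x + c"
    and "(\<And>x. x \<in> frontier \<Omega> \<Longrightarrow> l \<bullet> x + c \<le> \<psi> x) \<Longrightarrow> l \<bullet> x + c \<le> u x"
proof -
  have fr: "frontier \<Omega> = closure \<Omega> - \<Omega>" using op by (simp add: frontier_def interior_open)
  have u\<psi>: "u x = \<psi> x" if "x \<in> frontier \<Omega>" for x
    using min that unfolding is_minimizer_def competitors_def by blast
  have ne: "\<Omega> \<noteq> {}" using x by auto
  obtain C U where U: "C-lipschitz_on UNIV U" and eq: "\<And>x. x \<in> closure \<Omega> \<Longrightarrow> U x = u x"
    using minimizer_extension[OF min ne] by blast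
  note mU = minimizer_minimal_on[OF op bdd f min U eq]
  note L = inner_affine_lipschitz[of l c] and mL = affine_minimal_on[OF bdd f f0, of l c]
  have U\<psi>: "U x = \<psi> x" if "x \<in> frontier \<Omega>" for x using that eq u\<psi> fr by auto
  show "u x \<le> l \<bullet> x + c" if le: "\<And>x. x \<in> frontier \<Omega> \<Longrightarrow> \<psi> x \<le> l \<bullet> x + c"
  proof (cases "x \<in> \<Omega>")
    case True
    have bd: "U y - (l \<bullet> y + c) \<le> 0" if "y \<in> frontier \<Omega>" for y
      using le[OF that] U\<psi>[OF that] by simp
    have "U x - (l \<bullet> x + c) \<le> 0" by (rule comparison_principle[OF f f0 op bdd L mL U mU bd True])
    then show ?thesis using eq[OF x] by simp
  qed (use x le u\<psi> fr in auto)
  show "l \<bullet> x + c \<le> u x" if le: "\<And>x. x \<in> frontier \<Omega> \<Longrightarrow> l \<bullet> x + c \<le> \<psi> x"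
  proof (cases "x \<in> \<Omega>")
    case True
    have bd: "(l \<bullet> y + c) - U y \<le> 0" if "y \<in> frontier \<Omega>" for y
      using le[OF that] U\<psi>[OF that] by simp
    have "(l \<bullet> x + c) - U x \<le> 0" by (rule comparison_principle[OF f f0 op bdd U mU L mL bd True])
    then show ?thesis using eq[OF x] by simp
  qed (use x le u\<psi> fr in auto)
qed

text \<open>A minimizer is compared with its own translate on the intersection of the domain with its
  translate.  Each boundary point of the intersection is a boundary point of one of the two domains,
  which is where the hypothesis on \<open>M\<close> applies.\<close>

lemma minimizer_vs_translate:
  fixes \<Omega> :: "'a::euclidean_space set"
  assumes op: "open \<Omega>" and bdd: "bounded \<Omega>"
    and f: "regular_Lagrangean f" and f0: "half_deriv f 0 = 0"
    and min: "is_minimizer \<Omega> \<psi> f u"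
    and M: "\<And>x y. x \<in> closure \<Omega> \<Longrightarrow> y \<in> closure \<Omega> \<Longrightarrow> x \<in> frontier \<Omega> \<or> y \<in> frontier \<Omega> \<Longrightarrow> y - x = \<tau> \<Longrightarrow> u y - u x \<le> M"
    and x: "x \<in> \<Omega>" "x + \<tau> \<in> \<Omega>"
  shows "u (x + \<tau>) - u x \<le> M"
proof -
  have ne: "\<Omega> \<noteq> {}" using x by auto
  obtain C U where U: "C-lipschitz_on UNIV U" and eq: "\<And>x. x \<in> closure \<Omega> \<Longrightarrow> U x = u x"
    using minimizer_extension[OF min ne] by blast
  note mU = minimizer_minimal_on[OF op bdd f min U eq]
  define S where "S = \<Omega> \<inter> (\<lambda>x. x + \<tau>) -` \<Omega>"
  have S: "open S" unfolding S_def
    by (intro open_Int op open_vimage continuous_on_add continuous_on_id continuous_on_const)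
  have bS: "bounded S" using bdd unfolding S_def by (rule bounded_subset) auto
  have mS: "minimal_on f S U" by (rule minimal_on_subset[OF mU]) (auto simp: S_def)
  have mS': "minimal_on f S (\<lambda>x. U (x + \<tau>))"
    by (rule minimal_on_subset[OF minimal_on_translate[OF f U mU]]) (auto simp: S_def)
  have frS: "U (x + \<tau>) - U x \<le> M" if "x \<in> frontier S" for x
  proof -
    have xS: "x \<in> closure S" "x \<notin> S" using that S by (auto simp: frontier_def interior_open)
    have 1: "x \<in> closure \<Omega>" using xS(1) closure_mono[of S \<Omega>] unfolding S_def by auto
    have "S \<subseteq> (\<lambda>x. x + \<tau>) -` closure \<Omega>" unfolding S_def using closure_subset[of \<Omega>] by auto
    moreover have "closed ((\<lambda>x. x + \<tau>) -` closure \<Omega>)"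
      by (intro closed_vimage closed_closure continuous_on_add continuous_on_id continuous_on_const)
    ultimately have 2: "x + \<tau> \<in> closure \<Omega>" using xS(1) closure_minimal by blast
    have "x \<in> frontier \<Omega> \<or> x + \<tau> \<in> frontier \<Omega>"
      using 1 2 xS(2) op unfolding S_def by (auto simp: frontier_def interior_open)
    then have "u (x + \<tau>) - u x \<le> M" using 1 2 by (intro M) auto
    then show ?thesis using eq 1 2 by simp
  qed
  have "U (x + \<tau>) - U x \<le> M"
    by (rule comparison_principle[OF f f0 S bS U mS lipschitz_translate[OF U] mS' frS])
       (use x in \<open>auto simp: S_def\<close>)
  moreover have "U x = u x" "U (x + \<tau>) = u (x + \<tau>)" using x closure_subset[of \<Omega>] by (auto intro!: eq)
  ultimately show ?thesis by simp
qed

lemma affine_function_inner: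
  fixes L :: "'a::euclidean_space \<Rightarrow> real"
  assumes "affine_function L" obtains l c where "\<And>x. L x = l \<bullet> x + c"
proof -
  obtain h c where h: "linear h" "L = (\<lambda>x. h x + c)" using assms unfolding affine_function_def by blast
  have "h x = (\<Sum>b\<in>Basis. h b *\<^sub>R b) \<bullet> x" for x
  proof -
    have "h x = h (\<Sum>b\<in>Basis. (x \<bullet> b) *\<^sub>R b)" by (simp add: euclidean_representation)
    also have "\<dots> = (\<Sum>b\<in>Basis. (x \<bullet> b) * h b)" using h(1) by (simp add: linear_sum linear_scale)
    also have "\<dots> = (\<Sum>b\<in>Basis. h b *\<^sub>R b) \<bullet> x" by (simp add: inner_sum_left inner_commute[of x] mult.commute)
    finally show ?thesis .
  qed
  then have "L x = (\<Sum>b\<in>Basis. h b *\<^sub>R b) \<bullet> x + c" for x unfolding h(2) by (rule arg_cong)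
  then show ?thesis by (rule that)
qed

lemma bounded_slope_condition_planes:
  fixes \<Omega> :: "'a::euclidean_space set"
  assumes "open \<Omega>" "\<Omega> \<noteq> {}" "Q > 0" "bounded_slope_condition \<Omega> \<psi> Q" "x0 \<in> frontier \<Omega>"
  shows "\<exists>l c l' c'. norm l \<le> Q \<and> norm l' \<le> Q \<and>
    (\<forall>x\<in>frontier \<Omega>. l' \<bullet> x + c' \<le> \<psi> x \<and> \<psi> x \<le> l \<bullet> x + c) \<and>
    l' \<bullet> x0 + c' = \<psi> x0 \<and> l \<bullet> x0 + c = \<psi> x0"
proof -
  obtain Lp Lm where L: "affine_function Lp" "affine_function Lm"
    "\<And>x. x \<in> frontier \<Omega> \<Longrightarrow> Lm x \<le> \<psi> x \<and> \<psi> x \<le> Lp x" "Lm x0 = \<psi> x0" "Lp x0 = \<psi> x0"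
    and slope: "\<And>x y. x \<in> \<Omega> \<Longrightarrow> y \<in> \<Omega> \<Longrightarrow> x \<noteq> y \<Longrightarrow>
           \<bar>Lp x - Lp y\<bar> / norm (x - y) \<le> Q \<and> \<bar>Lm x - Lm y\<bar> / norm (x - y) \<le> Q"
    using assms(4)[unfolded bounded_slope_condition_def, rule_format, OF assms(5)] by blast
  obtain l c where l: "\<And>x. Lp x = l \<bullet> x + c" using affine_function_inner[OF L(1)] by blast
  obtain l' c' where l': "\<And>x. Lm x = l' \<bullet> x + c'" using affine_function_inner[OF L(2)] by blast
  have le: "norm m \<le> Q" if m: "\<And>x y. x \<in> \<Omega> \<Longrightarrow> y \<in> \<Omega> \<Longrightarrow> x \<noteq> y \<Longrightarrow> \<bar>m \<bullet> x - m \<bullet> y\<bar> / norm (x - y) \<le> Q" for m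
  proof (cases "m = 0")
    case True then show ?thesis using \<open>Q > 0\<close> by simp
  next
    case False
    obtain x r where x: "x \<in> \<Omega>" "r > 0" "ball x r \<subseteq> \<Omega>"
      using assms(1,2) by (metis all_not_in_conv open_contains_ball)
    define y where "y = x + (r / (2 * norm m)) *\<^sub>R m"
    have y: "y - x = (r / (2 * norm m)) *\<^sub>R m" unfolding y_def by simp
    have n: "norm (y - x) = r / 2" unfolding y using False x by simp
    then have "y \<in> \<Omega>" using x by (intro subsetD[OF x(3)]) (simp add: dist_norm norm_minus_commute)
    moreover have "y \<noteq> x" using n x by auto
    ultimately have "\<bar>m \<bullet> y - m \<bullet> x\<bar> / norm (y - x) \<le> Q" using m x by auto
    moreover have "m \<bullet> y - m \<bullet> x = r / 2 * norm m"
      unfolding inner_diff_right[symmetric] y using False by (simp add: power2_norm_eq_inner[symmetric] power2_eq_square)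
    ultimately show ?thesis unfolding n using x by (simp add: abs_mult)
  qed
  have "norm l \<le> Q" "norm l' \<le> Q" using slope by (auto simp: l l' intro!: le)
  moreover have "\<forall>x\<in>frontier \<Omega>. l' \<bullet> x + c' \<le> \<psi> x \<and> \<psi> x \<le> l \<bullet> x + c" using L(3) unfolding l l' by blast
  moreover have "l' \<bullet> x0 + c' = \<psi> x0" "l \<bullet> x0 + c = \<psi> x0" using L(4,5) unfolding l l' by auto
  ultimately show ?thesis by blast
qed

text \<open>The affine functions of the bounded slope condition are barriers that give the estimate when one
  of the points lies on the boundary; comparison with translates carries it to pairs of interior
  points.\<close>

lemma minimizer_lipschitz:
  fixes \<Omega> :: "'a::euclidean_space set"
  assumes op: "open \<Omega>" and bdd: "bounded \<Omega>" and Q: "Q > 0" and bsc: "bounded_slope_condition \<Omega> \<psi> Q"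
    and f: "regular_Lagrangean f" and f0: "half_deriv f 0 = 0"
    and min: "is_minimizer \<Omega> \<psi> f u"
    and x: "x \<in> \<Omega>" "y \<in> \<Omega>"
  shows "u y - u x \<le> Q * norm (y - x)"
proof -
  have u\<psi>: "u x = \<psi> x" if "x \<in> frontier \<Omega>" for x
    using min that unfolding is_minimizer_def competitors_def by blast
  have ne: "\<Omega> \<noteq> {}" using x by auto
  have bar: "\<bar>u x - u x0\<bar> \<le> Q * norm (x - x0)" if x: "x \<in> closure \<Omega>" and x0: "x0 \<in> frontier \<Omega>" for x x0
  proof -
    obtain l c l' c' where l: "norm l \<le> Q" "norm l' \<le> Q"
      "\<forall>x\<in>frontier \<Omega>. l' \<bullet> x + c' \<le> \<psi> x \<and> \<psi> x \<le> l \<bullet> x + c"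
      "l' \<bullet> x0 + c' = \<psi> x0" "l \<bullet> x0 + c = \<psi> x0"
      using bounded_slope_condition_planes[OF op ne Q bsc x0] by blast
    have cs: "\<bar>m \<bullet> (x - x0)\<bar> \<le> Q * norm (x - x0)" if "norm m \<le> Q" for m
      using Cauchy_Schwarz_ineq2[of m "x - x0"] mult_right_mono[OF that norm_ge_zero[of "x - x0"]] by linarith
    have "u x \<le> l \<bullet> x + c" by (rule minimizer_vs_affine(1)[OF op bdd f f0 min x]) (use l(3) in blast)
    moreover have "l' \<bullet> x + c' \<le> u x" by (rule minimizer_vs_affine(2)[OF op bdd f f0 min x]) (use l(3) in blast)
    ultimately show ?thesis
      using cs[OF l(1)] cs[OF l(2)] l(4,5) u\<psi>[OF x0] unfolding inner_diff_right by linarith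
  qed
  have "u (x + (y - x)) - u x \<le> Q * norm (y - x)"
  proof (rule minimizer_vs_translate[OF op bdd f f0 min])
    fix a b assume ab: "a \<in> closure \<Omega>" "b \<in> closure \<Omega>" "a \<in> frontier \<Omega> \<or> b \<in> frontier \<Omega>" "b - a = y - x"
    then show "u b - u a \<le> Q * norm (y - x)"
      using bar[of b a] bar[of a b] unfolding ab(4)[symmetric] by (auto simp: norm_minus_commute)
  qed (use x in auto)
  then show ?thesis by simp
qed

lemma minimizer_gradient_bound:
  fixes \<Omega> :: "'a::euclidean_space set"
  assumes op: "open \<Omega>" and bdd: "bounded \<Omega>" and Q: "Q > 0" and bsc: "bounded_slope_condition \<Omega> \<psi> Q"
    and f: "regular_Lagrangean f" and f0: "half_deriv f 0 = 0"
    and min: "is_minimizer \<Omega> \<psi> f u"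
  shows "AE x in lebesgue_on \<Omega>. norm (weak_gradient \<Omega> u x) \<le> real DIM('a) * Q"
proof (cases "\<Omega> = {}")
  case False
  obtain C U where U: "C-lipschitz_on UNIV U" and eq: "\<And>x. x \<in> closure \<Omega> \<Longrightarrow> U x = u x"
    using minimizer_extension[OF min False] by blast
  have eq\<Omega>: "U x = u x" if "x \<in> \<Omega>" for x using that closure_subset[of \<Omega>] by (intro eq) auto
  have "AE x in lebesgue. x \<in> \<Omega> \<longrightarrow> norm (grad U x) \<le> real DIM('a) * Q"
    using quotients_tendsto_grad[OF U]
  proof (eventually_elim, intro impI norm_le_of_components)
    fix x b :: 'a
    assume lim: "\<forall>b\<in>Basis. (\<lambda>n. diff_quotient b U n x) \<longlonglongrightarrow> grad U x \<bullet> b" and x: "x \<in> \<Omega>" and b: "b \<in> Basis"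
    have "\<forall>\<^sub>F n in sequentially. x + (1 / real (Suc n)) *\<^sub>R b \<in> \<Omega>"
      using topological_tendstoD[OF shrinking_steps op x] .
    then have ev: "\<forall>\<^sub>F n in sequentially. \<bar>diff_quotient b U n x\<bar> \<le> Q"
    proof eventually_elim
      fix n assume y: "x + (1 / real (Suc n)) *\<^sub>R b \<in> \<Omega>" (is "?y \<in> _")
      have "u ?y - u x \<le> Q * norm (?y - x)" by (rule minimizer_lipschitz[OF op bdd Q bsc f f0 min x y])
      moreover have "u x - u ?y \<le> Q * norm (x - ?y)" by (rule minimizer_lipschitz[OF op bdd Q bsc f f0 min y x])
      moreover have "norm (?y - x) = 1 / real (Suc n)" "norm (x - ?y) = 1 / real (Suc n)" using b by simp_all
      ultimately have "\<bar>U ?y - U x\<bar> \<le> Q * (1 / real (Suc n))" unfolding eq\<Omega>[OF x] eq\<Omega>[OF y] abs_le_iff by simp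
      then have "real (Suc n) * \<bar>U ?y - U x\<bar> \<le> real (Suc n) * (Q * (1 / real (Suc n)))" by (rule mult_left_mono) simp
      also have "\<dots> = Q" by simp
      finally show "\<bar>diff_quotient b U n x\<bar> \<le> Q" unfolding diff_quotient_def by (simp add: abs_mult)
    qed
    have "(\<lambda>n. \<bar>diff_quotient b U n x\<bar>) \<longlonglongrightarrow> \<bar>grad U x \<bullet> b\<bar>" using lim b by (intro tendsto_rabs) auto
    then show "\<bar>grad U x \<bullet> b\<bar> \<le> Q" using ev by (rule tendsto_upperbound) simp
  qed
  then have "AE x in lebesgue_on \<Omega>. norm (grad U x) \<le> real DIM('a) * Q"
    using op by (simp add: AE_restrict_space_iff borel_open)
  moreover have "AE x in lebesgue_on \<Omega>. weak_gradient \<Omega> u x = grad U x" by (rule weak_gradient_extension(2)[OF op U eq\<Omega>])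
  ultimately show ?thesis by eventually_elim simp
qed (use op in \<open>simp add: AE_restrict_space_iff borel_open\<close>)

lemma minimizer_affine_data:
  fixes \<Omega> :: "'a::euclidean_space set"
  assumes op: "open \<Omega>" and bdd: "bounded \<Omega>"
    and f: "regular_Lagrangean f" and f0: "half_deriv f 0 = 0"
    and min: "is_minimizer \<Omega> \<psi> f u" and \<psi>: "\<And>x. x \<in> frontier \<Omega> \<Longrightarrow> \<psi> x = l \<bullet> x + c"
  shows "AE x in lebesgue_on \<Omega>. weak_gradient \<Omega> u x = l"
proof -
  have eq: "l \<bullet> x + c = u x" if "x \<in> \<Omega>" for x
  proof (rule antisym)
    have x: "x \<in> closure \<Omega>" using that closure_subset[of \<Omega>] by auto
    show "l \<bullet> x + c \<le> u x" by (rule minimizer_vs_affine(2)[OF op bdd f f0 min x]) (simp add: \<psi>)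
    show "u x \<le> l \<bullet> x + c" by (rule minimizer_vs_affine(1)[OF op bdd f f0 min x]) (simp add: \<psi>)
  qed
  have "AE x in lebesgue_on \<Omega>. weak_gradient \<Omega> u x = grad (\<lambda>x. l \<bullet> x + c) x"
    by (rule weak_gradient_extension(2)[OF op inner_affine_lipschitz eq])
  then show ?thesis unfolding grad_affine .
qed


section \<open>The geometry imposed by the bounded slope condition\<close>

text \<open>A plane that supports the boundary also supports the domain, because every ray from an
  interior point meets the boundary.  A segment that leaves the domain would cross a boundary point
  strictly inside its own supporting half-space.\<close>

lemma convex_of_supporting_planes:
  fixes \<Omega> :: "'a::euclidean_space set"
  assumes op: "open \<Omega>" and bdd: "bounded \<Omega>"
    and supp: "\<And>x0. x0 \<in> frontier \<Omega> \<Longrightarrow> \<exists>m. m \<noteq> 0 \<and> (\<forall>y\<in>frontier \<Omega>. 0 \<le> m \<bullet> (y - x0))"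
  shows "convex \<Omega>"
proof -
  have inside: "0 < m \<bullet> (y - x0)" if m: "m \<noteq> 0" "\<And>y. y \<in> frontier \<Omega> \<Longrightarrow> 0 \<le> m \<bullet> (y - x0)" and y: "y \<in> \<Omega>" for m x0 y
  proof -
    \<comment> \<open>walk from \<open>y\<close> against \<open>m\<close> until the boundary is met\<close>
    obtain R where R: "\<And>x. x \<in> \<Omega> \<Longrightarrow> norm x \<le> R" using bdd unfolding bounded_iff by blast
    define T where "T = (norm y + \<bar>R\<bar> + 1) / norm m"
    have T: "T * norm m = norm y + \<bar>R\<bar> + 1" using m(1) unfolding T_def by simp
    have "T \<ge> 0" unfolding T_def by simp
    define w where "w = y - T *\<^sub>R m"
    have "norm (T *\<^sub>R m) \<le> norm y + norm w" unfolding w_def using norm_triangle_ineq4[of y "y - T *\<^sub>R m"] by simp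
    then have "R < norm w" using T \<open>T \<ge> 0\<close> by simp
    then have "w \<notin> \<Omega>" using R by force
    then have "closed_segment y w \<inter> \<Omega> \<noteq> {}" "closed_segment y w - \<Omega> \<noteq> {}" using y by auto
    then obtain z where z: "z \<in> closed_segment y w" "z \<in> frontier \<Omega>"
      using connected_Int_frontier[OF connected_segment] by blast
    then obtain s where s: "0 \<le> s" "z = (1 - s) *\<^sub>R y + s *\<^sub>R w" unfolding closed_segment_def by blast
    then have zy: "z = y - (s * T) *\<^sub>R m" unfolding w_def by (simp add: algebra_simps)
    have "z \<noteq> y" using z(2) y op by (auto simp: frontier_def interior_open)
    then have "s * T > 0" using s(1) \<open>T \<ge> 0\<close> zy by (metis diff_zero mult_nonneg_nonneg order_le_less scaleR_zero_left)
    then have "0 < (s * T) * (m \<bullet> m)" using m(1) by simp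
    moreover have "m \<bullet> (y - x0) = m \<bullet> (z - x0) + (s * T) * (m \<bullet> m)" unfolding zy by (simp add: inner_diff_right)
    ultimately show ?thesis using m(2)[OF z(2)] by linarith
  qed
  show ?thesis
    unfolding convex_contains_segment
  proof (intro ballI subsetI)
    fix a b z assume a: "a \<in> \<Omega>" and b: "b \<in> \<Omega>" and z: "z \<in> closed_segment a b"
    show "z \<in> \<Omega>"
    proof (rule ccontr)
      assume "z \<notin> \<Omega>"
      then have "closed_segment a b \<inter> \<Omega> \<noteq> {}" "closed_segment a b - \<Omega> \<noteq> {}" using a z by auto
      then obtain x0 where x0: "x0 \<in> closed_segment a b" "x0 \<in> frontier \<Omega>"
        using connected_Int_frontier[OF connected_segment] by blast
      obtain m where m: "m \<noteq> 0" "\<And>y. y \<in> frontier \<Omega> \<Longrightarrow> 0 \<le> m \<bullet> (y - x0)" using supp[OF x0(2)] by blast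
      obtain s where s: "0 \<le> s" "s \<le> 1" "x0 = (1 - s) *\<^sub>R a + s *\<^sub>R b" using x0(1) unfolding closed_segment_def by blast
      have pos: "0 < m \<bullet> (a - x0)" "0 < m \<bullet> (b - x0)" using inside[OF m] a b by auto
      have "0 = m \<bullet> ((1 - s) *\<^sub>R (a - x0) + s *\<^sub>R (b - x0))"
        unfolding s(3) by (simp add: algebra_simps)
      also have "\<dots> = (1 - s) * (m \<bullet> (a - x0)) + s * (m \<bullet> (b - x0))" by (simp add: inner_add_right)
      also have "\<dots> > 0"
        using s(1,2) pos by (cases "s = 0") (auto intro!: add_nonneg_pos)
      finally show False by simp
    qed
  qed
qed

text \<open>At each boundary point the difference of the two affine functions is an affine function that is
  nonnegative on the boundary and vanishes at the point: a supporting plane, unless the two coincide,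
  and then they pin down all the boundary values.\<close>

lemma bounded_slope_condition_dichotomy:
  fixes \<Omega> :: "'a::euclidean_space set"
  assumes "open \<Omega>" "\<Omega> \<noteq> {}" "bounded \<Omega>" "Q > 0" "bounded_slope_condition \<Omega> \<psi> Q"
  shows "(\<exists>l c. \<forall>x\<in>frontier \<Omega>. \<psi> x = l \<bullet> x + c) \<or> convex \<Omega>"
proof (rule disjCI)
  assume nonconvex: "\<not> convex \<Omega>"
  obtain x0 where x0: "x0 \<in> frontier \<Omega>" "\<And>m. m \<noteq> 0 \<Longrightarrow> \<not> (\<forall>y\<in>frontier \<Omega>. 0 \<le> m \<bullet> (y - x0))"
    using convex_of_supporting_planes[OF assms(1,3)] nonconvex by blast
  obtain l c l' c' where l:
    "\<forall>x\<in>frontier \<Omega>. l' \<bullet> x + c' \<le> \<psi> x \<and> \<psi> x \<le> l \<bullet> x + c" "l' \<bullet> x0 + c' = \<psi> x0" "l \<bullet> x0 + c = \<psi> x0"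
    using bounded_slope_condition_planes[OF assms(1,2,4,5) x0(1)] by blast
  have "0 \<le> (l - l') \<bullet> (y - x0)" if "y \<in> frontier \<Omega>" for y
  proof -
    have "l' \<bullet> y + c' \<le> l \<bullet> y + c" using l(1) that by force
    then show ?thesis using l(2,3) by (simp add: inner_diff_left inner_diff_right)
  qed
  then have "l = l'" using x0(2)[of "l - l'"] by force
  then have "\<psi> x = l \<bullet> x + c" if "x \<in> frontier \<Omega>" for x using l that by force
  then show "\<exists>l c. \<forall>x\<in>frontier \<Omega>. \<psi> x = l \<bullet> x + c" by blast
qed


section \<open>Equicontinuity and compactness\<close>

lemma lipschitz_of_weak_gradient_convex:
  fixes v :: "'a::euclidean_space \<Rightarrow> real"
  assumes op: "open \<Omega>" and conv: "convex \<Omega>" and v: "continuous_on UNIV v"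
    and G: "has_weak_gradient \<Omega> v G" and bd: "AE x in lebesgue_on \<Omega>. norm (G x) \<le> B"
    and x: "x \<in> \<Omega>" "y \<in> \<Omega>"
  shows "v y - v x \<le> B * norm (y - x)"
proof -
  have "v (x + (y - x)) - v x \<le> B * norm (y - x)"
  proof (rule weak_gradient_mean_value[OF op v G])
    show "AE z in lebesgue_on \<Omega>. G z \<bullet> (y - x) \<le> B * norm (y - x)"
      using bd
    proof eventually_elim
      fix z assume "norm (G z) \<le> B"
      then show "G z \<bullet> (y - x) \<le> B * norm (y - x)"
        using norm_cauchy_schwarz[of "G z" "y - x"] mult_right_mono[of "norm (G z)" B "norm (y - x)"] by auto
    qed
    show "closed_segment x (x + (y - x)) \<subseteq> \<Omega>"
      using closed_segment_subset[OF x conv] by simp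
  qed
  then show ?thesis by simp
qed

lemma affine_of_constant_weak_gradient:
  fixes v :: "'a::euclidean_space \<Rightarrow> real"
  assumes op: "open \<Omega>" and conn: "connected \<Omega>" and v: "continuous_on UNIV v"
    and G: "has_weak_gradient \<Omega> v G" and const: "AE x in lebesgue_on \<Omega>. G x = g"
    and x: "x \<in> \<Omega>" "y \<in> \<Omega>"
  shows "v y - v x = g \<bullet> (y - x)"
proof -
  have up: "v (a + e) - v a \<le> g \<bullet> e" if "closed_segment a (a + e) \<subseteq> \<Omega>" for a e
    by (rule weak_gradient_mean_value[OF op v G _ that]) (use const in \<open>eventually_elim, simp\<close>)
  have "v x - g \<bullet> x = v y - g \<bullet> y"
  proof (rule connected_local_const[OF conn x], intro ballI)
    fix a assume "a \<in> \<Omega>"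
    then obtain r where r: "r > 0" "ball a r \<subseteq> \<Omega>" using op open_contains_ball by blast
    have eqb: "v a - g \<bullet> a = v b - g \<bullet> b" if "b \<in> ball a r" for b
    proof -
      have seg: "closed_segment a b \<subseteq> \<Omega>"
        using closed_segment_subset[OF _ that convex_ball, of a] r by (metis centre_in_ball subset_trans)
      have "v b - v a \<le> g \<bullet> (b - a)" using up[of a "b - a"] seg by simp
      moreover have "v a - v b \<le> g \<bullet> (a - b)" using up[of b "a - b"] seg by (simp add: closed_segment_commute)
      ultimately show ?thesis by (simp add: inner_diff_right)
    qed
    show "\<forall>\<^sub>F b in at a within \<Omega>. v a - g \<bullet> a = v b - g \<bullet> b"
      by (rule eventually_mono[OF eventually_at_ball[OF r(1), of a \<Omega>]]) (use eqb in blast)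
  qed
  then show ?thesis by (simp add: inner_diff_right)
qed

text \<open>If \<open>v\<close> exceeded the bound at one point it would be positive on the whole domain, against its
  mean value.\<close>

lemma mean_zero_lipschitz_bound:
  fixes v :: "'a::euclidean_space \<Rightarrow> real"
  assumes op: "open \<Omega>" and ne: "\<Omega> \<noteq> {}" and R: "\<Omega> \<subseteq> cball 0 R"
    and v: "B-lipschitz_on (closure \<Omega>) v" and mean: "(LINT x|lebesgue_on \<Omega>. v x) = 0"
    and x: "x \<in> closure \<Omega>"
  shows "\<bar>v x\<bar> \<le> B * (2 * R)"
proof -
  have B: "B \<ge> 0" using v by (rule lipschitz_on_nonneg)
  have ne': "closure \<Omega> \<noteq> {}" using ne by simp
  obtain V where V: "B-lipschitz_on UNIV V" "\<And>x. x \<in> closure \<Omega> \<Longrightarrow> V x = v x"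
    using lipschitz_extension[OF v ne'] by blast
  have lm: "\<Omega> \<in> lmeasurable" using op R by (metis bounded_subset bounded_cball lmeasurable_open)
  have pos: "measure lebesgue \<Omega> > 0"
    using negligible_iff_measure0[OF lm] open_not_negligible[OF op ne] measure_nonneg[of lebesgue \<Omega>] by linarith
  have "locally_integrable_on UNIV V" by (rule locally_integrable_continuous[OF lipschitz_on_continuous_on[OF V(1)]])
  then have "V absolutely_integrable_on cball 0 R" unfolding locally_integrable_on_def by auto
  then have "V absolutely_integrable_on \<Omega>"
    by (rule set_integrable_subset) (use op R in \<open>auto simp: borel_open\<close>)
  then have intV: "integrable lebesgue (\<lambda>x. indicator \<Omega> x * V x)" unfolding set_integrable_def by simp
  have int1: "integrable lebesgue (\<lambda>x. indicator \<Omega> x * (c::real))" for c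
    using lm unfolding fmeasurable_def by (intro integrable_mult_left integrable_real_indicator) auto
  have val: "(LINT x|lebesgue. indicator \<Omega> x * c) = measure lebesgue \<Omega> * c" for c :: real
    by simp
  have zero: "(LINT x|lebesgue. indicator \<Omega> x * V x) = 0"
  proof -
    have "(LINT x|lebesgue_on \<Omega>. v x) = (LINT x|lebesgue_on \<Omega>. V x)"
      by (rule Bochner_Integration.integral_cong) (use V(2) closure_subset[of \<Omega>] in auto)
    then show ?thesis using mean unfolding LINT_on_eq_indicator[OF op] by simp
  qed
  have closeR: "norm y \<le> R" if "y \<in> closure \<Omega>" for y
    using that closure_minimal[OF R closed_cball] by auto
  have near: "\<bar>V y - V x\<bar> \<le> B * (2 * R)" if y: "y \<in> \<Omega>" for y
  proof -
    have yc: "y \<in> closure \<Omega>" using y closure_subset[of \<Omega>] by auto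
    have "norm (y - x) \<le> 2 * R" using closeR[OF yc] closeR[OF x] norm_triangle_ineq4[of y x] by linarith
    then have "B * norm (y - x) \<le> B * (2 * R)" using B by (rule mult_left_mono)
    moreover have "\<bar>V y - V x\<bar> \<le> B * norm (y - x)"
      using lipschitz_onD[OF V(1), of y x] by (simp add: dist_real_def dist_norm)
    ultimately show ?thesis by linarith
  qed
  have "measure lebesgue \<Omega> * (V x - B * (2 * R)) \<le> (LINT y|lebesgue. indicator \<Omega> y * V y)"
    unfolding val[symmetric]
    by (rule integral_mono[OF int1 intV]) (use near in \<open>fastforce simp: indicator_def\<close>)
  then have "V x - B * (2 * R) \<le> 0" unfolding zero using pos by (simp add: mult_le_0_iff)
  moreover have "(LINT y|lebesgue. indicator \<Omega> y * V y) \<le> measure lebesgue \<Omega> * (V x + B * (2 * R))"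
    unfolding val[symmetric]
    by (rule integral_mono[OF intV int1]) (use near in \<open>fastforce simp: indicator_def\<close>)
  then have "0 \<le> V x + B * (2 * R)" unfolding zero using pos by (simp add: zero_le_mult_iff)
  ultimately show ?thesis using V(2)[OF x] by (simp add: abs_le_iff)
qed

lemma equilipschitz_subsequence:
  fixes v :: "nat \<Rightarrow> 'a::euclidean_space \<Rightarrow> real"
  assumes K: "compact K" and v: "\<And>n. B-lipschitz_on K (v n)" and M: "\<And>n x. x \<in> K \<Longrightarrow> \<bar>v n x\<bar> \<le> M"
  shows "\<exists>r w. strict_mono (r :: nat \<Rightarrow> nat) \<and> uniform_limit K (\<lambda>k. v (r k)) w sequentially \<and> B-lipschitz_on K w"
proof -
  have B: "B \<ge> 0" using v by (rule lipschitz_on_nonneg)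
  have vB: "norm (v n x - v n y) \<le> B * norm (x - y)" if "x \<in> K" "y \<in> K" for n x y
    using lipschitz_onD[OF v that] by (simp add: dist_norm)
  have equi: "\<exists>d. 0 < d \<and> (\<forall>n y. y \<in> K \<and> norm (x - y) < d \<longrightarrow> norm (v n x - v n y) < e)"
    if "x \<in> K" "0 < e" for x e
  proof (intro exI conjI allI impI)
    show "0 < e / (B + 1)" using B that by simp
    fix n y assume y: "y \<in> K \<and> norm (x - y) < e / (B + 1)"
    have "norm (v n x - v n y) \<le> B * norm (x - y)" using vB that y by blast
    also have "\<dots> \<le> (B + 1) * norm (x - y)" using B by (intro mult_right_mono) auto
    also have "\<dots> < e" using y B by (simp add: pos_less_divide_eq mult.commute)
    finally show "norm (v n x - v n y) < e" .
  qed
  have M': "norm (v n x) \<le> M" if "x \<in> K" for n x using M[OF that] by simp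
  obtain w r where r: "strict_mono (r :: nat \<Rightarrow> nat)"
    "\<And>e. 0 < e \<Longrightarrow> \<exists>N. \<forall>n x. n \<ge> N \<and> x \<in> K \<longrightarrow> norm (v (r n) x - w x) < e"
    by (rule Arzela_Ascoli[OF K M' equi]) blast+
  have ul: "uniform_limit K (\<lambda>k. v (r k)) w sequentially"
    unfolding uniform_limit_iff eventually_sequentially dist_norm using r(2) by (metis (no_types, lifting))
  have "B-lipschitz_on K w"
  proof (rule lipschitz_onI[OF _ B])
    fix x y assume x: "x \<in> K" "y \<in> K"
    have "(\<lambda>k. dist (v (r k) x) (v (r k) y)) \<longlonglongrightarrow> dist (w x) (w y)"
      using tendsto_uniform_limitI[OF ul] x by (intro tendsto_dist) auto
    then show "dist (w x) (w y) \<le> B * dist x y"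
      by (rule LIMSEQ_le_const2) (use lipschitz_onD[OF v x] in auto)
  qed
  then show ?thesis using r(1) ul by blast
qed


section \<open>Stream functions and their limits\<close>

definition rot :: "real^2 \<Rightarrow> real^2" where
  "rot p = vector [- (p $ 2), p $ 1]"

lemma rot_component[simp]: "rot p $ 1 = - (p $ 2)" "rot p $ 2 = p $ 1"
  by (simp_all add: rot_def)

lemma norm_rot[simp]: "norm (rot p) = norm p"
  by (simp add: norm_eq_sqrt_inner inner_vec_def sum_2)

text \<open>The rotated flux \<open>f'(|p|) p\<^sup>\<bottom> / |p|\<close>.  With the convention \<open>1 / 0 = 0\<close> it
  vanishes at \<open>p = 0\<close>, as the first-order system requires.\<close>

definition flux :: "(real \<Rightarrow> real) \<Rightarrow> real^2 \<Rightarrow> real^2" where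
  "flux f p = (half_deriv f (norm p) / norm p) *\<^sub>R rot p"

lemma norm_flux_le: "0 \<le> half_deriv f (norm p) \<Longrightarrow> norm (flux f p) \<le> half_deriv f (norm p)"
  by (cases "p = 0") (auto simp: flux_def)

lemma conjugate_weak_gradient:
  assumes "conjugate_distributional \<Omega> f u v"
  shows "has_weak_gradient \<Omega> v (\<lambda>x. flux f (weak_gradient \<Omega> u x))"
proof -
  let ?D = "weak_gradient \<Omega> u"
  have *: "has_weak_partial \<Omega> (axis 1 1) v (\<lambda>x. flux f (?D x) \<bullet> axis 1 1)"
    "has_weak_partial \<Omega> (axis 2 1) v (\<lambda>x. flux f (?D x) \<bullet> axis 2 1)"
    using assms unfolding conjugate_distributional_def Let_def by (simp_all add: flux_def inner_axis)
  show ?thesis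
    unfolding has_weak_gradient_def
  proof
    fix b :: "real^2" assume "b \<in> Basis"
    then obtain i where "b = axis i 1" by (auto simp: Basis_vec_def)
    then show "has_weak_partial \<Omega> b v (\<lambda>x. flux f (?D x) \<bullet> b)" using * exhaust_2[of i] by auto
  qed
qed

text \<open>The supremum over the possible limits of \<open>flux (f n) (D n) \<bullet> e\<close> when \<open>D n\<close> tends to
  \<open>p\<close>: a single value if \<open>p \<noteq> 0\<close>, and all directions of length at most \<open>f'(0)\<close> otherwise.\<close>

definition flux_bound :: "(real \<Rightarrow> real) \<Rightarrow> real^2 \<Rightarrow> real^2 \<Rightarrow> real" where
  "flux_bound f e p = (if p = 0 then half_deriv f 0 * norm e else flux f p \<bullet> e)"

lemma flux_bound_borel:
  assumes f: "regular_Lagrangean f"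
  shows "flux_bound f e \<in> borel_measurable borel"
proof -
  have "continuous_on UNIV (\<lambda>p::real^2. half_deriv f (norm p))"
    by (rule continuous_on_compose2[OF regular_continuous_deriv[OF f] continuous_on_norm[OF continuous_on_id]]) auto
  then have [measurable]: "(\<lambda>p::real^2. half_deriv f (norm p)) \<in> borel_measurable borel"
    by (rule borel_measurable_continuous_onI)
  have "continuous_on UNIV (\<lambda>p::real^2. rot p \<bullet> e)"
    unfolding inner_vec_def sum_2 rot_component inner_real_def
    by (intro continuous_on_add continuous_on_mult continuous_on_minus continuous_on_component continuous_on_id continuous_on_const)
  then have [measurable]: "(\<lambda>p. rot p \<bullet> e) \<in> borel_measurable borel"
    by (rule borel_measurable_continuous_onI)
  show ?thesis unfolding flux_bound_def flux_def inner_scaleR_left by measurable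
qed

lemma flux_bound_abs:
  assumes f: "regular_Lagrangean f" and f0: "half_deriv f 0 > 0" and p: "norm p \<le> R"
  shows "\<bar>flux_bound f e p\<bar> \<le> half_deriv f R * norm e"
proof -
  have nn: "0 \<le> half_deriv f (norm p)" using regular_deriv_mono[OF f, of 0 "norm p"] f0 by simp
  have le: "half_deriv f (norm p) \<le> half_deriv f R" using p by (intro regular_deriv_mono[OF f]) auto
  have "\<bar>flux f p \<bullet> e\<bar> \<le> norm (flux f p) * norm e" by (rule Cauchy_Schwarz_ineq2)
  also have "\<dots> \<le> half_deriv f R * norm e"
    using norm_flux_le[OF nn] le by (intro mult_right_mono) auto
  finally have 1: "\<bar>flux f p \<bullet> e\<bar> \<le> half_deriv f R * norm e" .
  show ?thesis
  proof (cases "p = 0")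
    case True
    then have "half_deriv f 0 * norm e \<le> half_deriv f R * norm e" using le by (intro mult_right_mono) auto
    then show ?thesis using True f0 by (simp add: flux_bound_def abs_mult)
  next
    case False then show ?thesis using 1 by (simp add: flux_bound_def)
  qed
qed

lemma flux_excess_tendsto_0:
  assumes f: "regular_Lagrangean f" and fn: "\<And>n. regular_Lagrangean (fn n)"
    and fn0: "\<And>n. half_deriv (fn n) 0 = 0"
    and lim: "uniform_limit {0..} fn f sequentially" and p: "p \<longlonglongrightarrow> q"
  shows "(\<lambda>n. max 0 (flux (fn n) (p n) \<bullet> e - flux_bound f e q)) \<longlonglongrightarrow> 0"
proof -
  have np: "(\<lambda>n. norm (p n)) \<longlonglongrightarrow> norm q" using p by (rule tendsto_norm)
  show ?thesis
  proof (cases "q = 0")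
    case False
    have d: "(\<lambda>n. half_deriv (fn n) (norm (p n))) \<longlonglongrightarrow> half_deriv f (norm q)"
      using False by (intro deriv_tendsto[OF f fn lim np]) auto
    have "(\<lambda>n. rot (p n)) \<longlonglongrightarrow> rot q"
    proof (rule vec_tendstoI)
      fix i :: 2
      show "(\<lambda>n. rot (p n) $ i) \<longlonglongrightarrow> rot q $ i"
        using exhaust_2[of i] tendsto_minus[OF tendsto_vec_nth[OF p, of 2]] tendsto_vec_nth[OF p, of 1] by auto
    qed
    then have "(\<lambda>n. flux (fn n) (p n) \<bullet> e) \<longlonglongrightarrow> flux f q \<bullet> e"
      unfolding flux_def using False by (intro tendsto_inner tendsto_scaleR tendsto_divide d np tendsto_const) auto
    then have "(\<lambda>n. max 0 (flux (fn n) (p n) \<bullet> e - flux f q \<bullet> e)) \<longlonglongrightarrow> max 0 (flux f q \<bullet> e - flux f q \<bullet> e)"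
      by (rule tendsto_max[OF tendsto_const tendsto_diff[OF _ tendsto_const]])
    then show ?thesis using False by (simp add: flux_bound_def)
  next
    case True
    have nn: "0 \<le> half_deriv (fn n) (norm (p n))" for n
      using regular_deriv_mono[OF fn, of 0 "norm (p n)" n] fn0[of n] by simp
    have le: "flux (fn n) (p n) \<bullet> e \<le> half_deriv (fn n) (norm (p n)) * norm e" for n
      using norm_cauchy_schwarz[of "flux (fn n) (p n)" e] mult_right_mono[OF norm_flux_le[OF nn[of n]] norm_ge_zero[of e]]
      by linarith
    show ?thesis
    proof (rule LIMSEQ_I)
      fix \<epsilon> :: real assume "\<epsilon> > 0"
      define \<delta> where "\<delta> = \<epsilon> / (norm e + 1)"
      have \<delta>: "\<delta> > 0" "\<delta> * norm e < \<epsilon>"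
        using \<open>\<epsilon> > 0\<close> norm_ge_zero[of e] unfolding \<delta>_def by (auto simp: field_simps add_pos_nonneg add_nonneg_pos)
      have "\<forall>\<^sub>F n in sequentially. half_deriv (fn n) (norm (p n)) < half_deriv f 0 + \<delta>"
        using \<delta>(1) np True by (intro deriv_eventually_less[OF f fn lim, where l = 0]) auto
      then obtain N where N: "\<And>n. n \<ge> N \<Longrightarrow> half_deriv (fn n) (norm (p n)) < half_deriv f 0 + \<delta>"
        unfolding eventually_sequentially by blast
      have "norm (max 0 (flux (fn n) (p n) \<bullet> e - flux_bound f e q) - 0) < \<epsilon>" if "n \<ge> N" for n
      proof -
        have "half_deriv (fn n) (norm (p n)) * norm e \<le> (half_deriv f 0 + \<delta>) * norm e"
          using N[OF that] by (intro mult_right_mono) auto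
        then have "flux (fn n) (p n) \<bullet> e - flux_bound f e q < \<epsilon>"
          using le[of n] \<delta>(2) True by (simp add: flux_bound_def distrib_right)
        then show ?thesis using \<open>\<epsilon> > 0\<close> by simp
      qed
      then show "\<exists>N. \<forall>n\<ge>N. norm (max 0 (flux (fn n) (p n) \<bullet> e - flux_bound f e q) - 0) < \<epsilon>" by blast
    qed
  qed
qed

text \<open>Testing against nonnegative functions, the weak limit of \<open>flux (f n) (D n) \<bullet> e\<close> stays below
  the pointwise upper bound; only the positive part of the excess needs to converge.\<close>

lemma weak_limit_flux_le:
  fixes \<Omega> :: "(real^2) set"
  assumes op: "open \<Omega>" and f: "regular_Lagrangean f" and f0: "half_deriv f 0 > 0"
    and fn: "\<And>n. regular_Lagrangean (fn n)" and fn0: "\<And>n. half_deriv (fn n) 0 = 0"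
    and lim: "uniform_limit {0..} fn f sequentially"
    and V: "\<And>n. continuous_on UNIV (V n)" "C-lipschitz_on UNIV W"
    and VM: "\<And>n x. x \<in> \<Omega> \<Longrightarrow> \<bar>V n x\<bar> \<le> M"
    and VW: "\<And>x. x \<in> \<Omega> \<Longrightarrow> (\<lambda>n. V n x) \<longlonglongrightarrow> W x"
    and G: "\<And>n. has_weak_gradient \<Omega> (V n) (\<lambda>x. flux (fn n) (D n x))"
    and GB: "\<And>n. AE x in lebesgue_on \<Omega>. norm (flux (fn n) (D n x)) \<le> B"
    and D0: "D0 \<in> borel_measurable borel" "AE x in lebesgue_on \<Omega>. norm (D0 x) \<le> R"
    and DD: "AE x in lebesgue_on \<Omega>. (\<lambda>n. D n x) \<longlonglongrightarrow> D0 x"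
  shows "AE x in lebesgue_on \<Omega>. grad W x \<bullet> e \<le> flux_bound f e (D0 x)"
proof (rule fundamental_lemma_le[OF op])
  define H where "H x = flux_bound f e (D0 x)" for x
  have AE\<Omega>: "AE x in lebesgue. x \<in> \<Omega> \<longrightarrow> P x" if "AE x in lebesgue_on \<Omega>. P x" for P
    using that op by (simp add: AE_restrict_space_iff borel_open)
  have Hb: "AE x in lebesgue. x \<in> \<Omega> \<longrightarrow> \<bar>H x\<bar> \<le> half_deriv f R * norm e"
    using AE\<Omega>[OF D0(2)] by eventually_elim (auto simp: H_def intro: flux_bound_abs[OF f f0])
  have Hm: "H \<in> borel_measurable lebesgue"
    unfolding H_def by (intro borel_imp_lebesgue measurable_compose[OF D0(1) flux_bound_borel[OF f]])
  show Hl: "locally_integrable_on \<Omega> (\<lambda>x. flux_bound f e (D0 x))"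
    using locally_integrable_bounded[OF Hm, of \<Omega> "half_deriv f R * norm e"] Hb unfolding H_def by simp
  note GW = lipschitz_has_weak_gradient[OF op V(2)]
  show "locally_integrable_on \<Omega> (\<lambda>x. grad W x \<bullet> e)"
  proof (rule locally_integrable_bounded)
    show "(\<lambda>x. grad W x \<bullet> e) \<in> borel_measurable lebesgue"
      by (intro borel_imp_lebesgue borel_measurable_inner grad_borel lipschitz_on_continuous_on[OF V(2)] borel_measurable_const)
    show "AE x in lebesgue. x \<in> \<Omega> \<longrightarrow> norm (grad W x \<bullet> e) \<le> real DIM(real^2) * C * norm e"
      using grad_bounded[OF V(2)]
    proof (eventually_elim, intro impI)
      fix x assume "norm (grad W x) \<le> real DIM(real^2) * C"
      then show "norm (grad W x \<bullet> e) \<le> real DIM(real^2) * C * norm e"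
        using Cauchy_Schwarz_ineq2[of "grad W x" e] mult_right_mono[of "norm (grad W x)" "real DIM(real^2) * C" "norm e"]
        unfolding real_norm_def by force
    qed
  qed
  fix \<phi> :: "real^2 \<Rightarrow> real" assume \<phi>: "test_function \<Omega> \<phi>" and \<phi>0: "\<And>x. 0 \<le> \<phi> x"
  have \<phi>off: "\<phi> x = 0" "frechet_derivative \<phi> (at x) e = 0" if "x \<notin> \<Omega>" for x
    by (rule test_function_support[OF \<phi>], use that in blast)+
  define a where "a n = (LINT x|lebesgue. (flux (fn n) (D n x) \<bullet> e) * \<phi> x)" for n
  have inta: "integrable lebesgue (\<lambda>x. (flux (fn n) (D n x) \<bullet> e) * \<phi> x)" for n
    by (rule weak_gradient_directional(1)[OF op G \<phi>])
  have a_eq: "a n = - (LINT x|lebesgue. V n x * frechet_derivative \<phi> (at x) e)" for n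
    using weak_gradient_directional(2)[OF op G \<phi>, of n e] unfolding a_def by simp
  have intD: "integrable lebesgue (\<lambda>x. c * frechet_derivative \<phi> (at x) e)" for c :: real
    by (rule integrable_mult_test(2)[OF locally_integrable_continuous[OF continuous_on_const] \<phi>])
  have "(\<lambda>n. LINT x|lebesgue. V n x * frechet_derivative \<phi> (at x) e) \<longlonglongrightarrow> (LINT x|lebesgue. W x * frechet_derivative \<phi> (at x) e)"
  proof (rule integral_dominated_convergence[where w = "\<lambda>x. \<bar>M * frechet_derivative \<phi> (at x) e\<bar>"])
    show "integrable lebesgue (\<lambda>x. \<bar>M * frechet_derivative \<phi> (at x) e\<bar>)" by (intro integrable_abs intD)
    show "(\<lambda>x. V n x * frechet_derivative \<phi> (at x) e) \<in> borel_measurable lebesgue" for n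
      using integrable_mult_test(2)[OF locally_integrable_continuous[OF V(1)] \<phi>] by (rule borel_measurable_integrable)
    show "(\<lambda>x. W x * frechet_derivative \<phi> (at x) e) \<in> borel_measurable lebesgue"
      using integrable_mult_test(2)[OF locally_integrable_continuous[OF lipschitz_on_continuous_on[OF V(2)]] \<phi>]
      by (rule borel_measurable_integrable)
    show "AE x in lebesgue. (\<lambda>n. V n x * frechet_derivative \<phi> (at x) e) \<longlonglongrightarrow> W x * frechet_derivative \<phi> (at x) e"
    proof (rule AE_I2)
      fix x
      show "(\<lambda>n. V n x * frechet_derivative \<phi> (at x) e) \<longlonglongrightarrow> W x * frechet_derivative \<phi> (at x) e"
        by (cases "x \<in> \<Omega>") (auto simp: \<phi>off intro!: tendsto_mult VW)
    qed
    show "AE x in lebesgue. norm (V n x * frechet_derivative \<phi> (at x) e) \<le> \<bar>M * frechet_derivative \<phi> (at x) e\<bar>" for n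
    proof (rule AE_I2)
      fix x
      show "norm (V n x * frechet_derivative \<phi> (at x) e) \<le> \<bar>M * frechet_derivative \<phi> (at x) e\<bar>"
      proof (cases "x \<in> \<Omega>")
        case True
        then have "\<bar>V n x\<bar> \<le> \<bar>M\<bar>" using VM[OF True, of n] by linarith
        then show ?thesis by (simp add: abs_mult mult_right_mono)
      qed (simp add: \<phi>off)
    qed
  qed
  then have "a \<longlonglongrightarrow> - (LINT x|lebesgue. W x * frechet_derivative \<phi> (at x) e)"
    unfolding a_eq[abs_def] by (rule tendsto_minus)
  then have a_lim: "a \<longlonglongrightarrow> (LINT x|lebesgue. (grad W x \<bullet> e) * \<phi> x)"
    using weak_gradient_directional(2)[OF op GW \<phi>, of e] by simp
  have intH: "integrable lebesgue (\<lambda>x. H x * \<phi> x)"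
    unfolding H_def by (rule integrable_mult_test(1)[OF Hl \<phi>])
  define p where "p n x = max 0 ((flux (fn n) (D n x) \<bullet> e) * \<phi> x - H x * \<phi> x)" for n x
  have pm: "p n \<in> borel_measurable lebesgue" for n
    unfolding p_def using inta[of n] intH
    by (intro borel_measurable_max borel_measurable_const borel_measurable_diff borel_measurable_integrable)
  have p_eq: "p n x = max 0 (flux (fn n) (D n x) \<bullet> e - H x) * \<phi> x" for n x
    unfolding p_def left_diff_distrib[symmetric] using \<phi>0[of x]
    by (auto simp: max_def mult_le_0_iff zero_le_mult_iff)
  define w where "w x = ((B * norm e) + half_deriv f R * norm e) * \<phi> x" for x
  have intw: "integrable lebesgue w"
    unfolding w_def by (rule integrable_mult_test(1)[OF locally_integrable_continuous[OF continuous_on_const] \<phi>])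
  have p_lim: "AE x in lebesgue. (\<lambda>n. p n x) \<longlonglongrightarrow> 0"
    using AE\<Omega>[OF DD]
  proof eventually_elim
    fix x assume x: "x \<in> \<Omega> \<longrightarrow> (\<lambda>n. D n x) \<longlonglongrightarrow> D0 x"
    show "(\<lambda>n. p n x) \<longlonglongrightarrow> 0"
    proof (cases "x \<in> \<Omega>")
      case True
      have "(\<lambda>n. max 0 (flux (fn n) (D n x) \<bullet> e - H x)) \<longlonglongrightarrow> 0"
        unfolding H_def using x True by (intro flux_excess_tendsto_0[OF f fn fn0 lim]) auto
      then have "(\<lambda>n. max 0 (flux (fn n) (D n x) \<bullet> e - H x) * \<phi> x) \<longlonglongrightarrow> 0 * \<phi> x" by (intro tendsto_mult tendsto_const)
      then show ?thesis unfolding p_eq by simp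
    qed (simp add: p_def \<phi>off)
  qed
  have p_le: "AE x in lebesgue. norm (p n x) \<le> w x" for n
    using Hb AE\<Omega>[OF GB[of n]]
  proof eventually_elim
    fix x
    assume x: "x \<in> \<Omega> \<longrightarrow> \<bar>H x\<bar> \<le> half_deriv f R * norm e" "x \<in> \<Omega> \<longrightarrow> norm (flux (fn n) (D n x)) \<le> B"
    show "norm (p n x) \<le> w x"
    proof (cases "x \<in> \<Omega>")
      case True
      have "\<bar>flux (fn n) (D n x) \<bullet> e\<bar> \<le> B * norm e"
        using Cauchy_Schwarz_ineq2[of "flux (fn n) (D n x)" e] mult_right_mono[of "norm (flux (fn n) (D n x))" B "norm e"] x True
        by force
      then have "max 0 (flux (fn n) (D n x) \<bullet> e - H x) \<le> B * norm e + half_deriv f R * norm e" using x True by auto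
      then show ?thesis unfolding p_eq w_def using \<phi>0[of x] by (simp add: mult_right_mono abs_mult)
    qed (simp add: p_def w_def \<phi>off)
  qed
  have int_p: "integrable lebesgue (p n)" for n
    by (rule Bochner_Integration.integrable_bound[OF intw pm]) (use p_le[of n] in \<open>eventually_elim, simp\<close>)
  have b_lim: "(\<lambda>n. LINT x|lebesgue. p n x) \<longlonglongrightarrow> (LINT x|(lebesgue :: (real^2) measure). 0)"
    by (rule integral_dominated_convergence[OF _ pm intw p_lim p_le]) simp
  have le: "a n \<le> (LINT x|lebesgue. H x * \<phi> x) + (LINT x|lebesgue. p n x)" for n
  proof -
    have "a n \<le> (LINT x|lebesgue. H x * \<phi> x + p n x)"
      unfolding a_def
      by (rule integral_mono[OF inta Bochner_Integration.integrable_add[OF intH int_p]]) (auto simp: p_def)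
    then show ?thesis by (simp add: Bochner_Integration.integral_add[OF intH int_p])
  qed
  have "(\<lambda>n. (LINT x|lebesgue. H x * \<phi> x) + (LINT x|lebesgue. p n x)) \<longlonglongrightarrow> (LINT x|lebesgue. H x * \<phi> x) + (LINT x|(lebesgue :: (real^2) measure). 0)"
    by (intro tendsto_add tendsto_const b_lim)
  then show "(LINT x|lebesgue. (grad W x \<bullet> e) * \<phi> x) \<le> (LINT x|lebesgue. flux_bound f e (D0 x) * \<phi> x)"
    using LIMSEQ_le[OF a_lim] le unfolding H_def by auto
qed

lemma flux_bound_all_directions:
  assumes f: "regular_Lagrangean f" and le: "\<And>e. e \<in> E \<Longrightarrow> q \<bullet> e \<le> flux_bound f e p"
    and E: "closure E = UNIV"
  shows "p \<noteq> 0 \<Longrightarrow> q = flux f p" and "p = 0 \<Longrightarrow> norm q \<le> half_deriv f 0"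
proof -
  have cont: "continuous_on UNIV (\<lambda>e. flux_bound f e p - q \<bullet> e)"
    unfolding flux_bound_def by (cases "p = 0") (auto intro!: continuous_intros)
  have all: "q \<bullet> e \<le> flux_bound f e p" for e
  proof -
    have "closed {e. 0 \<le> flux_bound f e p - q \<bullet> e}"
      by (rule closed_Collect_le[OF continuous_on_const cont])
    moreover have "E \<subseteq> {e. 0 \<le> flux_bound f e p - q \<bullet> e}" using le by auto
    ultimately have "closure E \<subseteq> {e. 0 \<le> flux_bound f e p - q \<bullet> e}" by (rule closure_minimal[rotated])
    then show ?thesis using E by auto
  qed
  show "q = flux f p" if "p \<noteq> 0"
  proof -
    have "(q - flux f p) \<bullet> (q - flux f p) \<le> 0"
      using all[of "q - flux f p"] that by (simp add: flux_bound_def inner_diff_left)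
    then have "q - flux f p = 0" using inner_ge_zero[of "q - flux f p"] by (metis antisym inner_eq_zero_iff)
    then show ?thesis by simp
  qed
  show "norm q \<le> half_deriv f 0" if "p = 0"
  proof (cases "q = 0")
    case True
    obtain b :: "real^2" where b: "norm b = 1" using vector_choose_size[of 1] by auto
    show ?thesis using all[of b] that True b by (simp add: flux_bound_def)
  next
    case False
    have "norm q * norm q \<le> half_deriv f 0 * norm q"
      using all[of q] that by (simp add: flux_bound_def power2_norm_eq_inner[symmetric] power2_eq_square)
    then show ?thesis using False by simp
  qed
qed

text \<open>Inverting the relation between the two gradients, with the derivative of the conjugate.\<close>

lemma dual_pointwise:
  fixes p q :: "real^2"
  assumes f: "regular_Lagrangean f" and f0: "half_deriv f 0 > 0"
    and ne: "p \<noteq> 0 \<Longrightarrow> q = flux f p" and z: "p = 0 \<Longrightarrow> norm q \<le> half_deriv f 0"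
  shows "p $ 1 = half_deriv (conjugate_Lagrangean f) (norm q) * (q $ 2 / norm q)"
    and "p $ 2 = - half_deriv (conjugate_Lagrangean f) (norm q) * (q $ 1 / norm q)"
proof -
  have "p $ 1 = half_deriv (conjugate_Lagrangean f) (norm q) * (q $ 2 / norm q) \<and>
      p $ 2 = - half_deriv (conjugate_Lagrangean f) (norm q) * (q $ 1 / norm q)"
  proof (cases "p = 0")
    case True
    have "half_deriv (conjugate_Lagrangean f) (norm q) = 0"
      using z[OF True] by (intro half_deriv_conjugate[OF f]) (auto simp: supports_at_def)
    then show ?thesis using True by simp
  next
    case False
    have pos: "0 < half_deriv f (norm p)" using regular_deriv_mono[OF f, of 0 "norm p"] f0 by simp
    have nq: "norm q = half_deriv f (norm p)" unfolding ne[OF False] flux_def using pos False by simp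
    have g: "half_deriv (conjugate_Lagrangean f) (norm q) = norm p"
      unfolding nq using pos by (intro half_deriv_conjugate[OF f]) (auto simp: supports_at_def)
    have "q $ 1 / norm q = - (p $ 2) / norm p" "q $ 2 / norm q = p $ 1 / norm p"
      unfolding nq unfolding ne[OF False] flux_def using pos by simp_all
    then show ?thesis unfolding g using False by simp
  qed
  then show "p $ 1 = half_deriv (conjugate_Lagrangean f) (norm q) * (q $ 2 / norm q)"
    "p $ 2 = - half_deriv (conjugate_Lagrangean f) (norm q) * (q $ 1 / norm q)" by auto
qed


section \<open>Conclusion\<close>

text \<open>The gradients of the minimizers are bounded uniformly in \<open>n\<close>, hence so are the fluxes, and the
  fluxes are the gradients of the stream functions.  On a convex domain a gradient bound is a
  Lipschitz bound.  On any other domain the boundary data are affine, all minimizers coincide with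
  the same affine function, and the stream functions are affine as well.\<close>

lemma stream_functions_equilipschitz:
  fixes \<Omega> :: "(real^2) set"
  assumes op: "open \<Omega>" and conn: "connected \<Omega>" and ne: "\<Omega> \<noteq> {}" and bdd: "bounded \<Omega>"
    and Q: "Q > 0" "bounded_slope_condition \<Omega> \<psi> Q"
    and f: "regular_Lagrangean f"
    and fn: "\<And>n. regular_Lagrangean (fn n)" and fn0: "\<And>n. half_deriv (fn n) 0 = 0"
    and lim: "uniform_limit {0..} fn f sequentially"
    and min: "\<And>n. is_minimizer \<Omega> \<psi> (fn n) (un n)"
    and vn: "\<And>n. vn n \<in> Lip (closure \<Omega>)"
    and conj: "\<And>n. conjugate_distributional \<Omega> (fn n) (un n) (vn n)"
  shows "\<exists>B. \<forall>n. B-lipschitz_on (closure \<Omega>) (vn n) \<and>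
    (AE x in lebesgue_on \<Omega>. norm (flux (fn n) (weak_gradient \<Omega> (un n) x)) \<le> B)"
proof -
  define R where "R = real DIM(real^2) * Q"
  have R: "R > 0" unfolding R_def using Q by simp
  have grad_le: "AE x in lebesgue_on \<Omega>. norm (weak_gradient \<Omega> (un n) x) \<le> R" for n
    unfolding R_def by (rule minimizer_gradient_bound[OF op bdd Q fn fn0 min])
  have ne': "closure \<Omega> \<noteq> {}" using ne by simp
  have "\<exists>V C. C-lipschitz_on UNIV V \<and> (\<forall>x\<in>closure \<Omega>. V x = vn n x)" for n
  proof -
    obtain C where "C-lipschitz_on (closure \<Omega>) (vn n)" using vn[of n] unfolding Lip_def by blast
    then show ?thesis using lipschitz_extension[OF _ ne'] by metis
  qed
  then obtain V :: "nat \<Rightarrow> real^2 \<Rightarrow> real" and C :: "nat \<Rightarrow> real" where V: "\<And>n. (C n)-lipschitz_on UNIV (V n)" "\<And>n x. x \<in> closure \<Omega> \<Longrightarrow> V n x = vn n x"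
    by metis
  have cV: "continuous_on UNIV (V n)" for n by (rule lipschitz_on_continuous_on[OF V(1)])
  have eqV: "vn n x = V n x" if "x \<in> \<Omega>" for n x using V(2)[of x n] that closure_subset[of \<Omega>] by auto
  have GV: "has_weak_gradient \<Omega> (V n) (\<lambda>x. flux (fn n) (weak_gradient \<Omega> (un n) x))" for n
    by (rule has_weak_gradient_cong[OF conjugate_weak_gradient[OF conj] eqV])
  have flux_le: "norm (flux (fn n) p) \<le> A" if "\<forall>n. \<forall>r. 0 \<le> r \<and> r \<le> S \<longrightarrow> 0 \<le> half_deriv (fn n) r \<and> half_deriv (fn n) r \<le> A" "norm p \<le> S" for n p A S
    using norm_flux_le[of "fn n" p] that by (smt (verit) norm_ge_zero)
  obtain B where B: "\<forall>n. \<forall>r. 0 \<le> r \<and> r \<le> R \<longrightarrow> 0 \<le> half_deriv (fn n) r \<and> half_deriv (fn n) r \<le> B"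
    using deriv_bounded_on[OF f fn fn0 lim R] by blast
  have B0: "B \<ge> 0" using B R by (metis less_imp_le order_refl order_trans)
  have bd: "AE x in lebesgue_on \<Omega>. norm (flux (fn n) (weak_gradient \<Omega> (un n) x)) \<le> B" for n
    using grad_le[of n] by eventually_elim (rule flux_le[OF B])
  have "\<exists>A\<ge>B. \<forall>n. \<forall>x\<in>\<Omega>. \<forall>y\<in>\<Omega>. V n y - V n x \<le> A * norm (y - x)"
    using bounded_slope_condition_dichotomy[OF op ne bdd Q]
  proof
    assume conv: "convex \<Omega>"
    have "V n y - V n x \<le> B * norm (y - x)" if "x \<in> \<Omega>" "y \<in> \<Omega>" for n x y
      by (rule lipschitz_of_weak_gradient_convex[OF op conv cV GV bd that])
    then show ?thesis by blast
  next
    \<comment> \<open>here the domain may fail to be convex, but all gradients are constant\<close>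
    assume "\<exists>l c. \<forall>x\<in>frontier \<Omega>. \<psi> x = l \<bullet> x + c"
    then obtain l c where l: "\<And>x. x \<in> frontier \<Omega> \<Longrightarrow> \<psi> x = l \<bullet> x + c" by blast
    have "norm l + 1 > 0" by (simp add: add_nonneg_pos)
    then obtain A where A: "\<forall>n. \<forall>r. 0 \<le> r \<and> r \<le> norm l + 1 \<longrightarrow> 0 \<le> half_deriv (fn n) r \<and> half_deriv (fn n) r \<le> A"
      using deriv_bounded_on[OF f fn fn0 lim] by blast
    have "V n y - V n x \<le> max A B * norm (y - x)" if "x \<in> \<Omega>" "y \<in> \<Omega>" for n x y
    proof -
      have "AE x in lebesgue_on \<Omega>. weak_gradient \<Omega> (un n) x = l"
        by (rule minimizer_affine_data[OF op bdd fn fn0 min l])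
      then have "AE x in lebesgue_on \<Omega>. flux (fn n) (weak_gradient \<Omega> (un n) x) = flux (fn n) l"
        by eventually_elim simp
      then have "V n y - V n x = flux (fn n) l \<bullet> (y - x)"
        by (rule affine_of_constant_weak_gradient[OF op conn cV GV _ that])
      also have "\<dots> \<le> norm (flux (fn n) l) * norm (y - x)" by (rule norm_cauchy_schwarz)
      also have "\<dots> \<le> max A B * norm (y - x)"
        using flux_le[OF A, of l n] by (intro mult_right_mono) auto
      finally show ?thesis .
    qed
    then show ?thesis by (intro exI[of _ "max A B"]) auto
  qed
  then obtain A where A: "A \<ge> B" "\<And>n x y. x \<in> \<Omega> \<Longrightarrow> y \<in> \<Omega> \<Longrightarrow> V n y - V n x \<le> A * norm (y - x)" by blast
  have "A-lipschitz_on (closure \<Omega>) (vn n)" for n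
  proof -
    have "A-lipschitz_on \<Omega> (V n)"
    proof (rule lipschitz_onI)
      fix x y assume "x \<in> \<Omega>" "y \<in> \<Omega>"
      then show "dist (V n x) (V n y) \<le> A * dist x y"
        using A(2)[of x y n] A(2)[of y x n] by (simp add: dist_real_def dist_norm norm_minus_commute abs_le_iff)
    qed (use A B0 in simp)
    then have "A-lipschitz_on (closure \<Omega>) (V n)"
      by (rule lipschitz_on_closure) (rule continuous_on_subset[OF cV subset_UNIV])
    then show ?thesis by (rule lipschitz_on_transform) (simp add: V(2))
  qed
  moreover have "AE x in lebesgue_on \<Omega>. norm (flux (fn n) (weak_gradient \<Omega> (un n) x)) \<le> A" for n
    using bd[of n] by eventually_elim (use A(1) in simp)
  ultimately show ?thesis by blast
qed

lemma AE_lebesgue_on: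
  assumes op: "open \<Omega>" and P: "AE x in lebesgue. P x"
  shows "AE x in lebesgue_on \<Omega>. P x"
proof -
  have "AE x in lebesgue. x \<in> \<Omega> \<longrightarrow> P x" using P by eventually_elim simp
  then show ?thesis using op by (simp add: AE_restrict_space_iff borel_open)
qed

lemma W1_infinity_lipschitz:
  fixes \<Omega> :: "'a::euclidean_space set"
  assumes op: "open \<Omega>" and W: "C-lipschitz_on UNIV W" and eq: "\<And>x. x \<in> \<Omega> \<Longrightarrow> W x = w x"
    and M: "\<And>x. x \<in> \<Omega> \<Longrightarrow> \<bar>w x\<bar> \<le> M"
  shows "W1_infinity \<Omega> w"
  unfolding W1_infinity_def
proof (intro conjI exI)
  note cW = lipschitz_on_continuous_on[OF W]
  have "W \<in> borel_measurable (lebesgue_on \<Omega>)"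
    by (intro measurable_restrict_space1 borel_imp_lebesgue borel_measurable_continuous_onI cW)
  then have "w \<in> borel_measurable (lebesgue_on \<Omega>)"
    by (rule measurable_cong[THEN iffD1, rotated]) (use eq in auto)
  moreover have "AE x in lebesgue_on \<Omega>. norm (w x) \<le> M" using M by (intro AE_I2) auto
  ultimately show "ess_bounded_on \<Omega> w" unfolding ess_bounded_on_def by blast
  show "has_weak_gradient \<Omega> w (grad W)"
    by (rule has_weak_gradient_cong[OF lipschitz_has_weak_gradient[OF op W] eq])
  have "grad W \<in> borel_measurable (lebesgue_on \<Omega>)"
    by (intro measurable_restrict_space1 borel_imp_lebesgue grad_borel cW)
  moreover have "AE x in lebesgue_on \<Omega>. norm (grad W x) \<le> real DIM('a) * C"
    by (rule AE_lebesgue_on[OF op grad_bounded[OF W]])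
  ultimately show "ess_bounded_on \<Omega> (grad W)" unfolding ess_bounded_on_def by blast
qed

theorem theorem3p5:
  fixes \<Omega> :: "(real^2) set"
    and \<psi> :: "real^2 \<Rightarrow> real"
    and f :: "real \<Rightarrow> real" and fn :: "nat \<Rightarrow> real \<Rightarrow> real"
    and u :: "real^2 \<Rightarrow> real" and un vn :: "nat \<Rightarrow> real^2 \<Rightarrow> real"
    and Q :: real
  assumes "open \<Omega>" "connected \<Omega>" "\<Omega> \<noteq> {}" "bounded \<Omega>" "simply_connected \<Omega>"
    and "continuous_on (frontier \<Omega>) \<psi>"
    and "Q > 0" "bounded_slope_condition \<Omega> \<psi> Q"
    and "admissible_Lagrangean f"
    and "\<And>n. regular_Lagrangean (fn n)"
    and "\<And>n. half_deriv (fn n) 0 = 0"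
    and "uniform_limit {0..} fn f sequentially"
    and "is_minimizer \<Omega> \<psi> f u"
    and "\<And>n. is_minimizer \<Omega> \<psi> (fn n) (un n)"
    and "\<And>n. vn n \<in> Lip (closure \<Omega>)"
    and "\<And>n. (LINT x|lebesgue_on \<Omega>. vn n x) = 0"
    and "\<And>n. conjugate_distributional \<Omega> (fn n) (un n) (vn n)"
    and "AE x in lebesgue_on \<Omega>.
           (\<lambda>n. weak_gradient \<Omega> (un n) x) \<longlonglongrightarrow> weak_gradient \<Omega> u x"
  shows "\<exists>r v. strict_mono (r :: nat \<Rightarrow> nat) \<and>
           uniform_limit (closure \<Omega>) (\<lambda>k. vn (r k)) v sequentially \<and>
           W1_infinity \<Omega> v \<and>
           dual_system_ae \<Omega> (conjugate_Lagrangean f) u v"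
proof -
  note op = assms(1) and fn = assms(10) and fn0 = assms(11) and ulim = assms(12)
  have f: "regular_Lagrangean f" and f0: "half_deriv f 0 > 0"
    using assms(9) unfolding admissible_Lagrangean_def by auto
  obtain B where B: "\<And>n. B-lipschitz_on (closure \<Omega>) (vn n)"
    "\<And>n. AE x in lebesgue_on \<Omega>. norm (flux (fn n) (weak_gradient \<Omega> (un n) x)) \<le> B"
    using stream_functions_equilipschitz[OF assms(1-4,7,8) f fn fn0 ulim assms(14,15,17)] by blast
  have ne: "closure \<Omega> \<noteq> {}" using assms(3) by simp
  have sub: "\<Omega> \<subseteq> closure \<Omega>" by (rule closure_subset)
  obtain R where R: "\<Omega> \<subseteq> cball 0 R" using assms(4) by (metis bounded_iff mem_cball_0 subsetI)
  define M where "M = B * (2 * R)"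
  have M: "\<bar>vn n x\<bar> \<le> M" if "x \<in> closure \<Omega>" for n x
    unfolding M_def by (rule mean_zero_lipschitz_bound[OF op assms(3) R B(1) assms(16) that])
  have "compact (closure \<Omega>)" using assms(4) by simp
  then obtain r v where r: "strict_mono (r :: nat \<Rightarrow> nat)"
    and ul: "uniform_limit (closure \<Omega>) (\<lambda>k. vn (r k)) v sequentially" and v: "B-lipschitz_on (closure \<Omega>) v"
    using equilipschitz_subsequence[of "closure \<Omega>" B vn M] B(1) M by blast
  have vlim: "(\<lambda>k. vn (r k) x) \<longlonglongrightarrow> v x" if "x \<in> closure \<Omega>" for x
    using tendsto_uniform_limitI[OF ul that] .
  have vM: "\<bar>v x\<bar> \<le> M" if "x \<in> closure \<Omega>" for x
    using tendsto_rabs[OF vlim[OF that]] by (rule LIMSEQ_le_const2) (use M that in auto)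
  obtain W where W: "B-lipschitz_on UNIV W" "\<And>x. x \<in> closure \<Omega> \<Longrightarrow> W x = v x"
    using lipschitz_extension[OF v ne] by blast
  have Wv: "W x = v x" if "x \<in> \<Omega>" for x using W(2) that sub by auto
  have "\<exists>V. B-lipschitz_on UNIV V \<and> (\<forall>x\<in>closure \<Omega>. V x = vn n x)" for n
    using lipschitz_extension[OF B(1)[of n] ne] by metis
  then obtain V :: "nat \<Rightarrow> real^2 \<Rightarrow> real" where V: "\<And>n. B-lipschitz_on UNIV (V n)" "\<And>n x. x \<in> closure \<Omega> \<Longrightarrow> V n x = vn n x" by metis
  have Vv: "vn n x = V n x" if "x \<in> \<Omega>" for n x using V(2)[of x n] that sub by auto
  obtain C U where U: "C-lipschitz_on UNIV U" "\<And>x. x \<in> closure \<Omega> \<Longrightarrow> U x = u x"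
    using minimizer_extension[OF assms(13,3)] by blast
  have Uu: "U x = u x" if "x \<in> \<Omega>" for x using U(2) that sub by auto
  have Du: "AE x in lebesgue_on \<Omega>. weak_gradient \<Omega> u x = grad U x"
    by (rule weak_gradient_extension(2)[OF op U(1) Uu])
  have Dv: "AE x in lebesgue_on \<Omega>. weak_gradient \<Omega> v x = grad W x"
    by (rule weak_gradient_extension(2)[OF op W(1) Wv])
  have le: "AE x in lebesgue_on \<Omega>. grad W x \<bullet> e \<le> flux_bound f e (grad U x)" for e
  proof (rule weak_limit_flux_le[OF op f f0, where fn = "\<lambda>k. fn (r k)" and V = "\<lambda>k. V (r k)" and M = M
        and D = "\<lambda>k. weak_gradient \<Omega> (un (r k))" and B = B])
    show "uniform_limit {0..} (\<lambda>k. fn (r k)) f sequentially"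
      unfolding uniform_limit_iff
    proof (intro allI impI)
      fix \<epsilon> :: real assume "\<epsilon> > 0"
      then have "\<forall>\<^sub>F n in sequentially. \<forall>x\<in>{0..}. dist (fn n x) (f x) < \<epsilon>" by (rule uniform_limitD[OF ulim])
      then show "\<forall>\<^sub>F k in sequentially. \<forall>x\<in>{0..}. dist (fn (r k) x) (f x) < \<epsilon>" by (rule eventually_subseq[OF r])
    qed
    show "continuous_on UNIV (V (r k))" for k by (rule lipschitz_on_continuous_on[OF V(1)])
    show "\<bar>V (r k) x\<bar> \<le> M" if "x \<in> \<Omega>" for k x using M[of x "r k"] Vv[OF that] sub that by auto
    show "(\<lambda>k. V (r k) x) \<longlonglongrightarrow> W x" if "x \<in> \<Omega>" for x
      using vlim[of x] Vv[OF that] Wv[OF that] sub that by auto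
    show "has_weak_gradient \<Omega> (V (r k)) (\<lambda>x. flux (fn (r k)) (weak_gradient \<Omega> (un (r k)) x))" for k
      by (rule has_weak_gradient_cong[OF conjugate_weak_gradient[OF assms(17)] Vv])
    show "grad U \<in> borel_measurable borel" by (rule grad_borel[OF lipschitz_on_continuous_on[OF U(1)]])
    show "AE x in lebesgue_on \<Omega>. norm (grad U x) \<le> real DIM(real^2) * C"
      by (rule AE_lebesgue_on[OF op grad_bounded[OF U(1)]])
    show "AE x in lebesgue_on \<Omega>. (\<lambda>k. weak_gradient \<Omega> (un (r k)) x) \<longlonglongrightarrow> grad U x"
      using assms(18) Du
    proof eventually_elim
      fix x assume "(\<lambda>n. weak_gradient \<Omega> (un n) x) \<longlonglongrightarrow> weak_gradient \<Omega> u x" "weak_gradient \<Omega> u x = grad U x"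
      then show "(\<lambda>k. weak_gradient \<Omega> (un (r k)) x) \<longlonglongrightarrow> grad U x"
        using LIMSEQ_subseq_LIMSEQ[OF _ r] by (fastforce simp: comp_def)
    qed
  qed (use fn fn0 W(1) B(2) in auto)
  \<comment> \<open>countably many directions suffice, so a single null set can be discarded\<close>
  obtain E :: "(real^2) set" where E: "countable E"
    and dense: "\<And>X. open X \<Longrightarrow> X \<noteq> {} \<Longrightarrow> \<exists>e\<in>E. e \<in> X"
    by (rule countable_dense_setE) blast
  have E_dense: "closure E = UNIV"
    using dense[of "- closure E"] closure_subset[of E] by auto
  have "\<forall>e\<in>E. AE x in lebesgue_on \<Omega>. grad W x \<bullet> e \<le> flux_bound f e (grad U x)" using le by blast
  then have "AE x in lebesgue_on \<Omega>. \<forall>e\<in>E. grad W x \<bullet> e \<le> flux_bound f e (grad U x)"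
    using E by (simp add: AE_ball_countable)
  then have "AE x in lebesgue_on \<Omega>.
      weak_gradient \<Omega> u x $ 1 = half_deriv (conjugate_Lagrangean f) (norm (weak_gradient \<Omega> v x)) *
          (weak_gradient \<Omega> v x $ 2 / norm (weak_gradient \<Omega> v x)) \<and>
      weak_gradient \<Omega> u x $ 2 = - half_deriv (conjugate_Lagrangean f) (norm (weak_gradient \<Omega> v x)) *
          (weak_gradient \<Omega> v x $ 1 / norm (weak_gradient \<Omega> v x))"
    using Du Dv
  proof eventually_elim
    fix x
    assume le: "\<forall>e\<in>E. grad W x \<bullet> e \<le> flux_bound f e (grad U x)"
      and eq: "weak_gradient \<Omega> u x = grad U x" "weak_gradient \<Omega> v x = grad W x"
    have le': "grad W x \<bullet> e \<le> flux_bound f e (grad U x)" if "e \<in> E" for e using le that by blast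
    note lim = flux_bound_all_directions[OF f le' E_dense]
    show "weak_gradient \<Omega> u x $ 1 = half_deriv (conjugate_Lagrangean f) (norm (weak_gradient \<Omega> v x)) *
          (weak_gradient \<Omega> v x $ 2 / norm (weak_gradient \<Omega> v x)) \<and>
      weak_gradient \<Omega> u x $ 2 = - half_deriv (conjugate_Lagrangean f) (norm (weak_gradient \<Omega> v x)) *
          (weak_gradient \<Omega> v x $ 1 / norm (weak_gradient \<Omega> v x))"
      unfolding eq using dual_pointwise[OF f f0 lim] by blast
  qed
  then have "dual_system_ae \<Omega> (conjugate_Lagrangean f) u v"
    unfolding dual_system_ae_def Let_def .
  moreover have "W1_infinity \<Omega> v"
    by (rule W1_infinity_lipschitz[OF op W(1) Wv]) (use vM sub in auto)
  ultimately show ?thesis using r ul by blast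
qed

end
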